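(* Let $\mathcal{H}$ be an infinite dimensional separable complex Hilbert space and let $\mathcal{F}=\{f_i\}_{i\ge1}$ be a frame in a closed subspace $\mathcal{K}\subseteq\mathcal{H}$ such that $\mathcal{Q}_{\mathcal{F}}\neq\emptyset$. Let $F$ be its synthesis operator and $F=U|F|$ the polar decomposition. Set $n_1:=\dim(\ker(F))$, $n_2:=\dim(\ker(F)^\perp)$ and $n_3:=\dim(\operatorname{ran}(F)^\perp)$. Then $\mathcal{Q}_{\mathcal{F}}$ can be expressed as the union of infinitely many connected components labeled as follows: $$\mathcal{Q}_{\mathcal{F}}=\bigcup_{k\in\mathbb{J}}\mathcal{Q}_{\mathcal{F}}^k,\qquad \mathbb{J}=[-\min\{n_1,n_3\},\,n_2]\cap\mathbb{Z}.$$ These connected components have the following equivalent characterizations: $$\mathcal{Q}_{\mathcal{F}}^k=\{\{x_i\}\in\mathcal{Q}_{\mathcal{F}}: j(U^*U,X^*X)=k\}=\{\{x_i\}\in\mathcal{Q}_{\mathcal{F}}: j(UU^*,XX^* )=k\}$$ $$=\{\{x_i\}\in\mathcal{Q}_{\mathcal{F}}: \operatorname{index}(XU^*|_{\mathcal{K}}:\mathcal{K}\to\mathcal{L})=k,\ \mathcal{L}=\overline{\operatorname{span}}\{x_i\}\},$$ where $X$ denotes the synthesis operator of each Parseval frame $\{x_i\}$. Furthermore, each connected component is an orbit of the action of $\mathcal{U}_2(\mathcal{H})\times\mathcal{U}_2(\ell^2)$ on $\mathcal{Q}_{\mathcal{F}}$ given by $(V,W)\cdot\{x_i\}=\{VX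W^*e_i\}$.
   Context: A frame in a closed subspace $\mathcal{K}\subseteq\mathcal{H}$ is a sequence $\{f_i\}_{i\ge1}$ in $\mathcal{K}$ for which there are $A,B>0$ with $A\|f\|^2\le\sum_{i=1}^\infty|\langle f,f_i\rangle|^2\le B\|f\|^2$ for all $f\in\mathcal{K}$; it is a Parseval frame if one can take $A=B=1$. The zero subspace is allowed (the zero sequence is a Parseval frame in $\{0\}$). The synthesis operator of $\{f_i\}$ is the bounded operator $F:\ell^2\to\mathcal{H}$, $F(e_i)=f_i$, with $\{e_i\}$ the standard basis of $\ell^2$; it has closed range $\mathcal{K}$, and for a Parseval frame it is a partial isometry. In the polar decomposition $F=U|F|$, $U$ is the unique partial isometry with $F=U|F|$ and $\ker(U)=\ker(F)$. $\mathcal{Q}_{\mathcal{F}}$ is the set of all Parseval frames $\{x_i\}$ in closed subspaces $\mathcal{L}$ of $\mathcal{H}$ with $\sum_{i=1}^\infty\|x_i-f_i\|^2<\infty$, with the metric $d(\{x_i\},\{y_i\})=\left(\sum_{i=1}^\infty\|x_i-y_i\|^2\right)^{1/2}$. For orthogonal projections $P,Q$ on a Hilbert space, $(P,Q)$ is a Fredholm pair if $QP|_{\operatorname{ran}(P)}:\operatorname{ran}(P)\to\operatorname{ran}(Q)$ is Fredholm; its index is $j(P,Q)=\operatorname{index}(QP|_{\operatorname{ran}(P)})=\dim(\ker(Q)\cap\operatorname{ran}(P))-\dim(\operatorname{ran}(Q)\cap\ker(P))$. For a Hilbert space $\mathcal{E}$, $\mathcal{U}_2(\mathcal{E})$ is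 the group of unitary operators $L$ on $\mathcal{E}$ such that $L-I$ is Hilbert-Schmidt. Convention: the interval defining $\mathbb{J}$ contains all negative integers when $n_1=n_3=\infty$, and all positive integers when $n_2=\infty$. *)

theory Defs
  imports "HOL-Analysis.Analysis" "HOL-Algebra.Group_Action"
begin

text \<open>The inner product is linear in its first argument.\<close>

class complex_inner = real_normed_vector +
  fixes scaleC :: "complex \<Rightarrow> 'a \<Rightarrow> 'a"  (infixr \<open>*\<^sub>C\<close> 75)
    and cinner :: "'a \<Rightarrow> 'a \<Rightarrow> complex"
  assumes scaleC_add_right: "a *\<^sub>C (x + y) = a *\<^sub>C x + a *\<^sub>C y"
    and scaleC_add_left: "(a + b) *\<^sub>C x = a *\<^sub>C x + b *\<^sub>C x"
    and scaleC_scaleC: "a *\<^sub>C (b *\<^sub>C x) = (a * b) *\<^sub>C x"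
    and scaleC_of_real: "complex_of_real r *\<^sub>C x = r *\<^sub>R x"
    and cinner_commute: "cinner x y = cnj (cinner y x)"
    and cinner_add_left: "cinner (x + y) z = cinner x z + cinner y z"
    and cinner_scaleC_left: "cinner (a *\<^sub>C x) y = a * cinner x y"
    and cinner_self: "cinner x x = complex_of_real ((norm x)\<^sup>2)"

class chilbert_space = complex_inner + complete_space

global_interpretation complex_vector: vector_space "scaleC :: complex \<Rightarrow> 'a \<Rightarrow> 'a::complex_inner"
  defines csubspace = complex_vector.subspace
    and cspan = complex_vector.span
    and cdim = complex_vector.dim
    and cdependent = complex_vector.dependent
    and crepresentation = complex_vector.representation
    and cextend_basis = complex_vector.extend_basis
proof unfold_locales
  fix a b :: complex and x y :: 'a
  show "1 *\<^sub>C x = x"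
    using scaleC_of_real[of 1 x] by simp
qed (simp_all add: scaleC_add_right scaleC_add_left scaleC_scaleC)

definition closed_csubspace :: "'a::complex_inner set \<Rightarrow> bool" where
  "closed_csubspace S \<longleftrightarrow> csubspace S \<and> closed S"

definition ortho_compl :: "'a::complex_inner set \<Rightarrow> 'a set" where
  "ortho_compl S = {x. \<forall>y\<in>S. cinner x y = 0}"

text \<open>
  Dimension of a closed subspace of a separable Hilbert space. Finite Hilbert dimension and finite
  algebraic dimension agree, and all infinite (hence countable) Hilbert dimensions are identified
  with \<open>\<infinity>\<close>.
\<close>

definition hdim :: "'a::complex_inner set \<Rightarrow> enat" where
  "hdim S = (if \<exists>B. finite B \<and> S \<subseteq> cspan B then enat (cdim S) else \<infinity>)"

definition orthonormal_basis :: "'a::complex_inner set \<Rightarrow> bool" where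
  "orthonormal_basis B \<longleftrightarrow>
     (\<forall>x\<in>B. norm x = 1) \<and> (\<forall>x\<in>B. \<forall>y\<in>B. x \<noteq> y \<longrightarrow> cinner x y = 0) \<and> closure (cspan B) = UNIV"

lemma l2_add:
  fixes x y :: "nat \<Rightarrow> 'a::real_normed_vector"
  assumes x: "summable (\<lambda>i. (norm (x i))\<^sup>2)" and y: "summable (\<lambda>i. (norm (y i))\<^sup>2)"
  shows "summable (\<lambda>i. (norm (x i + y i))\<^sup>2)"
    and "sqrt (\<Sum>i. (norm (x i + y i))\<^sup>2) \<le> sqrt (\<Sum>i. (norm (x i))\<^sup>2) + sqrt (\<Sum>i. (norm (y i))\<^sup>2)"
proof -
  define c where "c = sqrt (\<Sum>i. (norm (x i))\<^sup>2) + sqrt (\<Sum>i. (norm (y i))\<^sup>2)"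
  have c0: "0 \<le> c"
    unfolding c_def by (intro add_nonneg_nonneg) (simp_all add: suminf_nonneg x y)
  have part: "(\<Sum>i<n. (norm (x i + y i))\<^sup>2) \<le> c\<^sup>2" for n
  proof -
    have "sqrt (\<Sum>i<n. (norm (x i + y i))\<^sup>2) \<le> L2_set (\<lambda>i. norm (x i) + norm (y i)) {..<n}"
      unfolding L2_set_def
      by (intro real_sqrt_le_mono sum_mono power_mono norm_triangle_ineq norm_ge_zero)
    also have "\<dots> \<le> L2_set (\<lambda>i. norm (x i)) {..<n} + L2_set (\<lambda>i. norm (y i)) {..<n}"
      by (rule L2_set_triangle_ineq)
    also have "\<dots> \<le> c"
      unfolding c_def L2_set_def
      by (intro add_mono real_sqrt_le_mono sum_le_suminf) (simp_all add: x y)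
    finally have "sqrt (\<Sum>i<n. (norm (x i + y i))\<^sup>2) \<le> c" .
    then show ?thesis
      by (simp add: real_sqrt_le_iff sqrt_le_D)
  qed
  show s: "summable (\<lambda>i. (norm (x i + y i))\<^sup>2)"
    by (rule summableI_nonneg_bounded[of _ "c\<^sup>2"]) (use part in auto)
  have "(\<Sum>i. (norm (x i + y i))\<^sup>2) \<le> c\<^sup>2"
    by (rule suminf_le_const[OF s part])
  then show "sqrt (\<Sum>i. (norm (x i + y i))\<^sup>2) \<le> sqrt (\<Sum>i. (norm (x i))\<^sup>2) + sqrt (\<Sum>i. (norm (y i))\<^sup>2)"
    unfolding c_def[symmetric] using c0 real_le_lsqrt by blast
qed

lemma l2_diff:
  fixes x y :: "nat \<Rightarrow> 'a::real_normed_vector"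
  assumes "summable (\<lambda>i. (norm (x i))\<^sup>2)" and "summable (\<lambda>i. (norm (y i))\<^sup>2)"
  shows "summable (\<lambda>i. (norm (x i - y i))\<^sup>2)"
  using l2_add(1)[of x "\<lambda>i. - y i"] assms by simp

lemma l2_mult:
  fixes x y :: "nat \<Rightarrow> complex"
  assumes x: "summable (\<lambda>i. (norm (x i))\<^sup>2)" and y: "summable (\<lambda>i. (norm (y i))\<^sup>2)"
  shows "summable (\<lambda>i. x i * cnj (y i))"
proof (rule summable_comparison_test'[OF summable_add[OF x y]])
  fix i
  have "norm (x i) * norm (y i) \<le> 2 * norm (x i) * norm (y i)"
    by simp
  also have "\<dots> \<le> (norm (x i))\<^sup>2 + (norm (y i))\<^sup>2"
    by (rule sum_squares_bound)
  finally show "norm (x i * cnj (y i)) \<le> (norm (x i))\<^sup>2 + (norm (y i))\<^sup>2"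
    by (simp add: norm_mult)
qed

typedef ell2 = "{x :: nat \<Rightarrow> complex. summable (\<lambda>i. (norm (x i))\<^sup>2)}"
  morphisms ell2_coord Abs_ell2
  by (rule exI[of _ "\<lambda>_. 0"]) simp

setup_lifting type_definition_ell2

instantiation ell2 :: complex_inner
begin

lift_definition zero_ell2 :: ell2 is "\<lambda>_. 0" by simp
lift_definition plus_ell2 :: "ell2 \<Rightarrow> ell2 \<Rightarrow> ell2" is "\<lambda>x y i. x i + y i" by (rule l2_add)
lift_definition minus_ell2 :: "ell2 \<Rightarrow> ell2 \<Rightarrow> ell2" is "\<lambda>x y i. x i - y i" by (rule l2_diff)
lift_definition uminus_ell2 :: "ell2 \<Rightarrow> ell2" is "\<lambda>x i. - x i" by simp
lift_definition scaleC_ell2 :: "complex \<Rightarrow> ell2 \<Rightarrow> ell2" is "\<lambda>c x i. c * x i"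
  by (simp add: norm_mult power_mult_distrib summable_mult)
lift_definition scaleR_ell2 :: "real \<Rightarrow> ell2 \<Rightarrow> ell2" is "\<lambda>r x i. r *\<^sub>R x i"
  by (simp add: power_mult_distrib summable_mult)
lift_definition cinner_ell2 :: "ell2 \<Rightarrow> ell2 \<Rightarrow> complex" is "\<lambda>x y. \<Sum>i. x i * cnj (y i)" .
lift_definition norm_ell2 :: "ell2 \<Rightarrow> real" is "\<lambda>x. sqrt (\<Sum>i. (norm (x i))\<^sup>2)" .

definition dist_ell2 :: "ell2 \<Rightarrow> ell2 \<Rightarrow> real" where "dist_ell2 x y = norm (x - y)"
definition sgn_ell2 :: "ell2 \<Rightarrow> ell2" where "sgn_ell2 x = scaleR (inverse (norm x)) x"
definition uniformity_ell2 :: "(ell2 \<times> ell2) filter" where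
  "uniformity_ell2 = (INF e\<in>{0<..}. principal {(x, y). dist x y < e})"
definition open_ell2 :: "ell2 set \<Rightarrow> bool" where
  "open_ell2 S = (\<forall>x\<in>S. \<forall>\<^sub>F (x', y) in uniformity. x' = x \<longrightarrow> y \<in> S)"

instance
proof
  fix x y z :: ell2 and a b :: complex and r s :: real
  show "x + y + z = x + (y + z)" by transfer (simp add: algebra_simps)
  show "x + y = y + x" by transfer (simp add: algebra_simps)
  show "0 + x = x" by transfer simp
  show "- x + x = 0" by transfer simp
  show "x - y = x + - y" by transfer simp
  show "r *\<^sub>R (x + y) = r *\<^sub>R x + r *\<^sub>R y" by transfer (simp add: algebra_simps)
  show "(r + s) *\<^sub>R x = r *\<^sub>R x + s *\<^sub>R x" by transfer (simp add: algebra_simps)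
  show "r *\<^sub>R s *\<^sub>R x = (r * s) *\<^sub>R x" by transfer simp
  show "1 *\<^sub>R x = x" by transfer simp
  show "a *\<^sub>C (x + y) = a *\<^sub>C x + a *\<^sub>C y" by transfer (simp add: algebra_simps)
  show "(a + b) *\<^sub>C x = a *\<^sub>C x + b *\<^sub>C x" by transfer (simp add: algebra_simps)
  show "a *\<^sub>C b *\<^sub>C x = (a * b) *\<^sub>C x" by transfer (simp add: algebra_simps)
  show "complex_of_real r *\<^sub>C x = r *\<^sub>R x" by transfer (simp add: scaleR_conv_of_real)
  show "dist x y = norm (x - y)" by (rule dist_ell2_def)
  show "sgn x = scaleR (inverse (norm x)) x" by (rule sgn_ell2_def)
  show "uniformity = (INF e\<in>{0<..}. principal {(x::ell2, y). dist x y < e})"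
    by (rule uniformity_ell2_def)
  show "open S = (\<forall>x\<in>S. \<forall>\<^sub>F (x', y) in uniformity. x' = x \<longrightarrow> y \<in> S)" for S :: "ell2 set"
    by (rule open_ell2_def)
  show "(norm x = 0) = (x = 0)"
    by transfer (auto simp: suminf_eq_zero_iff)
  show "norm (x + y) \<le> norm x + norm y" by transfer (rule l2_add)
  show "norm (r *\<^sub>R x) = \<bar>r\<bar> * norm x"
  proof transfer
    fix r :: real and x :: "nat \<Rightarrow> complex"
    assume "summable (\<lambda>i. (norm (x i))\<^sup>2)"
    from suminf_mult[OF this, of "r\<^sup>2"]
    show "sqrt (\<Sum>i. (norm (r *\<^sub>R x i))\<^sup>2) = \<bar>r\<bar> * sqrt (\<Sum>i. (norm (x i))\<^sup>2)"
      by (simp only: norm_scaleR power_mult_distrib power2_abs real_sqrt_mult real_sqrt_abs)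
  qed
  show "cinner x y = cnj (cinner y x)"
  proof transfer
    fix x y :: "nat \<Rightarrow> complex"
    assume "summable (\<lambda>i. (norm (x i))\<^sup>2)" and "summable (\<lambda>i. (norm (y i))\<^sup>2)"
    then have "summable (\<lambda>i. y i * cnj (x i))"
      by (intro l2_mult)
    then have "(\<lambda>i. cnj (y i * cnj (x i))) sums cnj (\<Sum>i. y i * cnj (x i))"
      by (intro sums_cnj[THEN iffD2] summable_sums)
    moreover have "(\<lambda>i. cnj (y i * cnj (x i))) = (\<lambda>i. x i * cnj (y i))"
      by (simp add: fun_eq_iff)
    ultimately show "(\<Sum>i. x i * cnj (y i)) = cnj (\<Sum>i. y i * cnj (x i))"
      by (simp only: sums_iff)
  qed
  show "cinner (x + y) z = cinner x z + cinner y z"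
    by transfer (simp only: distrib_right suminf_add[OF l2_mult l2_mult])
  show "cinner (a *\<^sub>C x) y = a * cinner x y"
    by transfer (simp only: mult.assoc suminf_mult[OF l2_mult])
  show "cinner x x = complex_of_real ((norm x)\<^sup>2)"
  proof transfer
    fix x :: "nat \<Rightarrow> complex"
    assume x: "summable (\<lambda>i. (norm (x i))\<^sup>2)"
    have "(\<lambda>i. complex_of_real ((norm (x i))\<^sup>2)) sums complex_of_real (\<Sum>i. (norm (x i))\<^sup>2)"
      by (rule sums_of_real[OF summable_sums[OF x]])
    moreover have "(\<lambda>i. complex_of_real ((norm (x i))\<^sup>2)) = (\<lambda>i. x i * cnj (x i))"
      by (simp add: fun_eq_iff complex_norm_square del: of_real_power)
    moreover have "(sqrt (\<Sum>i. (norm (x i))\<^sup>2))\<^sup>2 = (\<Sum>i. (norm (x i))\<^sup>2)"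
      by (intro real_sqrt_pow2 suminf_nonneg x) simp
    ultimately show "(\<Sum>i. x i * cnj (x i)) = complex_of_real ((sqrt (\<Sum>i. (norm (x i))\<^sup>2))\<^sup>2)"
      by (simp only: sums_iff)
  qed
qed

end

instance ell2 :: chilbert_space
proof
  fix X :: "nat \<Rightarrow> ell2"
  assume "Cauchy X"
  define x where "x n i = ell2_coord (X n) i" for n i
  have summ: "summable (\<lambda>i. (norm (x n i))\<^sup>2)" for n
    unfolding x_def using ell2_coord[of "X n"] by simp
  have summd: "summable (\<lambda>i. (norm (x n i - x m i))\<^sup>2)" for n m
    by (rule l2_diff[OF summ summ])
  have nd: "norm (X n - X m) = sqrt (\<Sum>i. (norm (x n i - x m i))\<^sup>2)" for n m
    unfolding x_def by transfer simp
  have cauchy: "\<exists>M. \<forall>m\<ge>M. \<forall>n\<ge>M. \<forall>N. (\<Sum>i<N. (norm (x n i - x m i))\<^sup>2) \<le> e\<^sup>2" if "e > 0" for e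
  proof -
    obtain M where M: "norm (X m - X n) < e" if "m \<ge> M" "n \<ge> M" for m n
      using CauchyD[OF \<open>Cauchy X\<close> \<open>e > 0\<close>] by blast
    have "(\<Sum>i<N. (norm (x n i - x m i))\<^sup>2) \<le> e\<^sup>2" if "m \<ge> M" "n \<ge> M" for m n N
    proof -
      have "(\<Sum>i<N. (norm (x n i - x m i))\<^sup>2) \<le> (\<Sum>i. (norm (x n i - x m i))\<^sup>2)"
        by (rule sum_le_suminf[OF summd]) auto
      also have "\<dots> \<le> e\<^sup>2"
        using M[OF that(2,1)] unfolding nd by (intro sqrt_le_D less_imp_le)
      finally show ?thesis .
    qed
    then show ?thesis by blast
  qed
  have "Cauchy (\<lambda>n. x n i)" for i
  proof (rule CauchyI)
    fix e :: real
    assume "e > 0"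
    then obtain M where M: "(\<Sum>i<N. (norm (x n i - x m i))\<^sup>2) \<le> (e/2)\<^sup>2" if "m \<ge> M" "n \<ge> M" for m n N
      using cauchy[of "e/2"] half_gt_zero[OF \<open>e > 0\<close>] by blast
    have "norm (x m i - x n i) < e" if "m \<ge> M" "n \<ge> M" for m n
    proof -
      have "(norm (x m i - x n i))\<^sup>2 \<le> (\<Sum>j<Suc i. (norm (x m j - x n j))\<^sup>2)"
        by (rule member_le_sum[where f = "\<lambda>j. (norm (x m j - x n j))\<^sup>2"]) auto
      also have "\<dots> \<le> (e/2)\<^sup>2" by (rule M[OF that(2,1)])
      finally have "norm (x m i - x n i) \<le> e/2"
        by (rule power2_le_imp_le) (use \<open>e > 0\<close> in simp)
      then show ?thesis using \<open>e > 0\<close> by simp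
    qed
    then show "\<exists>M. \<forall>m\<ge>M. \<forall>n\<ge>M. norm (x m i - x n i) < e" by blast
  qed
  then obtain l where l: "(\<lambda>n. x n i) \<longlonglongrightarrow> l i" for i
    unfolding Cauchy_convergent_iff convergent_def by metis
  have lim: "\<exists>M. \<forall>n\<ge>M. \<forall>N. (\<Sum>i<N. (norm (x n i - l i))\<^sup>2) \<le> e\<^sup>2" if "e > 0" for e
  proof -
    obtain M where M: "(\<Sum>i<N. (norm (x n i - x m i))\<^sup>2) \<le> e\<^sup>2" if "m \<ge> M" "n \<ge> M" for m n N
      using cauchy[OF \<open>e > 0\<close>] by blast
    have "(\<Sum>i<N. (norm (x n i - l i))\<^sup>2) \<le> e\<^sup>2" if "n \<ge> M" for n N
    proof (rule Lim_bounded[where M = M])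
      show "(\<lambda>m. \<Sum>i<N. (norm (x n i - x m i))\<^sup>2) \<longlonglongrightarrow> (\<Sum>i<N. (norm (x n i - l i))\<^sup>2)"
        by (intro tendsto_intros l)
      show "\<forall>m\<ge>M. (\<Sum>i<N. (norm (x n i - x m i))\<^sup>2) \<le> e\<^sup>2"
        using M that by blast
    qed
    then show ?thesis by blast
  qed
  have sumd: "summable (\<lambda>i. (norm (x n i - l i))\<^sup>2)"
    if "\<And>N. (\<Sum>i<N. (norm (x n i - l i))\<^sup>2) \<le> c" for n c
    by (rule summableI_nonneg_bounded[of _ c]) (use that in auto)
  have suml: "summable (\<lambda>i. (norm (l i))\<^sup>2)"
  proof -
    obtain M where "(\<Sum>i<N. (norm (x M i - l i))\<^sup>2) \<le> 1\<^sup>2" for N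
      using lim[OF zero_less_one] by blast
    then show ?thesis
      using l2_diff[OF summ[of M] sumd[of M "1\<^sup>2"]] by simp
  qed
  define L where "L = Abs_ell2 l"
  have L: "ell2_coord L = l"
    unfolding L_def by (rule Abs_ell2_inverse) (simp add: suml)
  have ndL: "norm (X n - L) = sqrt (\<Sum>i. (norm (x n i - l i))\<^sup>2)" for n
    by (simp add: norm_ell2.rep_eq minus_ell2.rep_eq L x_def)
  have "X \<longlonglongrightarrow> L"
  proof (rule LIMSEQ_I)
    fix r :: real
    assume "r > 0"
    then obtain M where M: "(\<Sum>i<N. (norm (x n i - l i))\<^sup>2) \<le> (r/2)\<^sup>2" if "n \<ge> M" for n N
      using lim[of "r/2"] half_gt_zero[OF \<open>r > 0\<close>] by blast
    have "norm (X n - L) < r" if "n \<ge> M" for n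
    proof -
      have "(\<Sum>i. (norm (x n i - l i))\<^sup>2) \<le> (r/2)\<^sup>2"
        by (rule suminf_le_const[OF sumd[OF M] M]) (use that in auto)
      then have "norm (X n - L) \<le> r/2"
        unfolding ndL using \<open>r > 0\<close> by (intro real_le_lsqrt) auto
      then show ?thesis using \<open>r > 0\<close> by simp
    qed
    then show "\<exists>M. \<forall>n\<ge>M. norm (X n - L) < r" by blast
  qed
  then show "convergent X" by (rule convergentI)
qed

lift_definition ell2_basis :: "nat \<Rightarrow> ell2" is "\<lambda>i j. if i = j then 1 else 0"
proof -
  fix i :: nat
  show "summable (\<lambda>j. (norm (if i = j then 1 else 0 :: complex))\<^sup>2)"
    by (rule summable_finite[of "{i}"]) auto
qed

definition bounded_clinear :: "('a::complex_inner \<Rightarrow> 'b::complex_inner) \<Rightarrow> bool" where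
  "bounded_clinear T \<longleftrightarrow> bounded_linear T \<and> (\<forall>c x. T (c *\<^sub>C x) = c *\<^sub>C T x)"

definition cadjoint :: "('a::chilbert_space \<Rightarrow> 'b::chilbert_space) \<Rightarrow> 'b \<Rightarrow> 'a" where
  "cadjoint T = (SOME S. \<forall>x y. cinner (T x) y = cinner x (S y))"

definition op_ker :: "('a::complex_inner \<Rightarrow> 'b::complex_inner) \<Rightarrow> 'a set" where
  "op_ker T = {x. T x = 0}"

definition positive_op :: "('a::complex_inner \<Rightarrow> 'a) \<Rightarrow> bool" where
  "positive_op T \<longleftrightarrow>
     bounded_clinear T \<and> (\<forall>x. cinner (T x) x \<in> \<real> \<and> 0 \<le> Re (cinner (T x) x))"

definition orthogonal_projection :: "('a::chilbert_space \<Rightarrow> 'a) \<Rightarrow> bool" where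
  "orthogonal_projection P \<longleftrightarrow> bounded_clinear P \<and> P \<circ> P = P \<and> cadjoint P = P"

definition partial_isometry :: "('a::complex_inner \<Rightarrow> 'b::complex_inner) \<Rightarrow> bool" where
  "partial_isometry U \<longleftrightarrow>
     bounded_clinear U \<and> (\<forall>x\<in>ortho_compl (op_ker U). norm (U x) = norm x)"

text \<open>\<open>A\<close> is the absolute value \<open>|T| = (T\<^sup>* T)\<^bsup>1/2\<^esup>\<close>, and \<open>T = U |T|\<close> with \<open>ker U = ker T\<close>.\<close>

definition polar_decomposition ::
  "('a::chilbert_space \<Rightarrow> 'b::chilbert_space) \<Rightarrow> ('a \<Rightarrow> 'b) \<Rightarrow> ('a \<Rightarrow> 'a) \<Rightarrow> bool" where
  "polar_decomposition T U A \<longleftrightarrow>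
     positive_op A \<and> A \<circ> A = cadjoint T \<circ> T \<and>
     partial_isometry U \<and> T = U \<circ> A \<and> op_ker U = op_ker T"

definition unitary_op :: "('a::chilbert_space \<Rightarrow> 'a) \<Rightarrow> bool" where
  "unitary_op L \<longleftrightarrow> bounded_clinear L \<and> cadjoint L \<circ> L = id \<and> L \<circ> cadjoint L = id"

definition hilbert_schmidt :: "('a::complex_inner \<Rightarrow> 'b::complex_inner) \<Rightarrow> bool" where
  "hilbert_schmidt T \<longleftrightarrow>
     bounded_clinear T \<and> (\<exists>B. orthonormal_basis B \<and> (\<lambda>b. (norm (T b))\<^sup>2) summable_on B)"

text \<open>
  In the next two definitions the operator \<open>M \<rightarrow> N\<close> between closed subspaces is the restriction
  \<open>T|\<^sub>M\<close> of an operator \<open>T\<close> on the ambient spaces. As the range of a Fredholm operator is closed,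
  its cokernel is identified with the orthogonal complement of the range in \<open>N\<close>.
\<close>

definition fredholm :: "'a::complex_inner set \<Rightarrow> 'b::complex_inner set \<Rightarrow> ('a \<Rightarrow> 'b) \<Rightarrow> bool" where
  "fredholm M N T \<longleftrightarrow>
     closed_csubspace M \<and> closed_csubspace N \<and> bounded_clinear T \<and> T ` M \<subseteq> N \<and> closed (T ` M) \<and>
     hdim (M \<inter> op_ker T) \<noteq> \<infinity> \<and> hdim (N \<inter> ortho_compl (T ` M)) \<noteq> \<infinity>"

definition fredholm_index :: "'a::complex_inner set \<Rightarrow> 'b::complex_inner set \<Rightarrow> ('a \<Rightarrow> 'b) \<Rightarrow> int" where
  "fredholm_index M N T = int (cdim (M \<inter> op_ker T)) - int (cdim (N \<inter> ortho_compl (T ` M)))"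

definition fredholm_pair :: "('a::chilbert_space \<Rightarrow> 'a) \<Rightarrow> ('a \<Rightarrow> 'a) \<Rightarrow> bool" where
  "fredholm_pair P Q \<longleftrightarrow>
     orthogonal_projection P \<and> orthogonal_projection Q \<and> fredholm (range P) (range Q) (Q \<circ> P)"

definition pair_index :: "('a::chilbert_space \<Rightarrow> 'a) \<Rightarrow> ('a \<Rightarrow> 'a) \<Rightarrow> int" where
  "pair_index P Q = fredholm_index (range P) (range Q) (Q \<circ> P)"

definition frame_bounds ::
  "'h::chilbert_space set \<Rightarrow> (nat \<Rightarrow> 'h) \<Rightarrow> real \<Rightarrow> real \<Rightarrow> bool" where
  "frame_bounds K f A B \<longleftrightarrow>
     (\<forall>g\<in>K. summable (\<lambda>i. (cmod (cinner g (f i)))\<^sup>2) \<and>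
        A * (norm g)\<^sup>2 \<le> (\<Sum>i. (cmod (cinner g (f i)))\<^sup>2) \<and>
        (\<Sum>i. (cmod (cinner g (f i)))\<^sup>2) \<le> B * (norm g)\<^sup>2)"

definition frame_in :: "'h::chilbert_space set \<Rightarrow> (nat \<Rightarrow> 'h) \<Rightarrow> bool" where
  "frame_in K f \<longleftrightarrow>
     closed_csubspace K \<and> range f \<subseteq> K \<and> (\<exists>A>0. \<exists>B>0. frame_bounds K f A B)"

definition parseval_frame_in :: "'h::chilbert_space set \<Rightarrow> (nat \<Rightarrow> 'h) \<Rightarrow> bool" where
  "parseval_frame_in K f \<longleftrightarrow> closed_csubspace K \<and> range f \<subseteq> K \<and> frame_bounds K f 1 1"

text \<open>Such an operator is unique; it exists if \<open>f\<close> is a frame in some closed subspace.\<close>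

definition synthesis :: "(nat \<Rightarrow> 'h::chilbert_space) \<Rightarrow> ell2 \<Rightarrow> 'h" where
  "synthesis f = (THE F. bounded_clinear F \<and> (\<forall>i. F (ell2_basis i) = f i))"

definition parseval_near :: "(nat \<Rightarrow> 'h::chilbert_space) \<Rightarrow> (nat \<Rightarrow> 'h) set" where
  "parseval_near f =
     {x. (\<exists>L. parseval_frame_in L x) \<and> summable (\<lambda>i. (norm (x i - f i))\<^sup>2)}"

text \<open>
  An \<open>infsum\<close>, unlike a \<open>suminf\<close>, is \<open>0\<close> where it diverges; the locale \<^locale>\<open>Metric_space\<close> asks for
  nonnegative values also outside its carrier.
\<close>

definition frame_dist :: "(nat \<Rightarrow> 'h::chilbert_space) \<Rightarrow> (nat \<Rightarrow> 'h) \<Rightarrow> real" where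
  "frame_dist x y = sqrt (\<Sum>\<^sub>\<infinity>i. (norm (x i - y i))\<^sup>2)"

lemma frame_dist_eq:
  assumes "summable (\<lambda>i. (norm (x i - y i))\<^sup>2)"
  shows "frame_dist x y = sqrt (\<Sum>i. (norm (x i - y i))\<^sup>2)"
proof -
  have "(\<lambda>i. (norm (x i - y i))\<^sup>2) summable_on UNIV"
    by (subst summable_on_UNIV_nonneg_real_iff) (simp_all add: assms)
  then have "(\<lambda>i. (norm (x i - y i))\<^sup>2) sums (\<Sum>\<^sub>\<infinity>i. (norm (x i - y i))\<^sup>2)"
    by (intro has_sum_imp_sums has_sum_infsum)
  then show ?thesis
    by (simp add: frame_dist_def sums_iff)
qed

lemma parseval_near_summable:
  assumes "x \<in> parseval_near f" and "y \<in> parseval_near f"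
  shows "summable (\<lambda>i. (norm (x i - y i))\<^sup>2)"
  using l2_diff[of "\<lambda>i. x i - f i" "\<lambda>i. y i - f i"] assms by (simp add: parseval_near_def)

lemma Metric_space_parseval_near: "Metric_space (parseval_near f) frame_dist"
proof
  fix x y z :: "nat \<Rightarrow> 'a"
  show "0 \<le> frame_dist x y"
    by (simp add: frame_dist_def infsum_nonneg)
  show "frame_dist x y = frame_dist y x"
    by (simp add: frame_dist_def norm_minus_commute)
  assume x: "x \<in> parseval_near f" and y: "y \<in> parseval_near f"
  note xy = parseval_near_summable[OF x y]
  show "(frame_dist x y = 0) = (x = y)"
    using suminf_eq_zero_iff[OF xy] by (auto simp: frame_dist_eq[OF xy] fun_eq_iff)
  assume z: "z \<in> parseval_near f"
  note yz = parseval_near_summable[OF y z] and xz = parseval_near_summable[OF x z]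
  show "frame_dist x z \<le> frame_dist x y + frame_dist y z"
    using l2_add(2)[OF xy yz] by (simp add: frame_dist_eq[OF xy] frame_dist_eq[OF yz] frame_dist_eq[OF xz])
qed

definition parseval_near_topology :: "(nat \<Rightarrow> 'h::chilbert_space) \<Rightarrow> (nat \<Rightarrow> 'h) topology" where
  "parseval_near_topology f = Metric_space.mtopology (parseval_near f) frame_dist"

definition U2 :: "('a::chilbert_space \<Rightarrow> 'a) monoid" where
  "U2 = \<lparr>carrier = {L. unitary_op L \<and> hilbert_schmidt (\<lambda>x. L x - x)},
         monoid.mult = (\<circ>), one = id\<rparr>"

text \<open>
  The map is restricted to \<open>parseval_near f\<close> (with the value \<open>undefined\<close> elsewhere), because
  \<^const>\<open>group_action\<close> takes values in the extensional bijections of that set.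
\<close>

definition U2_action ::
  "(nat \<Rightarrow> 'h::chilbert_space) \<Rightarrow> ('h \<Rightarrow> 'h) \<times> (ell2 \<Rightarrow> ell2) \<Rightarrow> (nat \<Rightarrow> 'h) \<Rightarrow> (nat \<Rightarrow> 'h)" where
  "U2_action f = (\<lambda>(V, W). \<lambda>x\<in>parseval_near f. (\<lambda>i. V (synthesis x (cadjoint W (ell2_basis i)))))"

end

theory Submission imports Defs
begin

text \<open>
  A Parseval frame is the sequence of columns of a partial isometry \<open>X\<close> from \<open>\<ell>\<^sup>2\<close> to the Hilbert
  space, and nearness to \<open>f\<close> says that \<open>X - F\<close> is Hilbert-Schmidt. If one such \<open>X\<close> exists, the
  polar part \<open>U\<close> of \<open>F\<close> is another (\<open>canonical_parseval\<close>), so \<open>F\<close> may be replaced by \<open>U\<close>. The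
  statement is then about partial isometries \<open>X\<close> with \<open>X - U\<close> Hilbert-Schmidt, modulo
  \<open>X \<mapsto> V X W\<close> with unitaries \<open>V\<close>, \<open>W\<close> that differ from the identity by Hilbert-Schmidt operators.

  The classification rests on one construction. Remove from the initial space of each of two such
  partial isometries \<open>X\<close>, \<open>Y\<close> the finite-dimensional part that the other one annihilates. The
  results lie in one orbit (\<open>orbit_equiv_restr\<close>): the two initial projections have trivial mutual
  intersections with each other's kernels, so the polar part of the operator \<open>Q P + (1 - Q) (1 - P)\<close>
  aligns them (\<open>projections_u2_equivalent\<close>), and once the initial spaces agree, a generalised
  Householder reflection moves one partial isometry to the other (\<open>orbit_equiv_same_initial\<close>). If
  \<open>\<parallel>X - Y\<parallel> < 1\<close>, nothing is removed, so orbits are open. In general, \<open>U\<close> and some member of the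
  orbit of \<open>X\<close> have a common restriction, of finite coranks \<open>a\<close> and \<open>b\<close>, and \<open>a - b\<close> is
  the index. It determines the orbit, because two extensions of one partial isometry by the same finite rank
  differ by a finite-rank motion (\<open>orbit_equiv_same_rank\<close>). It is well defined, because an orbit never contains
  a proper restriction of one of its members (\<open>not_orbit_equiv_restr\<close>): iterating the unitary would
  produce infinitely many orthonormal vectors on which a Hilbert-Schmidt operator has norm \<open>\<surd>2\<close>.

  The numbers \<open>a\<close> and \<open>b\<close> can be taken to be the dimensions of the intersections that define the index of the pair of
  initial projections and, through the isometry \<open>U\<close>, the index of \<open>X U\<^sup>*\<close>. The relative index is
  unchanged when both operators are replaced by their adjoints, which yields the index of the final
  projections (\<open>three_indices\<close>).

  Orbits are connected because the unitary group in question is connected: a unitary without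
  eigenvalue \<open>-1\<close> is joined to the identity by its Cayley transforms (\<open>cayley_path\<close>), and every
  element is a product of three of these (\<open>u2_factorization\<close>). Being open and connected, the orbits
  are the connected components.
\<close>

section \<open>Elementary Hilbert space geometry\<close>

lemma cinner_add_right: "cinner x (y + z) = cinner x y + cinner x z"
  by (metis cinner_add_left cinner_commute complex_cnj_add)

lemma cinner_scaleC_right: "cinner x (a *\<^sub>C y) = cnj a * cinner x y"
  by (metis cinner_scaleC_left cinner_commute complex_cnj_mult)

lemma cinner_zero_left [simp]: "cinner 0 x = 0"
  using cinner_add_left[of 0 0 x] by simp

lemma cinner_zero_right [simp]: "cinner x 0 = 0"
  using cinner_add_right[of x 0 0] by simp

lemma cinner_minus_left [simp]: "cinner (- x) y = - cinner x y"
  using cinner_add_left[of x "- x" y] by (simp add: eq_neg_iff_add_eq_0 add.commute)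

lemma cinner_minus_right [simp]: "cinner x (- y) = - cinner x y"
  using cinner_add_right[of x y "- y"] by (simp add: eq_neg_iff_add_eq_0 add.commute)

lemma cinner_diff_left: "cinner (x - y) z = cinner x z - cinner y z"
  using cinner_add_left[of x "- y" z] by simp

lemma cinner_diff_right: "cinner x (y - z) = cinner x y - cinner x z"
  using cinner_add_right[of x y "- z"] by simp

lemma cinner_sum_left: "cinner (sum f A) y = (\<Sum>a\<in>A. cinner (f a) y)"
  by (induction A rule: infinite_finite_induct) (simp_all add: cinner_add_left)

lemma cinner_sum_right: "cinner y (sum f A) = (\<Sum>a\<in>A. cinner y (f a))"
  by (induction A rule: infinite_finite_induct) (simp_all add: cinner_add_right)

lemmas cinner_simps = cinner_add_left cinner_add_right cinner_diff_left cinner_diff_right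
  cinner_scaleC_left cinner_scaleC_right

lemma norm_sq_cinner: "(norm x)\<^sup>2 = Re (cinner x x)"
  by (simp add: cinner_self)

lemma Im_cinner_self [simp]: "Im (cinner x x) = 0"
  by (simp add: cinner_self)

lemma cinner_self_eq_0 [simp]: "cinner x x = 0 \<longleftrightarrow> x = 0"
  by (simp add: cinner_self)

lemma cinner_eqI: "(\<And>z. cinner x z = cinner y z) \<Longrightarrow> x = y"
  using cinner_self_eq_0[of "x - y"] by (simp only: cinner_diff_left) simp

lemma cinner_eqI': "(\<And>z. cinner z x = cinner z y) \<Longrightarrow> x = y"
  by (rule cinner_eqI) (metis cinner_commute)

lemma Re_cinner_commute: "Re (cinner x y) = Re (cinner y x)"
  by (metis cinner_commute complex_cnj(1) complex.sel(1) cnj.simps(1))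

lemma cmod_cinner_commute: "cmod (cinner x y) = cmod (cinner y x)"
  by (metis cinner_commute complex_mod_cnj)

lemma norm_scaleC: "norm (a *\<^sub>C x) = cmod a * norm (x :: 'a::complex_inner)"
proof -
  have "complex_of_real ((norm (a *\<^sub>C x))\<^sup>2) = complex_of_real ((cmod a * norm x)\<^sup>2)"
    by (simp only: cinner_self[symmetric] cinner_scaleC_left cinner_scaleC_right)
       (simp add: cinner_self power_mult_distrib complex_norm_square mult.assoc del: of_real_power)
  then show ?thesis
    by (metis of_real_eq_iff norm_ge_zero zero_le_mult_iff power2_eq_imp_eq)
qed

lemma norm_add_sq: "(norm (x + y))\<^sup>2 = (norm x)\<^sup>2 + (norm y)\<^sup>2 + 2 * Re (cinner x y)"
  by (simp add: norm_sq_cinner cinner_simps Re_cinner_commute[of y x])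

lemma norm_diff_sq: "(norm (x - y))\<^sup>2 = (norm x)\<^sup>2 + (norm y)\<^sup>2 - 2 * Re (cinner x y)"
  by (simp add: norm_sq_cinner cinner_simps Re_cinner_commute[of y x])

lemma pythagoras: "cinner x y = 0 \<Longrightarrow> (norm (x + y))\<^sup>2 = (norm x)\<^sup>2 + (norm y)\<^sup>2"
  by (simp add: norm_add_sq)

text \<open>The scalar below is the coefficient of the projection of \<open>x\<close> on the line of \<open>y\<close>.\<close>

lemma norm_diff_line:
  assumes "y \<noteq> 0"
  shows "(norm (x - (cinner x y / complex_of_real ((norm y)\<^sup>2)) *\<^sub>C y))\<^sup>2
          = (norm x)\<^sup>2 - (cmod (cinner x y))\<^sup>2 / (norm y)\<^sup>2"
proof -
  have n: "norm y \<noteq> 0" using assms by simp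
  have c: "Re (z * cnj z) = (cmod z)\<^sup>2" for z
    by (simp add: complex_norm_square[symmetric] del: of_real_power)
  have "Re (cinner x ((cinner x y / complex_of_real ((norm y)\<^sup>2)) *\<^sub>C y))
          = Re (cinner x y * cnj (cinner x y) / complex_of_real ((norm y)\<^sup>2))"
    by (simp add: cinner_scaleC_right mult.commute)
  also have "\<dots> = (cmod (cinner x y))\<^sup>2 / (norm y)\<^sup>2"
    using c[of "cinner x y"] by (simp only: Re_divide_of_real)
  finally have 1: "Re (cinner x ((cinner x y / complex_of_real ((norm y)\<^sup>2)) *\<^sub>C y))
     = (cmod (cinner x y))\<^sup>2 / (norm y)\<^sup>2" .
  have 2: "(norm ((cinner x y / complex_of_real ((norm y)\<^sup>2)) *\<^sub>C y))\<^sup>2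
     = (cmod (cinner x y))\<^sup>2 / (norm y)\<^sup>2"
    using n by (simp add: norm_scaleC norm_divide power_mult_distrib power_divide norm_power)
       (simp add: power2_eq_square power4_eq_xxxx)
  show ?thesis by (simp only: norm_diff_sq 1 2)
qed

lemma cauchy_schwarz: "cmod (cinner x y) \<le> norm x * norm y"
proof (cases "y = 0")
  case False
  have "(cmod (cinner x y))\<^sup>2 / (norm y)\<^sup>2 \<le> (norm x)\<^sup>2"
    using norm_diff_line[OF False, of x]
    by (metis diff_ge_0_iff_ge zero_le_power2)
  then have "(cmod (cinner x y))\<^sup>2 \<le> (norm x * norm y)\<^sup>2"
    using False by (simp add: divide_le_eq power_mult_distrib)
  then show ?thesis by (rule power2_le_imp_le) simp
qed simp

lemma Re_cauchy_schwarz: "Re (cinner x y) \<le> norm x * norm y"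
  using cauchy_schwarz[of x y] complex_Re_le_cmod[of "cinner x y"] by linarith

lemma bounded_bilinear_cinner: "bounded_bilinear (cinner :: 'a \<Rightarrow> 'a \<Rightarrow> complex)"
  for x :: "'a::complex_inner"
proof
  fix a a' b b' :: 'a and r :: real
  show "cinner (r *\<^sub>R a) b = r *\<^sub>R cinner a b"
    by (simp add: scaleC_of_real[symmetric] cinner_scaleC_left scaleR_conv_of_real)
  show "cinner a (r *\<^sub>R b) = r *\<^sub>R cinner a b"
    by (simp add: scaleC_of_real[symmetric] cinner_scaleC_right scaleR_conv_of_real)
  show "\<exists>K. \<forall>a b :: 'a. norm (cinner a b) \<le> norm a * norm b * K"
    using cauchy_schwarz by (intro exI[of _ 1]) auto
qed (simp_all add: cinner_simps)

lemmas continuous_on_cinner [continuous_intros] =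
  bounded_bilinear.continuous_on[OF bounded_bilinear_cinner]

lemma bounded_linear_scaleC: "bounded_linear (\<lambda>x :: 'a::complex_inner. a *\<^sub>C x)"
proof (rule bounded_linear_intro[where K = "cmod a"])
  fix r :: real and x :: 'a
  show "a *\<^sub>C r *\<^sub>R x = r *\<^sub>R a *\<^sub>C x"
    by (simp add: scaleC_of_real[symmetric] scaleC_scaleC mult.commute)
qed (simp_all add: scaleC_add_right norm_scaleC)

section \<open>Bounded operators\<close>

lemma bounded_clinearI:
  fixes T :: "'a::complex_inner \<Rightarrow> 'b::complex_inner"
  assumes "\<And>x y. T (x + y) = T x + T y" "\<And>c x. T (c *\<^sub>C x) = c *\<^sub>C T x"
    and "\<And>x. norm (T x) \<le> K * norm x"
  shows "bounded_clinear T"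
  unfolding bounded_clinear_def
proof
  show "bounded_linear T"
    by (rule bounded_linear_intro[where K = K])
       (use assms in \<open>simp_all add: scaleC_of_real[symmetric] mult.commute\<close>)
qed (use assms in simp)

context
  fixes T :: "'a::complex_inner \<Rightarrow> 'b::complex_inner"
  assumes T: "bounded_clinear T"
begin

lemma bcl_bounded_linear: "bounded_linear T" using T by (simp add: bounded_clinear_def)
lemma bcl_scaleC: "T (c *\<^sub>C x) = c *\<^sub>C T x" using T by (simp add: bounded_clinear_def)
lemma bcl_add: "T (x + y) = T x + T y"
  using bcl_bounded_linear bounded_linear.linear linear_add by blast
lemma bcl_diff: "T (x - y) = T x - T y"
  using bcl_bounded_linear bounded_linear.linear linear_diff by blast
lemma bcl_zero: "T 0 = 0"
  using bcl_bounded_linear bounded_linear.linear linear_0 by blast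
lemma bcl_minus: "T (- x) = - T x"
  using bcl_bounded_linear bounded_linear.linear linear_neg by blast
lemma bcl_sum: "T (sum f A) = (\<Sum>a\<in>A. T (f a))"
  using bcl_bounded_linear bounded_linear.linear linear_sum by blast
lemma bcl_bounded: "\<exists>K>0. \<forall>x. norm (T x) \<le> K * norm x"
  using bounded_linear.pos_bounded[OF bcl_bounded_linear] by (simp add: mult.commute)
lemma bcl_continuous: "continuous_on S T"
  using bcl_bounded_linear linear_continuous_on by blast
lemma bcl_tendsto: "(f \<longlongrightarrow> l) Fl \<Longrightarrow> ((\<lambda>x. T (f x)) \<longlongrightarrow> T l) Fl"
  using bounded_linear.tendsto[OF bcl_bounded_linear] .

lemmas bcl_simps = bcl_scaleC bcl_add bcl_diff bcl_zero bcl_minus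

end

lemma bounded_clinear_id: "bounded_clinear (\<lambda>x. x)"
  by (rule bounded_clinearI[of _ 1]) simp_all

lemma bounded_clinear_zero: "bounded_clinear (\<lambda>x. 0)"
  by (rule bounded_clinearI[of _ 1]) simp_all

lemma bounded_clinear_comp:
  assumes "bounded_clinear S" "bounded_clinear T"
  shows "bounded_clinear (\<lambda>x. S (T x))"
  using assms bounded_linear_compose[of S T] by (simp add: bounded_clinear_def)

lemma bounded_clinear_o: "bounded_clinear S \<Longrightarrow> bounded_clinear T \<Longrightarrow> bounded_clinear (S \<circ> T)"
  using bounded_clinear_comp by (simp add: comp_def)

lemma bounded_clinear_add:
  assumes "bounded_clinear S" "bounded_clinear T"
  shows "bounded_clinear (\<lambda>x. S x + T x)"
  using assms bounded_linear_add[of S T] by (simp add: bounded_clinear_def scaleC_add_right)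

lemma bounded_clinear_scaleC:
  assumes "bounded_clinear T" shows "bounded_clinear (\<lambda>x. a *\<^sub>C T x)"
  using assms bounded_linear_compose[OF bounded_linear_scaleC, of T]
  by (simp add: bounded_clinear_def scaleC_scaleC mult.commute)

lemma bounded_clinear_minus: "bounded_clinear T \<Longrightarrow> bounded_clinear (\<lambda>x. - T x)"
  using bounded_clinear_scaleC[of T "-1"] by simp

lemma bounded_clinear_diff:
  assumes "bounded_clinear S" "bounded_clinear T"
  shows "bounded_clinear (\<lambda>x. S x - T x)"
  using bounded_clinear_add[OF assms(1) bounded_clinear_minus[OF assms(2)]] by simp

lemma bounded_clinear_sum:
  assumes "\<And>a. a \<in> A \<Longrightarrow> bounded_clinear (T a)"
  shows "bounded_clinear (\<lambda>x. \<Sum>a\<in>A. T a x)"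
  using assms
  by (induction A rule: infinite_finite_induct)
     (simp_all add: bounded_clinear_zero bounded_clinear_add)

lemma bounded_clinear_rank1: "bounded_clinear (\<lambda>x. cinner x g *\<^sub>C h)"
proof (rule bounded_clinearI[where K = "norm g * norm h"])
  fix x
  have "cmod (cinner x g) * norm h \<le> (norm x * norm g) * norm h"
    by (intro mult_right_mono cauchy_schwarz) simp
  then show "norm (cinner x g *\<^sub>C h) \<le> norm g * norm h * norm x"
    by (simp add: norm_scaleC mult_ac)
qed (simp_all add: cinner_simps scaleC_add_left scaleC_scaleC)

lemmas bounded_clinear_intros = bounded_clinear_id bounded_clinear_zero bounded_clinear_o
  bounded_clinear_add bounded_clinear_diff bounded_clinear_minus
  bounded_clinear_scaleC bounded_clinear_sum bounded_clinear_rank1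

section \<open>Orthogonal projections and adjoints\<close>

lemma closed_csubspaceD:
  assumes "closed_csubspace S"
  shows "closed S" "0 \<in> S" "x \<in> S \<Longrightarrow> y \<in> S \<Longrightarrow> x + y \<in> S"
    "x \<in> S \<Longrightarrow> y \<in> S \<Longrightarrow> x - y \<in> S" "x \<in> S \<Longrightarrow> a *\<^sub>C x \<in> S"
  using assms complex_vector.subspace_0 complex_vector.subspace_add complex_vector.subspace_diff
    complex_vector.subspace_scale
  by (auto simp: closed_csubspace_def)

lemma csubspace_ortho_compl: "csubspace (ortho_compl S)"
  by (rule complex_vector.subspaceI) (auto simp: ortho_compl_def cinner_simps)

lemma closed_csubspace_ortho_compl: "closed_csubspace (ortho_compl S)"
proof -
  have "ortho_compl S = (\<Inter>y\<in>S. {x. cinner x y = 0})" by (auto simp: ortho_compl_def)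
  moreover have "closed {x. cinner x y = 0}" for y :: 'a
    by (intro closed_Collect_eq continuous_intros)
  ultimately have "closed (ortho_compl S)" by (metis (no_types, lifting) closed_INT)
  then show ?thesis by (simp add: closed_csubspace_def csubspace_ortho_compl)
qed

text \<open>The parallelogram law makes every minimising sequence for the distance from \<open>x\<close> to \<open>S\<close>
  a Cauchy sequence, and minimality at the limit is orthogonality.\<close>

lemma projection_exists:
  fixes x :: "'a::chilbert_space"
  assumes S: "closed_csubspace S"
  shows "\<exists>y\<in>S. \<forall>z\<in>S. cinner (x - y) z = 0"
proof -
  define N where "N = (\<lambda>y. (norm (x - y))\<^sup>2) ` S"
  define d where "d = Inf N"
  have ne: "N \<noteq> {}" using closed_csubspaceD(2)[OF S] by (auto simp: N_def)
  have bdd: "bdd_below N" by (rule bdd_belowI[of _ 0]) (auto simp: N_def)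
  have d_le: "d \<le> (norm (x - y))\<^sup>2" if "y \<in> S" for y
    unfolding d_def by (rule cInf_lower[OF _ bdd]) (use that in \<open>auto simp: N_def\<close>)
  have "\<exists>y\<in>S. (norm (x - y))\<^sup>2 < d + inverse (real (Suc n))" for n
  proof -
    have "Inf N < d + inverse (real (Suc n))" by (simp add: d_def)
    then show ?thesis using cInf_lessD[OF ne] by (auto simp: N_def)
  qed
  then obtain y where yS: "y n \<in> S" and y: "(norm (x - y n))\<^sup>2 < d + inverse (real (Suc n))" for n
    by metis
  have para: "(norm (y m - y n))\<^sup>2 \<le> 2 * inverse (real (Suc m)) + 2 * inverse (real (Suc n))" for m n
  proof -
    define u v where "u = x - y m" and "v = x - y n"
    have mid: "(1/2) *\<^sub>C (y m + y n) \<in> S" by (intro closed_csubspaceD(3,5)[OF S] yS)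
    have "u + v = 2 *\<^sub>C (x - (1/2) *\<^sub>C (y m + y n))"
      using scaleC_of_real[of 2 x]
      by (simp add: u_def v_def complex_vector.scale_right_diff_distrib scaleC_scaleC scaleR_2)
    then have "(norm (u + v))\<^sup>2 = 4 * (norm (x - (1/2) *\<^sub>C (y m + y n)))\<^sup>2"
      by (simp add: norm_scaleC power_mult_distrib)
    then have "4 * d \<le> (norm (u + v))\<^sup>2" using d_le[OF mid] by simp
    moreover have "(norm (u + v))\<^sup>2 + (norm (u - v))\<^sup>2 = 2 * (norm u)\<^sup>2 + 2 * (norm v)\<^sup>2"
      by (simp add: norm_add_sq norm_diff_sq)
    moreover have "norm (u - v) = norm (y m - y n)" by (simp add: u_def v_def norm_minus_commute)
    ultimately show ?thesis using y[of m] y[of n] by (simp add: u_def v_def)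
  qed
  have "Cauchy y"
  proof (rule CauchyI)
    fix e :: real assume e: "e > 0"
    then obtain M where M: "inverse (real (Suc M)) < e\<^sup>2 / 4"
      using reals_Archimedean[of "e\<^sup>2 / 4"] by auto
    have "norm (y m - y n) < e" if "m \<ge> M" "n \<ge> M" for m n
    proof -
      have "inverse (real (Suc m)) \<le> inverse (real (Suc M))"
        "inverse (real (Suc n)) \<le> inverse (real (Suc M))"
        using that by (simp_all add: le_imp_inverse_le)
      then have "(norm (y m - y n))\<^sup>2 < e\<^sup>2" using para[of m n] M by linarith
      then show ?thesis using e by (simp add: power2_less_imp_less)
    qed
    then show "\<exists>M. \<forall>m\<ge>M. \<forall>n\<ge>M. norm (y m - y n) < e" by blast
  qed
  then obtain l where l: "y \<longlonglongrightarrow> l" using Cauchy_convergent_iff convergent_def by blast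
  have lS: "l \<in> S" using closed_sequentially[OF closed_csubspaceD(1)[OF S] _ l] yS by blast
  have "(norm (x - l))\<^sup>2 \<le> d"
  proof (rule LIMSEQ_le)
    show "(\<lambda>n. (norm (x - y n))\<^sup>2) \<longlonglongrightarrow> (norm (x - l))\<^sup>2" by (intro tendsto_intros l)
    show "(\<lambda>n. d + inverse (real (Suc n))) \<longlonglongrightarrow> d"
      using tendsto_add[OF tendsto_const[of d] LIMSEQ_inverse_real_of_nat] by simp
    show "\<exists>N. \<forall>n\<ge>N. (norm (x - y n))\<^sup>2 \<le> d + inverse (real (Suc n))"
      using y less_imp_le by blast
  qed
  then have min: "(norm (x - l))\<^sup>2 \<le> (norm (x - z))\<^sup>2" if "z \<in> S" for z using d_le[OF that] by linarith
  have "cinner (x - l) z = 0" if "z \<in> S" for z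
  proof (cases "z = 0")
    case False
    define a where "a = cinner (x - l) z / complex_of_real ((norm z)\<^sup>2)"
    have "l + a *\<^sub>C z \<in> S" using closed_csubspaceD(3,5)[OF S] lS that by blast
    from min[OF this] have "(norm (x - l))\<^sup>2 \<le> (norm (x - l - a *\<^sub>C z))\<^sup>2"
      by (simp add: diff_diff_eq)
    with norm_diff_line[OF False, of "x - l"] have "(cmod (cinner (x - l) z))\<^sup>2 / (norm z)\<^sup>2 \<le> 0"
      unfolding a_def by simp
    then show ?thesis using False by (simp add: divide_le_0_iff)
  qed simp
  then show ?thesis using lS by blast
qed

definition proj :: "'a::chilbert_space set \<Rightarrow> 'a \<Rightarrow> 'a" where
  "proj S x = (SOME y. y \<in> S \<and> (\<forall>z\<in>S. cinner (x - y) z = 0))"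

context
  fixes S :: "'a::chilbert_space set"
  assumes S: "closed_csubspace S"
begin

lemma proj_in: "proj S x \<in> S" and proj_orth: "z \<in> S \<Longrightarrow> cinner (x - proj S x) z = 0"
  using someI_ex[of "\<lambda>y. y \<in> S \<and> (\<forall>z\<in>S. cinner (x - y) z = 0)"] projection_exists[OF S, of x]
  unfolding proj_def by blast+

lemma proj_unique:
  assumes "y \<in> S" "\<And>z. z \<in> S \<Longrightarrow> cinner (x - y) z = 0"
  shows "proj S x = y"
proof -
  have "proj S x - y \<in> S" using closed_csubspaceD(4)[OF S] proj_in assms(1) by blast
  then have "cinner (x - y) (proj S x - y) = 0" "cinner (x - proj S x) (proj S x - y) = 0"
    using assms(2) proj_orth by blast+
  then have "cinner ((x - y) - (x - proj S x)) (proj S x - y) = 0"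
    by (simp add: cinner_diff_left)
  then show ?thesis by simp
qed

lemma proj_eq_self: "x \<in> S \<Longrightarrow> proj S x = x"
  by (rule proj_unique) simp_all

lemma proj_eq_self_iff: "proj S x = x \<longleftrightarrow> x \<in> S"
  using proj_eq_self proj_in by metis

lemma proj_pythagoras: "(norm x)\<^sup>2 = (norm (proj S x))\<^sup>2 + (norm (x - proj S x))\<^sup>2"
  using pythagoras[OF proj_orth[OF proj_in], of x x] by (simp add: add.commute)

lemma proj_norm_le: "norm (proj S x) \<le> norm x"
  using proj_pythagoras[of x] by (simp add: power2_le_imp_le)

lemma bounded_clinear_proj: "bounded_clinear (proj S)"
proof (rule bounded_clinearI[where K = 1])
  fix x y :: 'a and c :: complex
  show "proj S (x + y) = proj S x + proj S y"
  proof (rule proj_unique)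
    fix z assume z: "z \<in> S"
    have "x + y - (proj S x + proj S y) = (x - proj S x) + (y - proj S y)" by simp
    then show "cinner (x + y - (proj S x + proj S y)) z = 0"
      using proj_orth[OF z] by (simp only: cinner_add_left) simp
  qed (intro closed_csubspaceD[OF S] proj_in)
  show "proj S (c *\<^sub>C x) = c *\<^sub>C proj S x"
  proof (rule proj_unique)
    fix z assume z: "z \<in> S"
    have "c *\<^sub>C x - c *\<^sub>C proj S x = c *\<^sub>C (x - proj S x)"
      by (simp add: complex_vector.scale_right_diff_distrib)
    then show "cinner (c *\<^sub>C x - c *\<^sub>C proj S x) z = 0"
      using proj_orth[OF z] by (simp add: cinner_scaleC_left)
  qed (intro closed_csubspaceD[OF S] proj_in)
qed (use proj_norm_le in simp)

lemma proj_selfadj: "cinner (proj S x) y = cinner x (proj S y)"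
proof -
  have "cinner (proj S x) (y - proj S y) = 0"
    using proj_orth[OF proj_in, of y x] by (metis cinner_commute complex_cnj_zero)
  moreover have "cinner (x - proj S x) (proj S y) = 0" by (rule proj_orth[OF proj_in])
  ultimately show ?thesis by (simp add: cinner_simps)
qed

lemma proj_eq_0_iff: "proj S x = 0 \<longleftrightarrow> x \<in> ortho_compl S"
  using proj_unique[of 0 x] proj_orth[of _ x] closed_csubspaceD(2)[OF S]
  by (auto simp: ortho_compl_def)

lemma ortho_compl_ortho_compl: "ortho_compl (ortho_compl S) = S"
proof
  show "S \<subseteq> ortho_compl (ortho_compl S)"
    by (auto simp: ortho_compl_def) (metis cinner_commute complex_cnj_zero)
  show "ortho_compl (ortho_compl S) \<subseteq> S"
  proof
    fix x assume x: "x \<in> ortho_compl (ortho_compl S)"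
    have "x - proj S x \<in> ortho_compl S" using proj_orth by (simp add: ortho_compl_def)
    then have "cinner x (x - proj S x) = 0" "cinner (proj S x) (x - proj S x) = 0"
      using x proj_in[of x] by (auto simp: ortho_compl_def) (metis cinner_commute complex_cnj_zero)
    then have "cinner (x - proj S x) (x - proj S x) = 0" by (simp add: cinner_diff_left)
    then show "x \<in> S" using proj_in[of x] by simp
  qed
qed

end

lemma closed_csubspace_kernel:
  assumes T: "bounded_clinear T" shows "closed_csubspace {x. T x = 0}"
  unfolding closed_csubspace_def
proof
  show "csubspace {x. T x = 0}"
    by (rule complex_vector.subspaceI) (simp_all add: bcl_simps[OF T])
  show "closed {x. T x = 0}"
    by (intro closed_Collect_eq bcl_continuous[OF T] continuous_intros)
qed

lemma closed_csubspace_Int: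
  "closed_csubspace S \<Longrightarrow> closed_csubspace T \<Longrightarrow> closed_csubspace (S \<inter> T)"
  by (simp add: closed_csubspace_def complex_vector.subspace_inter closed_Int)

lemma riesz_representation:
  fixes \<phi> :: "'a::chilbert_space \<Rightarrow> complex"
  assumes add: "\<And>x y. \<phi> (x + y) = \<phi> x + \<phi> y" and scale: "\<And>c x. \<phi> (c *\<^sub>C x) = c * \<phi> x"
    and bound: "\<And>x. cmod (\<phi> x) \<le> K * norm x"
  shows "\<exists>z. \<forall>x. \<phi> x = cinner x z"
proof (cases "\<forall>x. \<phi> x = 0")
  case True
  then show ?thesis by (intro exI[of _ 0]) simp
next
  case False
  then obtain u where u: "\<phi> u \<noteq> 0" by blast
  have minus: "\<phi> (x - y) = \<phi> x - \<phi> y" for x y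
    using add[of "x - y" y] by (simp add: algebra_simps)
  have "bounded_linear \<phi>"
  proof (rule bounded_linear_intro[where K = K])
    fix r x show "\<phi> (r *\<^sub>R x) = r *\<^sub>R \<phi> x"
      using scale[of "complex_of_real r" x] by (simp add: scaleC_of_real scaleR_conv_of_real)
  qed (use add bound in \<open>simp_all add: mult.commute\<close>)
  then have "continuous_on UNIV \<phi>" by (rule linear_continuous_on)
  then have "closed {x. \<phi> x = 0}" by (intro closed_Collect_eq) auto
  moreover have "csubspace {x. \<phi> x = 0}"
    using scale[of 0 0] by (intro complex_vector.subspaceI) (auto simp: add scale)
  ultimately have S: "closed_csubspace {x. \<phi> x = 0}" by (simp add: closed_csubspace_def)
  define v where "v = u - proj {x. \<phi> x = 0} u"
  have v: "\<phi> v \<noteq> 0" using proj_in[OF S, of u] u by (simp add: v_def minus)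
  then have vz: "v \<noteq> 0" using scale[of 0 0] by auto
  define z where "z = cnj (\<phi> v / complex_of_real ((norm v)\<^sup>2)) *\<^sub>C v"
  have "\<phi> x = cinner x z" for x
  proof -
    have "\<phi> (x - (\<phi> x / \<phi> v) *\<^sub>C v) = 0" using v by (simp add: minus scale)
    then have "cinner v (x - (\<phi> x / \<phi> v) *\<^sub>C v) = 0"
      unfolding v_def using proj_orth[OF S] by simp
    then have "cinner (x - (\<phi> x / \<phi> v) *\<^sub>C v) v = 0"
      by (metis cinner_commute complex_cnj_zero)
    then have "cinner x v = (\<phi> x / \<phi> v) * complex_of_real ((norm v)\<^sup>2)"
      by (simp add: cinner_diff_left cinner_scaleC_left cinner_self)
    then show ?thesis using v vz by (simp add: z_def cinner_scaleC_right)
  qed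
  then show ?thesis by blast
qed

lemma cadjoint_exists:
  fixes T :: "'a::chilbert_space \<Rightarrow> 'b::chilbert_space"
  assumes T: "bounded_clinear T"
  shows "\<exists>S. \<forall>x y. cinner (T x) y = cinner x (S y)"
proof -
  obtain K where K: "\<And>x. norm (T x) \<le> K * norm x" using bcl_bounded[OF T] by blast
  have "\<exists>z. \<forall>x. cinner (T x) y = cinner x z" for y
  proof (rule riesz_representation[where K = "K * norm y"])
    fix x
    have "cmod (cinner (T x) y) \<le> norm (T x) * norm y" by (rule cauchy_schwarz)
    also have "\<dots> \<le> K * norm x * norm y" by (intro mult_right_mono K) simp
    finally show "cmod (cinner (T x) y) \<le> K * norm y * norm x" by (simp add: mult_ac)
  qed (simp_all add: bcl_simps[OF T] cinner_simps)
  then show ?thesis by metis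
qed

lemma cadjoint: "bounded_clinear T \<Longrightarrow> cinner (T x) y = cinner x (cadjoint T y)"
  using someI_ex[OF cadjoint_exists] unfolding cadjoint_def by blast

lemma cadjoint': "bounded_clinear T \<Longrightarrow> cinner (cadjoint T y) x = cinner y (T x)"
  using cadjoint by (metis cinner_commute)

lemma cadjoint_eqI:
  assumes "\<And>x y. cinner (T x) y = cinner x (S y)"
  shows "cadjoint T = S"
proof
  fix y
  have "\<forall>x y. cinner (T x) y = cinner x (cadjoint T y)"
    unfolding cadjoint_def by (rule someI[of _ S]) (simp add: assms)
  then show "cadjoint T y = S y" by (intro cinner_eqI') (simp add: assms[symmetric])
qed

lemma cadjoint_bound:
  assumes T: "bounded_clinear T" and K: "K \<ge> 0" "\<And>x. norm (T x) \<le> K * norm x"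
  shows "norm (cadjoint T y) \<le> K * norm y"
proof -
  have "(norm (cadjoint T y))\<^sup>2 = Re (cinner y (T (cadjoint T y)))"
    by (simp add: norm_sq_cinner cadjoint'[OF T])
  also have "\<dots> \<le> norm y * norm (T (cadjoint T y))" by (rule Re_cauchy_schwarz)
  also have "\<dots> \<le> norm y * (K * norm (cadjoint T y))" by (intro mult_left_mono K) simp
  finally have "norm (cadjoint T y) * norm (cadjoint T y)
      \<le> (K * norm y) * norm (cadjoint T y)" by (simp add: power2_eq_square mult_ac)
  then show ?thesis
    using K by (cases "norm (cadjoint T y) = 0") (auto simp: mult_le_cancel_right)
qed

lemma bounded_clinear_cadjoint:
  fixes T :: "'a::chilbert_space \<Rightarrow> 'b::chilbert_space"
  assumes T: "bounded_clinear T" shows "bounded_clinear (cadjoint T)"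
proof -
  obtain K where K: "K > 0" "\<And>x. norm (T x) \<le> K * norm x" using bcl_bounded[OF T] by blast
  show ?thesis
  proof (rule bounded_clinearI[where K = K])
    fix x y :: 'b and c :: complex
    show "cadjoint T (x + y) = cadjoint T x + cadjoint T y"
      by (rule cinner_eqI) (simp add: cinner_simps cadjoint'[OF T])
    show "cadjoint T (c *\<^sub>C x) = c *\<^sub>C cadjoint T x"
      by (rule cinner_eqI) (simp add: cinner_simps cadjoint'[OF T])
    show "norm (cadjoint T x) \<le> K * norm x" using cadjoint_bound[OF T _ K(2)] K(1) by simp
  qed
qed

lemma cadjoint_cadjoint: "bounded_clinear T \<Longrightarrow> cadjoint (cadjoint T) = T"
  by (rule cadjoint_eqI) (simp add: cadjoint')

lemma cadjoint_comp:
  "bounded_clinear S \<Longrightarrow> bounded_clinear T \<Longrightarrow>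
    cadjoint (\<lambda>x. S (T x)) = (\<lambda>x. cadjoint T (cadjoint S x))"
  by (rule cadjoint_eqI) (simp add: cadjoint)

lemma cadjoint_id: "cadjoint (\<lambda>x. x) = (\<lambda>x. x)"
  by (rule cadjoint_eqI) simp

lemma cadjoint_diff:
  "bounded_clinear S \<Longrightarrow> bounded_clinear T \<Longrightarrow>
    cadjoint (\<lambda>x. S x - T x) = (\<lambda>x. cadjoint S x - cadjoint T x)"
  by (rule cadjoint_eqI) (simp add: cinner_simps cadjoint)

lemma closed_image_bounded_below:
  fixes T :: "'a::chilbert_space \<Rightarrow> 'b::chilbert_space"
  assumes T: "bounded_clinear T" and M: "closed_csubspace M"
    and c: "c > 0" "\<And>x. x \<in> M \<Longrightarrow> c * norm x \<le> norm (T x)"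
  shows "closed_csubspace (T ` M)"
  unfolding closed_csubspace_def
proof
  show "csubspace (T ` M)"
  proof (rule complex_vector.subspaceI)
    show "0 \<in> T ` M" using bcl_zero[OF T] closed_csubspaceD(2)[OF M] by (metis imageI)
    show "u + v \<in> T ` M" if "u \<in> T ` M" "v \<in> T ` M" for u v
      using that closed_csubspaceD(3)[OF M] by (metis (no_types, lifting) bcl_add[OF T] image_iff)
    show "a *\<^sub>C u \<in> T ` M" if "u \<in> T ` M" for a u
      using that closed_csubspaceD(5)[OF M] by (metis (no_types, lifting) bcl_scaleC[OF T] image_iff)
  qed
  show "closed (T ` M)"
    unfolding closed_sequential_limits
  proof (intro allI impI, elim conjE)
    fix y l assume y: "\<forall>n. y n \<in> T ` M" and l: "y \<longlonglongrightarrow> l"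
    obtain x where x: "\<And>n. x n \<in> M" "\<And>n. y n = T (x n)"
    proof -
      have "\<forall>n. \<exists>z. z \<in> M \<and> y n = T z" using y by blast
      then show ?thesis using that by metis
    qed
    have "Cauchy x"
    proof (rule CauchyI)
      fix e :: real assume "e > 0"
      then obtain N where N: "\<And>m n. m \<ge> N \<Longrightarrow> n \<ge> N \<Longrightarrow> norm (y m - y n) < c * e"
        using CauchyD[OF LIMSEQ_imp_Cauchy[OF l] mult_pos_pos[OF c(1) \<open>e > 0\<close>]] by blast
      have "norm (x m - x n) < e" if "m \<ge> N" "n \<ge> N" for m n
      proof -
        have "c * norm (x m - x n) \<le> norm (y m - y n)"
          using c(2)[of "x m - x n"] x closed_csubspaceD(4)[OF M] by (simp add: bcl_diff[OF T])
        also have "\<dots> < c * e" by (rule N[OF that])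
        finally show ?thesis using c(1) by simp
      qed
      then show "\<exists>N. \<forall>m\<ge>N. \<forall>n\<ge>N. norm (x m - x n) < e" by blast
    qed
    then obtain z where z: "x \<longlonglongrightarrow> z" using Cauchy_convergent_iff convergent_def by blast
    have "z \<in> M" using closed_sequentially[OF closed_csubspaceD(1)[OF M] _ z] x by blast
    moreover have "T z = l"
    proof -
      have "(\<lambda>n. T (x n)) = y" by (simp add: fun_eq_iff x(2))
      then show ?thesis using LIMSEQ_unique[OF bcl_tendsto[OF T z], of l] l by simp
    qed
    ultimately show "l \<in> T ` M" by blast
  qed
qed

lemma closed_csubspace_UNIV: "closed_csubspace UNIV"
  by (simp add: closed_csubspace_def)

text \<open>The range is closed, and its orthogonal complement is the kernel of the adjoint.\<close>

lemma surj_if_bounded_below: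
  fixes T :: "'a::chilbert_space \<Rightarrow> 'b::chilbert_space"
  assumes T: "bounded_clinear T" and c: "c > 0" "\<And>x. c * norm x \<le> norm (T x)"
    and inj: "\<And>y. cadjoint T y = 0 \<Longrightarrow> y = 0"
  shows "surj T"
proof -
  have S: "closed_csubspace (range T)"
    using closed_image_bounded_below[OF T closed_csubspace_UNIV c(1)] c(2) by blast
  have "y \<in> range T" for y
  proof -
    have "cinner x (cadjoint T (y - proj (range T) y)) = 0" for x
      using proj_orth[OF S, of "T x" y] by (metis T cadjoint cinner_commute complex_cnj_zero rangeI)
    then have "cadjoint T (y - proj (range T) y) = 0" using cinner_self_eq_0 by blast
    then have "y = proj (range T) y" using inj by fastforce
    then show ?thesis using proj_in[OF S, of y] by simp
  qed
  then show ?thesis by blast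
qed

abbreviation finv :: "('a \<Rightarrow> 'b) \<Rightarrow> 'b \<Rightarrow> 'a" where
  "finv T \<equiv> inv_into UNIV T"

lemma bounded_clinear_inverse:
  fixes T :: "'a::chilbert_space \<Rightarrow> 'b::chilbert_space"
  assumes T: "bounded_clinear T" and c: "c > 0" "\<And>x. c * norm x \<le> norm (T x)" and s: "surj T"
  shows "bounded_clinear (finv T)" "T (finv T y) = y" "finv T (T x) = x"
    "norm (finv T y) \<le> norm y / c"
proof -
  have inj: "inj T"
  proof (rule injI)
    fix x y assume "T x = T y"
    then have "c * norm (x - y) \<le> 0" using c(2)[of "x - y"] by (simp add: bcl_diff[OF T])
    then show "x = y" using c(1) by (simp add: mult_le_0_iff)
  qed
  show 1: "T (finv T y) = y" for y by (rule surj_f_inv_f[OF s])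
  show 2: "finv T (T x) = x" for x by (rule inv_f_f[OF inj])
  have 3: "norm (finv T y) \<le> norm y / c" for y
    using c(2)[of "finv T y"] c(1) 1 by (simp add: pos_le_divide_eq mult.commute)
  then show "norm (finv T y) \<le> norm y / c" .
  show "bounded_clinear (finv T)"
    by (rule bounded_clinearI[where K = "1 / c"])
       (metis 1 2 bcl_add[OF T], metis 1 2 bcl_scaleC[OF T], use 3 in simp)
qed

section \<open>Finite orthonormal sets and dimension\<close>

definition orthonormal :: "'a::complex_inner set \<Rightarrow> bool" where
  "orthonormal G \<longleftrightarrow> (\<forall>x\<in>G. norm x = 1) \<and> (\<forall>x\<in>G. \<forall>y\<in>G. x \<noteq> y \<longrightarrow> cinner x y = 0)"

text \<open>For a finite orthonormal set this is the orthogonal projection onto its span.\<close>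

definition fproj :: "'a::complex_inner set \<Rightarrow> 'a \<Rightarrow> 'a" where
  "fproj G x = (\<Sum>g\<in>G. cinner x g *\<^sub>C g)"

lemma orthonormalD:
  assumes "orthonormal G"
  shows "x \<in> G \<Longrightarrow> norm x = 1" "x \<in> G \<Longrightarrow> y \<in> G \<Longrightarrow> x \<noteq> y \<Longrightarrow> cinner x y = 0"
  using assms unfolding orthonormal_def by simp_all

lemma orthonormalI:
  "(\<And>x. x \<in> G \<Longrightarrow> norm x = 1) \<Longrightarrow> (\<And>x y. x \<in> G \<Longrightarrow> y \<in> G \<Longrightarrow> x \<noteq> y \<Longrightarrow> cinner x y = 0)
    \<Longrightarrow> orthonormal G"
  unfolding orthonormal_def by simp

lemma orthonormal_cinner:
  assumes "orthonormal G" "g \<in> G" "h \<in> G"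
  shows "cinner g h = (if g = h then 1 else 0)"
  using orthonormalD[OF assms(1)] assms(2,3) by (simp add: cinner_self)

lemma orthonormal_empty [simp]: "orthonormal {}"
  by (rule orthonormalI) simp_all

lemma orthonormal_subset:
  assumes "orthonormal G" "F \<subseteq> G" shows "orthonormal F"
  by (rule orthonormalI) (use orthonormalD[OF assms(1)] subsetD[OF assms(2)] in simp_all)

lemma cinner_eq_0_commute: "cinner x y = 0 \<longleftrightarrow> cinner y x = 0"
  by (metis cinner_commute complex_cnj_zero)

lemma orthonormal_Un:
  assumes "orthonormal G" "orthonormal H" "\<And>g h. g \<in> G \<Longrightarrow> h \<in> H \<Longrightarrow> cinner g h = 0"
  shows "orthonormal (G \<union> H)" "G \<inter> H = {}"
proof -
  show "orthonormal (G \<union> H)"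
  proof (rule orthonormalI)
    fix x y assume xy: "x \<in> G \<union> H" "y \<in> G \<union> H" "x \<noteq> y"
    from xy(1,2) consider "x \<in> G" "y \<in> G" | "x \<in> G" "y \<in> H" | "x \<in> H" "y \<in> G" | "x \<in> H" "y \<in> H"
      by (elim UnE)
    then show "cinner x y = 0"
      by cases (use assms orthonormalD(2) xy(3) cinner_eq_0_commute in metis)+
  qed (use orthonormalD(1) assms in \<open>metis UnE\<close>)
  have False if "x \<in> G" "x \<in> H" for x
    using assms(3)[OF that] orthonormalD(1)[OF assms(1) that(1)] by (simp add: cinner_self)
  then show "G \<inter> H = {}" by blast
qed

lemma orthonormal_insert:
  assumes "orthonormal G" "norm u = 1" "\<And>g. g \<in> G \<Longrightarrow> cinner u g = 0"
  shows "orthonormal (insert u G)" "u \<notin> G"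
  using orthonormal_Un[of "{u}" G] assms by (simp_all add: orthonormal_def)

lemma bounded_clinear_fproj: "bounded_clinear (fproj G)"
  unfolding fproj_def[abs_def] by (intro bounded_clinear_intros)

lemma cinner_sum_orthonormal:
  assumes G: "finite G" "g \<in> G" and o: "orthonormal (f ` G)" and inj: "inj_on f G"
  shows "cinner (\<Sum>h\<in>G. a h *\<^sub>C f h) (f g) = a g"
proof -
  have "cinner (\<Sum>h\<in>G. a h *\<^sub>C f h) (f g) = (\<Sum>h\<in>G. a h * (if h = g then 1 else 0))"
    unfolding cinner_sum_left cinner_scaleC_left
  proof (rule sum.cong)
    fix h assume h: "h \<in> G"
    have "f h = f g \<longleftrightarrow> h = g" using inj_on_eq_iff[OF inj h G(2)] .
    then show "a h * cinner (f h) (f g) = a h * (if h = g then 1 else 0)"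
      using orthonormal_cinner[OF o imageI[OF h] imageI[OF G(2)]] by simp
  qed simp
  then show ?thesis using G by (simp add: if_distrib cong: if_cong)
qed

lemma cinner_fproj:
  assumes "finite G" "orthonormal G" "h \<in> G"
  shows "cinner (fproj G x) h = cinner x h"
  using cinner_sum_orthonormal[of G h "\<lambda>x. x"] assms by (simp add: fproj_def)

lemma fproj_in_cspan: "fproj G x \<in> cspan G"
  unfolding fproj_def
  by (intro complex_vector.span_sum complex_vector.span_scale complex_vector.span_base)

lemma csubspace_orth: "csubspace {z. cinner x z = 0}"
  by (rule complex_vector.subspaceI) (simp_all add: cinner_simps)

lemma fproj_orth:
  assumes "finite G" "orthonormal G" "z \<in> cspan G"
  shows "cinner (x - fproj G x) z = 0"
proof -
  have "G \<subseteq> {z. cinner (x - fproj G x) z = 0}"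
    using cinner_fproj[OF assms(1,2)] by (auto simp: cinner_diff_left)
  then have "cspan G \<subseteq> {z. cinner (x - fproj G x) z = 0}"
    by (intro complex_vector.span_minimal csubspace_orth)
  then show ?thesis using assms(3) by blast
qed

lemma fproj_eq_self:
  assumes "finite G" "orthonormal G" "z \<in> cspan G"
  shows "fproj G z = z"
proof -
  have "z - fproj G z \<in> cspan G"
    using assms(3) fproj_in_cspan by (rule complex_vector.span_diff)
  from fproj_orth[OF assms(1,2) this, of z] show ?thesis by simp
qed

lemma fproj_eq_self_iff:
  "finite G \<Longrightarrow> orthonormal G \<Longrightarrow> fproj G z = z \<longleftrightarrow> z \<in> cspan G"
  using fproj_eq_self fproj_in_cspan by metis

lemma closed_csubspace_cspan:
  fixes G :: "'a::complex_inner set"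
  assumes "finite G" "orthonormal G" shows "closed_csubspace (cspan G)"
proof -
  have "cspan G = {x. (\<lambda>x. x - fproj G x) x = 0}"
  proof (rule Set.set_eqI)
    fix x show "x \<in> cspan G \<longleftrightarrow> x \<in> {x. x - fproj G x = 0}"
      using fproj_eq_self_iff[OF assms, of x] by (simp only: mem_Collect_eq right_minus_eq) metis
  qed
  moreover have "bounded_clinear (\<lambda>x. x - fproj G x)"
    by (intro bounded_clinear_intros bounded_clinear_fproj)
  ultimately show ?thesis using closed_csubspace_kernel by metis
qed

lemma fproj_eq_proj:
  assumes "finite G" "orthonormal G" shows "fproj G = proj (cspan G)"
  by (rule ext, rule proj_unique[OF closed_csubspace_cspan[OF assms], symmetric])
     (simp_all add: fproj_in_cspan fproj_orth[OF assms])

lemma norm_fproj: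
  assumes "finite G" "orthonormal G"
  shows "(norm (fproj G x))\<^sup>2 = (\<Sum>g\<in>G. (cmod (cinner x g))\<^sup>2)"
proof -
  have "cinner (fproj G x) (fproj G x) = (\<Sum>g\<in>G. cinner x g * cinner g (fproj G x))"
    by (subst (1) fproj_def) (simp only: cinner_sum_left cinner_scaleC_left)
  also have "\<dots> = (\<Sum>g\<in>G. cinner x g * cnj (cinner x g))"
    by (rule sum.cong) (simp_all add: cinner_commute[of _ "fproj G x"] cinner_fproj[OF assms])
  also have "\<dots> = complex_of_real (\<Sum>g\<in>G. (cmod (cinner x g))\<^sup>2)"
    by (simp add: complex_norm_square del: of_real_power)
  finally show ?thesis by (simp only: cinner_self of_real_eq_iff)
qed

lemma fproj_pythagoras:
  assumes "finite G" "orthonormal G"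
  shows "(norm x)\<^sup>2 = (\<Sum>g\<in>G. (cmod (cinner x g))\<^sup>2) + (norm (x - fproj G x))\<^sup>2"
proof -
  have "cinner (x - fproj G x) (fproj G x) = 0" by (rule fproj_orth[OF assms fproj_in_cspan])
  from pythagoras[OF this] show ?thesis by (simp add: norm_fproj[OF assms])
qed

lemma bessel:
  "finite G \<Longrightarrow> orthonormal G \<Longrightarrow> (\<Sum>g\<in>G. (cmod (cinner x g))\<^sup>2) \<le> (norm x)\<^sup>2"
  by (subst fproj_pythagoras) auto

lemma independent_orthonormal:
  assumes "orthonormal (G :: 'a::complex_inner set)" "finite G" shows "\<not> cdependent G"
proof
  assume "cdependent G"
  then obtain a where a: "a \<in> G" "a \<in> cspan (G - {a})"
    unfolding complex_vector.dependent_def by blast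
  have 1: "orthonormal (G - {a})" "finite (G - {a})"
    using assms orthonormal_subset[of G "G - {a}"] by auto
  have "fproj (G - {a}) a = 0"
    unfolding fproj_def by (rule sum.neutral) (use a orthonormalD(2)[OF assms(1) a(1)] in auto)
  then have "a = 0" using fproj_eq_self[OF 1(2,1) a(2)] by simp
  then show False using orthonormalD(1)[OF assms(1) a(1)] by simp
qed

lemma cdim_cspan: "orthonormal G \<Longrightarrow> finite G \<Longrightarrow> cdim (cspan G) = card G"
  using complex_vector.dim_eq_card[of G "cspan G"] independent_orthonormal[of G]
  by (simp add: complex_vector.span_span)

lemma hdim_cspan: "orthonormal G \<Longrightarrow> finite G \<Longrightarrow> hdim (cspan G) = enat (card G)"
  unfolding hdim_def using cdim_cspan by auto

text \<open>One step of the Gram-Schmidt process.\<close>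

lemma orthonormal_extend1:
  fixes G :: "'a::complex_inner set"
  assumes G: "finite G" "orthonormal G" and x: "x \<notin> cspan G"
  shows "\<exists>u. u \<notin> G \<and> orthonormal (insert u G) \<and> cspan (insert u G) = cspan (insert x G)"
proof -
  define v where "v = x - fproj G x"
  have v: "norm v \<noteq> 0" using x fproj_in_cspan[of G x] by (auto simp: v_def)
  define u where "u = complex_of_real (1 / norm v) *\<^sub>C v"
  have "norm u = 1" using v by (simp add: u_def norm_scaleC norm_divide)
  moreover have "cinner u g = 0" if "g \<in> G" for g
    using fproj_orth[OF G complex_vector.span_base[OF that], of x]
    by (simp add: u_def v_def cinner_scaleC_left)
  ultimately have u: "orthonormal (insert u G)" "u \<notin> G" using orthonormal_insert[OF G(2)] by blast+
  have f: "fproj G x \<in> cspan (insert y G)" for y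
    using complex_vector.span_mono[of G "insert y G"] fproj_in_cspan[of G x] by blast
  have b: "y \<in> cspan (insert y G)" for y :: 'a by (rule complex_vector.span_base) simp
  have "x = complex_of_real (norm v) *\<^sub>C u + fproj G x"
    using v by (simp add: u_def v_def scaleC_scaleC)
  also have "\<dots> \<in> cspan (insert u G)"
    using f b by (intro complex_vector.span_add complex_vector.span_scale)
  finally have xu: "x \<in> cspan (insert u G)" .
  have ux: "u \<in> cspan (insert x G)"
    unfolding u_def v_def by (intro complex_vector.span_scale complex_vector.span_diff f b)
  have m: "cspan (insert y G) \<subseteq> cspan (insert z G)" if "y \<in> cspan (insert z G)" for y z
    using that complex_vector.span_superset[of "insert z G"]
    by (intro complex_vector.span_minimal) auto
  from m[OF xu] m[OF ux] u show ?thesis by blast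
qed

lemma orthonormal_extend:
  fixes G :: "'a::complex_inner set"
  assumes "finite A" "finite G" "orthonormal G"
  shows "\<exists>N. finite N \<and> orthonormal N \<and> G \<subseteq> N \<and> cspan N = cspan (G \<union> A)"
  using assms(1)
proof induction
  case empty
  show ?case using assms by (intro exI[of _ G]) simp
next
  case (insert x A)
  then obtain N where N: "finite N" "orthonormal N" "G \<subseteq> N" "cspan N = cspan (G \<union> A)" by blast
  have eq: "cspan (insert x N) = cspan (G \<union> insert x A)"
    using N(4) complex_vector.span_insert[of x N] complex_vector.span_insert[of x "G \<union> A"] by simp
  show ?case
  proof (cases "x \<in> cspan N")
    case True
    then show ?thesis using N eq complex_vector.span_redundant[of x N] by (intro exI[of _ N]) simp
  next
    case False
    from orthonormal_extend1[OF N(1,2) this] obtain u where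
      "orthonormal (insert u N)" "cspan (insert u N) = cspan (insert x N)" by blast
    then show ?thesis using N eq by (intro exI[of _ "insert u N"]) auto
  qed
qed

lemma cspan_subset: "csubspace S \<Longrightarrow> G \<subseteq> S \<Longrightarrow> cspan G \<subseteq> S"
  using complex_vector.span_minimal by blast

lemma card_orthonormal_le:
  assumes "finite B" "finite G" "orthonormal G" "G \<subseteq> cspan B" shows "card G \<le> card B"
  using complex_vector.independent_span_bound[OF assms(1) independent_orthonormal] assms by blast

text \<open>An orthonormal subset of maximal cardinality spans, since otherwise a Gram-Schmidt step would
  enlarge it.\<close>

lemma orthonormal_spanning:
  fixes S :: "'a::complex_inner set"
  assumes S: "csubspace S"
    and bound: "\<And>G. finite G \<Longrightarrow> orthonormal G \<Longrightarrow> G \<subseteq> S \<Longrightarrow> card G \<le> n"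
  shows "\<exists>G. finite G \<and> orthonormal G \<and> cspan G = S"
proof -
  define P where "P m \<longleftrightarrow> (\<exists>G \<subseteq> S. finite G \<and> orthonormal G \<and> card G = m)" for m
  have "P 0" unfolding P_def by (intro exI[of _ "{}"]) simp
  moreover have "\<forall>m. P m \<longrightarrow> m \<le> n" using bound unfolding P_def by blast
  ultimately obtain m where m: "P m" "\<And>k. P k \<Longrightarrow> k \<le> m"
    using Greatest_le_nat[of P _ n] GreatestI_nat[of P 0 n] by blast
  then obtain G where G: "G \<subseteq> S" "finite G" "orthonormal G" "card G = m" unfolding P_def by blast
  have "S \<subseteq> cspan G"
  proof (rule ccontr)
    assume "\<not> S \<subseteq> cspan G"
    then obtain x where x: "x \<in> S" "x \<notin> cspan G" by blast
    from orthonormal_extend1[OF G(2,3) x(2)] obtain u where u: "u \<notin> G" "orthonormal (insert u G)"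
      "cspan (insert u G) = cspan (insert x G)" by blast
    have "insert u G \<subseteq> S"
      using cspan_subset[OF S, of "insert x G"] G(1) x(1) u(3)
        complex_vector.span_superset[of "insert u G"] by (simp add: subset_iff)
    then have "P (Suc m)" unfolding P_def using u G by (intro exI[of _ "insert u G"]) auto
    then show False using m(2) by fastforce
  qed
  then show ?thesis using G cspan_subset[OF S G(1)] by blast
qed

lemma hdim_finiteE:
  fixes S :: "'a::complex_inner set"
  assumes S: "csubspace S" and fin: "hdim S \<noteq> \<infinity>"
  obtains G where "finite G" "orthonormal G" "cspan G = S" "hdim S = enat (card G)"
proof -
  obtain B where B: "finite B" "S \<subseteq> cspan B" using fin unfolding hdim_def by (auto split: if_splits)
  have "\<exists>G. finite G \<and> orthonormal G \<and> cspan G = S"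
    by (rule orthonormal_spanning[OF S, of "card B"]) (use card_orthonormal_le B in blast)
  then show ?thesis using that hdim_cspan by blast
qed

lemma card_le_hdim:
  assumes "csubspace S" "finite G" "orthonormal G" "G \<subseteq> S" shows "enat (card G) \<le> hdim S"
proof (cases "hdim S = \<infinity>")
  case False
  then obtain H where "finite H" "orthonormal H" "cspan H = S" "hdim S = enat (card H)"
    using hdim_finiteE[OF assms(1)] by blast
  then show ?thesis using card_orthonormal_le[of H G] assms by simp
qed simp

lemma orthonormal_of_card:
  fixes S :: "'a::complex_inner set"
  assumes S: "csubspace S" and n: "enat n \<le> hdim S"
  shows "\<exists>G. finite G \<and> orthonormal G \<and> G \<subseteq> S \<and> card G = n"
  using n
proof (induction n)
  case 0
  show ?case by (intro exI[of _ "{}"]) simp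
next
  case (Suc n)
  then have "enat n \<le> hdim S" by (metis Suc_ile_eq order_less_imp_le)
  then obtain G where G: "finite G" "orthonormal G" "G \<subseteq> S" "card G = n" using Suc.IH by blast
  have "\<not> S \<subseteq> cspan G"
  proof
    assume "S \<subseteq> cspan G"
    then have "S = cspan G" using cspan_subset[OF S G(3)] by blast
    then show False using hdim_cspan[OF G(2,1)] Suc.prems G(4) by simp
  qed
  then obtain x where x: "x \<in> S" "x \<notin> cspan G" by blast
  from orthonormal_extend1[OF G(1,2) x(2)] obtain u where u: "u \<notin> G" "orthonormal (insert u G)"
    "cspan (insert u G) = cspan (insert x G)" by blast
  have "insert u G \<subseteq> S"
    using cspan_subset[OF S, of "insert x G"] G(3) x(1) u(3)
      complex_vector.span_superset[of "insert u G"] by (simp add: subset_iff)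
  then show ?case using u G by (intro exI[of _ "insert u G"]) auto
qed

lemma orthonormal_basisD:
  assumes "orthonormal_basis B" shows "orthonormal B"
  using assms by (simp add: orthonormal_basis_def orthonormal_def)

lemma orthonormal_basis_approx:
  assumes B: "orthonormal_basis B" and e: "e > 0"
  shows "\<exists>F. finite F \<and> F \<subseteq> B \<and> (norm x)\<^sup>2 \<le> (\<Sum>b\<in>F. (cmod (cinner x b))\<^sup>2) + e"
proof -
  have "x \<in> closure (cspan B)" using B by (simp add: orthonormal_basis_def)
  then obtain y where y: "y \<in> cspan B" "dist y x < sqrt e"
    using e closure_approachable[of x "cspan B"] by (metis real_sqrt_gt_0_iff)
  then obtain F where F: "finite F" "F \<subseteq> B" "y \<in> cspan F"
    using complex_vector.span_explicit[of B] complex_vector.span_explicit'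
    by (smt (verit) mem_Collect_eq complex_vector.span_sum complex_vector.span_scale complex_vector.span_base)
  have o: "orthonormal F" using orthonormal_subset[OF orthonormal_basisD[OF B] F(2)] .
  have "x - y = (x - fproj F x) + (fproj F x - y)" by simp
  moreover have "cinner (x - fproj F x) (fproj F x - y) = 0"
    using F(3) fproj_in_cspan by (intro fproj_orth F o complex_vector.span_diff)
  ultimately have "(norm (x - y))\<^sup>2 = (norm (x - fproj F x))\<^sup>2 + (norm (fproj F x - y))\<^sup>2"
    by (metis pythagoras)
  then have "(norm (x - fproj F x))\<^sup>2 \<le> (norm (x - y))\<^sup>2" by simp
  also have "\<dots> \<le> (sqrt e)\<^sup>2"
    by (intro power_mono) (use y(2) in \<open>simp_all add: dist_norm norm_minus_commute\<close>)
  also have "\<dots> = e" using e by simp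
  finally show ?thesis using fproj_pythagoras[OF F(1) o, of x] F by (intro exI[of _ F]) simp
qed

text \<open>A maximal orthonormal set is total, since a vector orthogonal to the closure of its span
  could be added to it.\<close>

lemma orthonormal_basis_exists: "\<exists>B :: 'a::chilbert_space set. orthonormal_basis B"
proof -
  have "\<exists>M\<in>{G :: 'a set. orthonormal G}. \<forall>X\<in>{G. orthonormal G}. M \<subseteq> X \<longrightarrow> X = M"
  proof (rule subset_Zorn')
    fix C :: "'a set set" assume C: "subset.chain {G. orthonormal G} C"
    show "\<Union>C \<in> {G. orthonormal G}"
      unfolding mem_Collect_eq orthonormal_def
    proof (intro conjI ballI impI)
      fix x assume "x \<in> \<Union>C"
      then obtain X where "X \<in> C" "x \<in> X" by blast
      then show "norm x = 1" using C orthonormalD(1) unfolding subset.chain_def by blast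
    next
      fix x y assume "x \<in> \<Union>C" "y \<in> \<Union>C" and ne: "x \<noteq> y"
      then obtain X Y where XY: "X \<in> C" "Y \<in> C" "x \<in> X" "y \<in> Y" by blast
      then have "X \<subseteq> Y \<or> Y \<subseteq> X" using C by (auto simp: subset.chain_def)
      then obtain Z where "Z \<in> C" "x \<in> Z" "y \<in> Z" using XY by blast
      moreover from this have "orthonormal Z" using C unfolding subset.chain_def by blast
      ultimately show "cinner x y = 0" using orthonormalD(2) ne by metis
    qed
  qed
  then obtain B :: "'a set" where B: "orthonormal B" "\<And>X. orthonormal X \<Longrightarrow> B \<subseteq> X \<Longrightarrow> X = B"
    by auto
  have sub: "csubspace (closure (cspan B))"
  proof (rule complex_vector.subspaceI)
    show "0 \<in> closure (cspan B)" using closure_subset complex_vector.span_zero by blast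
  next
    fix x y assume "x \<in> closure (cspan B)" "y \<in> closure (cspan B)"
    then obtain f g where "\<forall>n. f n \<in> cspan B" "f \<longlonglongrightarrow> x" "\<forall>n. g n \<in> cspan B" "g \<longlonglongrightarrow> y"
      unfolding closure_sequential by blast
    then show "x + y \<in> closure (cspan B)"
      unfolding closure_sequential
      by (intro exI[of _ "\<lambda>n. f n + g n"]) (auto intro: tendsto_add complex_vector.span_add)
  next
    fix a x assume "x \<in> closure (cspan B)"
    then obtain f where "\<forall>n. f n \<in> cspan B" "f \<longlonglongrightarrow> x" unfolding closure_sequential by blast
    then show "a *\<^sub>C x \<in> closure (cspan B)"
      unfolding closure_sequential
      by (intro exI[of _ "\<lambda>n. a *\<^sub>C f n"])
         (auto intro: bounded_linear.tendsto[OF bounded_linear_scaleC] complex_vector.span_scale)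
  qed
  then have S: "closed_csubspace (closure (cspan B))" by (simp add: closed_csubspace_def)
  have "x \<in> closure (cspan B)" for x
  proof (rule ccontr)
    assume x: "x \<notin> closure (cspan B)"
    define v where "v = x - proj (closure (cspan B)) x"
    have v: "norm v \<noteq> 0" using x proj_in[OF S, of x] by (auto simp: v_def)
    define u where "u = complex_of_real (1 / norm v) *\<^sub>C v"
    have "norm u = 1" using v by (simp add: u_def norm_scaleC norm_divide)
    moreover have "cinner u g = 0" if "g \<in> B" for g
    proof -
      have "g \<in> closure (cspan B)"
        using complex_vector.span_base[OF that] closure_subset by blast
      then show ?thesis using proj_orth[OF S] by (simp add: u_def v_def cinner_scaleC_left)
    qed
    ultimately have "orthonormal (insert u B)" "u \<notin> B" using orthonormal_insert[OF B(1)] by blast+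
    then show False using B(2)[of "insert u B"] by blast
  qed
  then have "closure (cspan B) = UNIV" by blast
  then have "orthonormal_basis B" using B(1) unfolding orthonormal_basis_def orthonormal_def by simp
  then show ?thesis by blast
qed

section \<open>Hilbert-Schmidt operators\<close>

text \<open>The quantification over all finite orthonormal sets, instead of one basis, makes the bound
  independent of choices and keeps every estimate a finite sum.\<close>

definition hs_bound :: "('a::complex_inner \<Rightarrow> 'b::complex_inner) \<Rightarrow> real \<Rightarrow> bool" where
  "hs_bound T C \<longleftrightarrow> (\<forall>F. finite F \<longrightarrow> orthonormal F \<longrightarrow> (\<Sum>x\<in>F. (norm (T x))\<^sup>2) \<le> C)"

lemma hs_boundD: "hs_bound T C \<Longrightarrow> finite F \<Longrightarrow> orthonormal F \<Longrightarrow> (\<Sum>x\<in>F. (norm (T x))\<^sup>2) \<le> C"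
  by (simp add: hs_bound_def)

lemma hs_bound_nonneg: "hs_bound T C \<Longrightarrow> 0 \<le> C"
  using hs_boundD[of T C "{}"] by simp

text \<open>\<open>\<Sum> \<parallel>T\<^sup>* g\<parallel>\<^sup>2 = \<Sum> \<Sum> |\<langle>T\<^sup>* g, b\<rangle>|\<^sup>2 = \<Sum> \<Sum> |\<langle>T b, g\<rangle>|\<^sup>2 \<le> \<Sum> \<parallel>T b\<parallel>\<^sup>2\<close>, where the
  expansions in the basis are cut off to finite sums at the price of an arbitrarily small error.\<close>

lemma hs_bound_cadjoint_basis:
  fixes T :: "'a::chilbert_space \<Rightarrow> 'b::chilbert_space"
  assumes T: "bounded_clinear T" and B: "orthonormal_basis B"
    and C: "\<And>F. finite F \<Longrightarrow> F \<subseteq> B \<Longrightarrow> (\<Sum>x\<in>F. (norm (T x))\<^sup>2) \<le> C"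
  shows "hs_bound (cadjoint T) C"
  unfolding hs_bound_def
proof (intro allI impI)
  fix G :: "'b set" assume G: "finite G" "orthonormal G"
  have "(\<Sum>g\<in>G. (norm (cadjoint T g))\<^sup>2) \<le> C + e" if "e > 0" for e
  proof -
    define e' where "e' = e / (real (card G) + 1)"
    have e': "e' > 0" using that by (simp add: e'_def add_nonneg_pos)
    have "\<forall>g. \<exists>F. finite F \<and> F \<subseteq> B \<and>
        (norm (cadjoint T g))\<^sup>2 \<le> (\<Sum>b\<in>F. (cmod (cinner (cadjoint T g) b))\<^sup>2) + e'"
      using orthonormal_basis_approx[OF B e'] by blast
    then obtain Fg where Fg: "\<And>g. finite (Fg g)" "\<And>g. Fg g \<subseteq> B"
      "\<And>g. (norm (cadjoint T g))\<^sup>2 \<le> (\<Sum>b\<in>Fg g. (cmod (cinner (cadjoint T g) b))\<^sup>2) + e'"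
      by metis
    define F where "F = (\<Union>g\<in>G. Fg g)"
    have F: "finite F" "F \<subseteq> B" using Fg G by (auto simp: F_def)
    have "(\<Sum>g\<in>G. (norm (cadjoint T g))\<^sup>2)
        \<le> (\<Sum>g\<in>G. (\<Sum>b\<in>F. (cmod (cinner (cadjoint T g) b))\<^sup>2) + e')"
    proof (rule sum_mono)
      fix g assume "g \<in> G"
      then have "(\<Sum>b\<in>Fg g. (cmod (cinner (cadjoint T g) b))\<^sup>2)
          \<le> (\<Sum>b\<in>F. (cmod (cinner (cadjoint T g) b))\<^sup>2)"
        using F(1) by (intro sum_mono2) (auto simp: F_def)
      then show "(norm (cadjoint T g))\<^sup>2 \<le> (\<Sum>b\<in>F. (cmod (cinner (cadjoint T g) b))\<^sup>2) + e'"
        using Fg(3)[of g] by linarith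
    qed
    also have "\<dots> = (\<Sum>b\<in>F. \<Sum>g\<in>G. (cmod (cinner (T b) g))\<^sup>2) + real (card G) * e'"
      by (simp add: sum.distrib sum.swap[of _ F G] cadjoint'[OF T] cmod_cinner_commute[of _ "T _"])
    also have "(\<Sum>b\<in>F. \<Sum>g\<in>G. (cmod (cinner (T b) g))\<^sup>2) \<le> (\<Sum>b\<in>F. (norm (T b))\<^sup>2)"
      by (intro sum_mono bessel G)
    also have "\<dots> \<le> C" by (rule C[OF F])
    also have "real (card G) * e' \<le> e"
      using that by (simp add: e'_def divide_le_eq mult.commute)
    finally show ?thesis by simp
  qed
  then show "(\<Sum>g\<in>G. (norm (cadjoint T g))\<^sup>2) \<le> C" by (rule field_le_epsilon)
qed

lemma hs_bound_cadjoint: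
  fixes T :: "'a::chilbert_space \<Rightarrow> 'b::chilbert_space"
  assumes "bounded_clinear T" "hs_bound T C" shows "hs_bound (cadjoint T) C"
proof -
  obtain B :: "'a set" where B: "orthonormal_basis B" using orthonormal_basis_exists by blast
  show ?thesis
    by (rule hs_bound_cadjoint_basis[OF assms(1) B])
       (use hs_boundD[OF assms(2)] orthonormal_subset[OF orthonormal_basisD[OF B]] in blast)
qed

text \<open>Passing to the adjoint twice replaces the bound along one basis by a bound along all finite
  orthonormal sets.\<close>

lemma hs_bound_of_basis:
  fixes T :: "'a::chilbert_space \<Rightarrow> 'b::chilbert_space"
  assumes T: "bounded_clinear T" and B: "orthonormal_basis B"
    and C: "\<And>F. finite F \<Longrightarrow> F \<subseteq> B \<Longrightarrow> (\<Sum>x\<in>F. (norm (T x))\<^sup>2) \<le> C"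
  shows "hs_bound T C"
  using hs_bound_cadjoint[OF bounded_clinear_cadjoint[OF T] hs_bound_cadjoint_basis[OF T B C]]
  by (simp add: cadjoint_cadjoint[OF T])

lemma hilbert_schmidt_iff:
  fixes T :: "'a::chilbert_space \<Rightarrow> 'b::chilbert_space"
  shows "hilbert_schmidt T \<longleftrightarrow> bounded_clinear T \<and> (\<exists>C. hs_bound T C)"
proof
  assume "hilbert_schmidt T"
  then obtain B where T: "bounded_clinear T" and B: "orthonormal_basis B"
    and s: "(\<lambda>b. (norm (T b))\<^sup>2) summable_on B" unfolding hilbert_schmidt_def by blast
  have "(\<Sum>x\<in>F. (norm (T x))\<^sup>2) \<le> (\<Sum>\<^sub>\<infinity>b\<in>B. (norm (T b))\<^sup>2)" if "finite F" "F \<subseteq> B" for F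
    using finite_sum_le_infsum[OF s that] by simp
  then show "bounded_clinear T \<and> (\<exists>C. hs_bound T C)" using T hs_bound_of_basis[OF T B] by blast
next
  assume "bounded_clinear T \<and> (\<exists>C. hs_bound T C)"
  then obtain C where T: "bounded_clinear T" "hs_bound T C" by blast
  obtain B :: "'a set" where B: "orthonormal_basis B" using orthonormal_basis_exists by blast
  have "(\<lambda>b. (norm (T b))\<^sup>2) summable_on B"
  proof (rule nonneg_bdd_above_summable_on)
    show "bdd_above (sum (\<lambda>b. (norm (T b))\<^sup>2) ` {F. F \<subseteq> B \<and> finite F})"
      using hs_boundD[OF T(2)] orthonormal_subset[OF orthonormal_basisD[OF B]]
      by (intro bdd_aboveI[of _ C]) blast
  qed simp
  then show "hilbert_schmidt T" unfolding hilbert_schmidt_def using T B by blast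
qed

lemma hs_bcl: "hilbert_schmidt T \<Longrightarrow> bounded_clinear T"
  by (simp add: hilbert_schmidt_def)

lemma hsI: 
  fixes T :: "'a::chilbert_space \<Rightarrow> 'b::chilbert_space"
  shows "bounded_clinear T \<Longrightarrow> hs_bound T C \<Longrightarrow> hilbert_schmidt T"
  using hilbert_schmidt_iff by blast

lemma hsE:
  fixes T :: "'a::chilbert_space \<Rightarrow> 'b::chilbert_space"
  assumes "hilbert_schmidt T" obtains C where "hs_bound T C" "C \<ge> 0"
  using assms hilbert_schmidt_iff[of T] hs_bound_nonneg by blast

lemma hs_bound_dominated:
  assumes "hs_bound T C" and "\<And>x. norm (S x) \<le> a * norm (T x)"
  shows "hs_bound S (a\<^sup>2 * C)"
  unfolding hs_bound_def
proof (intro allI impI)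
  fix F :: "'a set" assume F: "finite F" "orthonormal F"
  have "(\<Sum>x\<in>F. (norm (S x))\<^sup>2) \<le> (\<Sum>x\<in>F. a\<^sup>2 * (norm (T x))\<^sup>2)"
    unfolding power_mult_distrib[symmetric] by (intro sum_mono power_mono assms) simp
  also have "\<dots> \<le> a\<^sup>2 * C"
    unfolding sum_distrib_left[symmetric] by (intro mult_left_mono hs_boundD[OF assms(1) F]) simp
  finally show "(\<Sum>x\<in>F. (norm (S x))\<^sup>2) \<le> a\<^sup>2 * C" .
qed

lemma hs_bound_comp_right:
  fixes T :: "'b::chilbert_space \<Rightarrow> 'c::chilbert_space" and A :: "'a::chilbert_space \<Rightarrow> 'b"
  assumes T: "bounded_clinear T" "hs_bound T C" and A: "bounded_clinear A"
    and a: "a \<ge> 0" "\<And>x. norm (A x) \<le> a * norm x"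
  shows "hs_bound (\<lambda>x. T (A x)) (a\<^sup>2 * C)"
proof -
  have TA: "bounded_clinear (\<lambda>x. T (A x))" by (rule bounded_clinear_comp[OF T(1) A])
  have "hs_bound (\<lambda>x. cadjoint A (cadjoint T x)) (a\<^sup>2 * C)"
    by (rule hs_bound_dominated[OF hs_bound_cadjoint[OF T]]) (rule cadjoint_bound[OF A a])
  then have "hs_bound (cadjoint (\<lambda>x. T (A x))) (a\<^sup>2 * C)" by (simp add: cadjoint_comp[OF T(1) A])
  from hs_bound_cadjoint[OF bounded_clinear_cadjoint[OF TA] this]
  show ?thesis by (simp add: cadjoint_cadjoint[OF TA])
qed

lemma hs_bound_add:
  assumes "hs_bound S C" "hs_bound T D" shows "hs_bound (\<lambda>x. S x + T x) (2 * C + 2 * D)"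
  unfolding hs_bound_def
proof (intro allI impI)
  fix F :: "'a set" assume F: "finite F" "orthonormal F"
  have "(norm (u + v))\<^sup>2 \<le> 2 * (norm u)\<^sup>2 + 2 * (norm v)\<^sup>2" for u v :: 'b
    using norm_add_sq[of u v] norm_diff_sq[of u v] zero_le_power2[of "norm (u - v)"] by linarith
  then have "(\<Sum>x\<in>F. (norm (S x + T x))\<^sup>2) \<le> (\<Sum>x\<in>F. 2 * (norm (S x))\<^sup>2 + 2 * (norm (T x))\<^sup>2)"
    by (intro sum_mono)
  also have "\<dots> \<le> 2 * C + 2 * D"
    unfolding sum.distrib sum_distrib_left[symmetric]
    by (intro add_mono mult_left_mono hs_boundD[OF _ F] assms) simp_all
  finally show "(\<Sum>x\<in>F. (norm (S x + T x))\<^sup>2) \<le> 2 * C + 2 * D" .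
qed

lemma hs_dominated:
  fixes S :: "'a::chilbert_space \<Rightarrow> 'b::chilbert_space" and T :: "'a \<Rightarrow> 'c::chilbert_space"
  assumes "hilbert_schmidt T" "bounded_clinear S" "\<And>x. norm (S x) \<le> a * norm (T x)"
  shows "hilbert_schmidt S"
proof -
  obtain C where "hs_bound T C" using hsE[OF assms(1)] by blast
  from hs_bound_dominated[OF this assms(3)] show ?thesis by (rule hsI[OF assms(2)])
qed

context
  fixes S T :: "'a::chilbert_space \<Rightarrow> 'b::chilbert_space"
  assumes T: "hilbert_schmidt T"
begin

lemma hs_cadjoint: "hilbert_schmidt (cadjoint T)"
  using T hs_bound_cadjoint bounded_clinear_cadjoint unfolding hilbert_schmidt_iff by blast

lemma hs_comp_left:
  fixes A :: "'b \<Rightarrow> 'c::chilbert_space"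
  assumes "bounded_clinear A" shows "hilbert_schmidt (\<lambda>x. A (T x))"
proof -
  obtain K where "\<forall>x. norm (A x) \<le> K * norm x" using bcl_bounded[OF assms] by blast
  moreover obtain C where "hs_bound T C" using T hsE by blast
  ultimately have "hs_bound (\<lambda>x. A (T x)) (K\<^sup>2 * C)" by (intro hs_bound_dominated) auto
  then show ?thesis by (rule hsI[OF bounded_clinear_comp[OF assms hs_bcl[OF T]]])
qed

lemma hs_comp_right:
  fixes A :: "'c::chilbert_space \<Rightarrow> 'a"
  assumes "bounded_clinear A" shows "hilbert_schmidt (\<lambda>x. T (A x))"
proof -
  obtain K where "K > 0" "\<forall>x. norm (A x) \<le> K * norm x" using bcl_bounded[OF assms] by blast
  moreover obtain C where "hs_bound T C" using T hsE by blast
  ultimately have "hs_bound (\<lambda>x. T (A x)) (K\<^sup>2 * C)"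
    by (intro hs_bound_comp_right hs_bcl[OF T] assms) auto
  then show ?thesis by (rule hsI[OF bounded_clinear_comp[OF hs_bcl[OF T] assms]])
qed

lemma hs_add: "hilbert_schmidt S \<Longrightarrow> hilbert_schmidt (\<lambda>x. S x + T x)"
  using T hs_bound_add bounded_clinear_add unfolding hilbert_schmidt_iff by blast

lemma hs_scaleC: "hilbert_schmidt (\<lambda>x. a *\<^sub>C T x)"
proof -
  obtain C where "hs_bound T C" using T hsE by blast
  then have "hs_bound (\<lambda>x. a *\<^sub>C T x) ((cmod a)\<^sup>2 * C)"
    by (rule hs_bound_dominated) (simp add: norm_scaleC)
  then show ?thesis by (rule hsI[OF bounded_clinear_scaleC[OF hs_bcl[OF T]]])
qed

lemma hs_minus: "hilbert_schmidt (\<lambda>x. - T x)"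
  using hs_scaleC[of "-1"] by simp

end

lemma hs_diff:
  fixes S T :: "'a::chilbert_space \<Rightarrow> 'b::chilbert_space"
  shows "hilbert_schmidt S \<Longrightarrow> hilbert_schmidt T \<Longrightarrow> hilbert_schmidt (\<lambda>x. S x - T x)"
  using hs_add[OF hs_minus[of T], of S] by simp

lemma hs_zero: "hilbert_schmidt (\<lambda>x :: 'a::chilbert_space. 0 :: 'b::chilbert_space)"
  by (rule hsI[of _ 0]) (simp_all add: bounded_clinear_zero hs_bound_def)

lemma hs_rank1: "hilbert_schmidt (\<lambda>x :: 'a::chilbert_space. cinner x g *\<^sub>C (h :: 'b::chilbert_space))"
proof (rule hsI)
  show "hs_bound (\<lambda>x. cinner x g *\<^sub>C h) ((norm g)\<^sup>2 * (norm h)\<^sup>2)"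
    unfolding hs_bound_def
  proof (intro allI impI)
    fix F :: "'a set" assume F: "finite F" "orthonormal F"
    have "(\<Sum>x\<in>F. (norm (cinner x g *\<^sub>C h))\<^sup>2) = (\<Sum>x\<in>F. (cmod (cinner g x))\<^sup>2) * (norm h)\<^sup>2"
      by (simp add: norm_scaleC power_mult_distrib sum_distrib_right cmod_cinner_commute[of g])
    also have "\<dots> \<le> (norm g)\<^sup>2 * (norm h)\<^sup>2" by (intro mult_right_mono bessel F) simp
    finally show "(\<Sum>x\<in>F. (norm (cinner x g *\<^sub>C h))\<^sup>2) \<le> (norm g)\<^sup>2 * (norm h)\<^sup>2" .
  qed
qed (rule bounded_clinear_rank1)

lemma hs_sum:
  fixes T :: "'i \<Rightarrow> 'a::chilbert_space \<Rightarrow> 'b::chilbert_space"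
  assumes "\<And>i. i \<in> A \<Longrightarrow> hilbert_schmidt (T i)" shows "hilbert_schmidt (\<lambda>x. \<Sum>i\<in>A. T i x)"
  using assms by (induction A rule: infinite_finite_induct) (simp_all add: hs_zero hs_add)

lemma hs_fproj: "hilbert_schmidt (fproj G :: 'a::chilbert_space \<Rightarrow> 'a)"
  unfolding fproj_def[abs_def] by (intro hs_sum hs_rank1)

text \<open>A Hilbert-Schmidt operator is small off a finite-dimensional subspace: if \<open>F\<close> nearly attains
  the supremum of the sums, a unit vector orthogonal to \<open>F\<close> can add only little.\<close>

lemma hs_tail:
  fixes T :: "'a::chilbert_space \<Rightarrow> 'b::chilbert_space"
  assumes T: "hilbert_schmidt T" and e: "e > 0"
  shows "\<exists>F. finite F \<and> orthonormal F \<and> (\<forall>x. norm (T (x - fproj F x)) \<le> e * norm x)"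
proof -
  obtain C where C: "hs_bound T C" using T hsE by blast
  define N where "N = (\<lambda>F. \<Sum>x\<in>F. (norm (T x))\<^sup>2) ` {F. finite F \<and> orthonormal F}"
  have bdd: "bdd_above N" unfolding N_def using hs_boundD[OF C] by (intro bdd_aboveI[of _ C]) auto
  have ne: "N \<noteq> {}" unfolding N_def by (auto intro!: exI[of _ "{}"])
  have "Sup N - e\<^sup>2 < Sup N" using e by simp
  then obtain F where F: "finite F" "orthonormal F" "Sup N - e\<^sup>2 < (\<Sum>x\<in>F. (norm (T x))\<^sup>2)"
    by (rule less_cSupE[OF _ ne]) (auto simp: N_def)
  have bT: "bounded_clinear T" by (rule hs_bcl[OF T])
  have unit: "norm (T u) \<le> e" if u: "norm u = 1" "\<And>f. f \<in> F \<Longrightarrow> cinner u f = 0" for u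
  proof -
    note o = orthonormal_insert[OF F(2) u]
    have "insert u F \<in> {F. finite F \<and> orthonormal F}" using o(1) F(1) by simp
    then have "(\<Sum>x\<in>insert u F. (norm (T x))\<^sup>2) \<in> N" unfolding N_def by (rule imageI)
    then have "(\<Sum>x\<in>insert u F. (norm (T x))\<^sup>2) \<le> Sup N" by (rule cSup_upper[OF _ bdd])
    then have "(norm (T u))\<^sup>2 \<le> e\<^sup>2" using o(2) F(1,3) by simp
    then show ?thesis by (rule power2_le_imp_le) (use e in simp)
  qed
  have "norm (T (x - fproj F x)) \<le> e * norm x" for x
  proof (cases "x - fproj F x = 0")
    case True
    then show ?thesis using e by (simp add: bcl_zero[OF bT])
  next
    case False
    define v where "v = x - fproj F x"
    have v: "norm v > 0" using False by (simp add: v_def)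
    define u where "u = complex_of_real (1 / norm v) *\<^sub>C v"
    have "norm (T u) \<le> e"
    proof (rule unit)
      show "norm u = 1" using v by (simp add: u_def norm_scaleC norm_divide)
      show "cinner u f = 0" if "f \<in> F" for f
        using fproj_orth[OF F(1,2) complex_vector.span_base[OF that], of x]
        by (simp add: u_def v_def cinner_scaleC_left)
    qed
    then have "norm (T v) \<le> e * norm v"
      using v by (simp add: u_def bcl_scaleC[OF bT] norm_scaleC norm_divide divide_le_eq)
    moreover have "norm v \<le> norm x"
      by (rule power2_le_imp_le) (simp_all add: fproj_pythagoras[OF F(1,2), of x] v_def sum_nonneg)
    ultimately have "norm (T v) \<le> e * norm x"
      using mult_left_mono[of "norm v" "norm x" e] e by linarith
    then show ?thesis by (simp add: v_def)
  qed
  then show ?thesis using F by blast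
qed

section \<open>Lower bounds modulo Hilbert-Schmidt operators\<close>

lemma bounded_inner_subsequence:
  assumes "finite F" and "\<And>n. norm (x n :: 'a::complex_inner) \<le> K"
  shows "\<exists>r. strict_mono (r :: nat \<Rightarrow> nat) \<and> (\<forall>f\<in>F. convergent (\<lambda>n. cinner (x (r n)) f))"
  using assms(1)
proof induction
  case empty
  show ?case by (intro exI[of _ "\<lambda>n. n"]) (simp add: strict_mono_def)
next
  case (insert f F)
  then obtain r where r: "strict_mono (r :: nat \<Rightarrow> nat)" "\<forall>f\<in>F. convergent (\<lambda>n. cinner (x (r n)) f)"
    by blast
  have "bounded (range (\<lambda>n. cinner (x (r n)) f))"
    unfolding bounded_iff
  proof (intro exI[of _ "K * norm f"] ballI)
    fix z assume "z \<in> range (\<lambda>n. cinner (x (r n)) f)"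
    then obtain n where "z = cinner (x (r n)) f" by blast
    then show "norm z \<le> K * norm f"
      using cauchy_schwarz[of "x (r n)" f] mult_right_mono[OF assms(2)[of "r n"], of "norm f"]
      by simp
  qed
  then obtain l s where s: "strict_mono (s :: nat \<Rightarrow> nat)"
    "((\<lambda>n. cinner (x (r n)) f) \<circ> s) \<longlonglongrightarrow> l"
    using bounded_imp_convergent_subsequence by blast
  have "convergent (\<lambda>n. cinner (x (r (s n))) g)" if "g \<in> insert f F" for g
  proof (cases "g = f")
    case True
    then show ?thesis using s(2) by (auto simp: convergent_def comp_def)
  next
    case False
    then have "convergent (\<lambda>n. cinner (x (r n)) g)" using r that by blast
    from convergent_subseq_convergent[OF this s(1)] show ?thesis by (simp add: comp_def)
  qed
  moreover have "strict_mono (\<lambda>n. r (s n))" using r(1) s(1) by (simp add: strict_mono_def)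
  ultimately show ?case by (intro exI[of _ "\<lambda>n. r (s n)"]) blast
qed

text \<open>An operator that is bounded below up to a Hilbert-Schmidt error is semi-Fredholm on \<open>M\<close>.
  The hypothesis gives \<open>\<parallel>S g\<parallel> \<ge> d\<close> for unit vectors of the kernel, which bounds the number of
  orthonormal ones. Off the kernel, a sequence of unit vectors with images tending to \<open>0\<close> would
  have a subsequence that converges on the finite-dimensional part where \<open>S\<close> is not small, and
  hence converges to a unit vector in the kernel.\<close>

context
  fixes R :: "'a::chilbert_space \<Rightarrow> 'b::chilbert_space" and S :: "'a \<Rightarrow> 'c::chilbert_space"
    and M :: "'a set" and d :: real
  assumes R: "bounded_clinear R" and S: "hilbert_schmidt S" and M: "closed_csubspace M"
    and d: "d > 0" and below: "\<And>x. x \<in> M \<Longrightarrow> d * norm x - norm (S x) \<le> norm (R x)"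
begin

lemma semi_fredholm_kernel:
  "\<exists>G. finite G \<and> orthonormal G \<and> cspan G = M \<inter> {x. R x = 0}"
proof -
  obtain C where C: "hs_bound S C" "C \<ge> 0" using S hsE by blast
  have sub: "csubspace (M \<inter> {x. R x = 0})"
    using closed_csubspace_Int[OF M closed_csubspace_kernel[OF R]] by (simp add: closed_csubspace_def)
  have "card G \<le> nat \<lfloor>C / d\<^sup>2\<rfloor>" if G: "finite G" "orthonormal G" "G \<subseteq> M \<inter> {x. R x = 0}" for G
  proof -
    have "d \<le> norm (S g)" if "g \<in> G" for g
      using below[of g] orthonormalD(1)[OF G(2) that] subsetD[OF G(3) that] by simp
    then have "real (card G) * d\<^sup>2 \<le> (\<Sum>g\<in>G. (norm (S g))\<^sup>2)"
      using d sum_mono[of G "\<lambda>_. d\<^sup>2" "\<lambda>g. (norm (S g))\<^sup>2"] by (simp add: power_mono)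
    also have "\<dots> \<le> C" by (rule hs_boundD[OF C(1) G(1,2)])
    finally have "real (card G) \<le> C / d\<^sup>2" using d by (simp add: pos_le_divide_eq)
    then show ?thesis by (simp add: le_nat_floor)
  qed
  then show ?thesis by (rule orthonormal_spanning[OF sub])
qed

lemma semi_fredholm_bounded_below:
  "\<exists>c>0. \<forall>x\<in>M \<inter> ortho_compl (M \<inter> {x. R x = 0}). c * norm x \<le> norm (R x)"
proof (rule ccontr)
  define L where "L = M \<inter> ortho_compl (M \<inter> {x. R x = 0})"
  have L: "closed_csubspace L"
    unfolding L_def by (rule closed_csubspace_Int[OF M closed_csubspace_ortho_compl])
  assume "\<not> ?thesis"
  then have no: "\<exists>x\<in>L. norm (R x) < c * norm x" if "c > 0" for c
    using that unfolding L_def by (meson not_le)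
  obtain F where F: "finite F" "orthonormal F" "\<And>x. norm (S (x - fproj F x)) \<le> (d/2) * norm x"
    using hs_tail[OF S, of "d/2"] d by auto
  obtain K where K: "K > 0" "\<And>x. norm (S x) \<le> K * norm x"
    using bcl_bounded[OF hs_bcl[OF S]] by blast
  \<comment> \<open>Off the span of \<open>F\<close> the error \<open>S\<close> costs only half of the lower bound.\<close>
  have est: "(d/2) * norm x \<le> norm (R x) + K * norm (fproj F x)" if "x \<in> M" for x
  proof -
    have "norm (S x) \<le> norm (S (x - fproj F x)) + norm (S (fproj F x))"
      using norm_triangle_ineq[of "S (x - fproj F x)" "S (fproj F x)"]
      by (simp flip: bcl_add[OF hs_bcl[OF S]])
    then show ?thesis using F(3)[of x] K(2)[of "fproj F x"] below[OF that] by argo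
  qed
  have "\<exists>x\<in>L. norm x = 1 \<and> norm (R x) < inverse (real (Suc n))" for n
  proof -
    obtain x where x: "x \<in> L" "norm (R x) < inverse (real (Suc n)) * norm x"
      using no[of "inverse (real (Suc n))"] by auto
    then have nz: "norm x \<noteq> 0" using norm_ge_zero[of "R x"] by (cases "norm x = 0") auto
    show ?thesis
    proof (intro bexI conjI)
      show "complex_of_real (1 / norm x) *\<^sub>C x \<in> L" by (rule closed_csubspaceD(5)[OF L x(1)])
      show "norm (complex_of_real (1 / norm x) *\<^sub>C x) = 1"
        using nz by (simp add: norm_scaleC norm_divide)
      have "norm (R (complex_of_real (1 / norm x) *\<^sub>C x)) = norm (R x) / norm x"
        by (simp add: bcl_scaleC[OF R] norm_scaleC norm_divide)
      also have "\<dots> < inverse (real (Suc n))" using x(2) nz by (simp add: pos_divide_less_eq)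
      finally show "norm (R (complex_of_real (1 / norm x) *\<^sub>C x)) < inverse (real (Suc n))" .
    qed
  qed
  then obtain y where y: "\<And>n. y n \<in> L" "\<And>n. norm (y n) = 1"
    "\<And>n. norm (R (y n)) < inverse (real (Suc n))" by metis
  obtain r where r: "strict_mono (r :: nat \<Rightarrow> nat)" "\<And>f. f \<in> F \<Longrightarrow> convergent (\<lambda>n. cinner (y (r n)) f)"
    using bounded_inner_subsequence[OF F(1), of y 1] y(2) by auto
  define z where "z n = y (r n)" for n
  have z: "z n \<in> L" "norm (z n) = 1" for n using y by (simp_all add: z_def)
  have Rz: "(\<lambda>n. R (z n)) \<longlonglongrightarrow> 0"
  proof (rule tendsto_norm_zero_cancel, rule tendsto_sandwich[OF _ _ tendsto_const])
    show "\<forall>\<^sub>F n in sequentially. norm (R (z n)) \<le> inverse (real (Suc n))"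
    proof (rule always_eventually, rule allI)
      fix n
      have "inverse (real (Suc (r n))) \<le> inverse (real (Suc n))"
        using seq_suble[OF r(1), of n] by (intro le_imp_inverse_le) simp_all
      from less_le_trans[OF y(3)[of "r n"] this] show "norm (R (z n)) \<le> inverse (real (Suc n))"
        unfolding z_def by (rule less_imp_le)
    qed
    show "(\<lambda>n. inverse (real (Suc n))) \<longlonglongrightarrow> 0" by (rule LIMSEQ_inverse_real_of_nat)
  qed simp
  have "\<exists>l. (\<lambda>n. cinner (z n) f) \<longlonglongrightarrow> l" if "f \<in> F" for f
    using r(2)[OF that] by (simp add: z_def convergent_def)
  then obtain l where l: "\<And>f. f \<in> F \<Longrightarrow> (\<lambda>n. cinner (z n) f) \<longlonglongrightarrow> l f" by metis
  have Fz: "(\<lambda>n. fproj F (z n)) \<longlonglongrightarrow> (\<Sum>f\<in>F. l f *\<^sub>C f)"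
    unfolding fproj_def
  proof (rule tendsto_sum)
    fix f assume f: "f \<in> F"
    have "(\<lambda>n. (cinner (z n) f - l f) *\<^sub>C f) \<longlonglongrightarrow> 0"
    proof (rule tendsto_norm_zero_cancel)
      have "(\<lambda>n. norm (cinner (z n) f - l f) * norm f) \<longlonglongrightarrow> norm (l f - l f) * norm f"
        by (intro tendsto_intros l f)
      then show "(\<lambda>n. norm ((cinner (z n) f - l f) *\<^sub>C f)) \<longlonglongrightarrow> 0" by (simp add: norm_scaleC)
    qed
    from tendsto_add[OF this tendsto_const[of "l f *\<^sub>C f"]]
    show "(\<lambda>n. cinner (z n) f *\<^sub>C f) \<longlonglongrightarrow> l f *\<^sub>C f"
      by (simp flip: scaleC_add_left)
  qed
  have "Cauchy z"
  proof (rule CauchyI)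
    fix e :: real assume e: "e > 0"
    define e1 where "e1 = d * e / 8"
    define e2 where "e2 = d * e / (8 * K)"
    have pos: "e1 > 0" "e2 > 0" using e d K(1) by (simp_all add: e1_def e2_def)
    obtain N1 where N1: "\<And>n. n \<ge> N1 \<Longrightarrow> norm (R (z n)) < e1"
      using LIMSEQ_D[OF Rz pos(1)] by auto
    obtain N2 where N2: "\<And>m n. m \<ge> N2 \<Longrightarrow> n \<ge> N2 \<Longrightarrow> norm (fproj F (z m) - fproj F (z n)) < e2"
      using CauchyD[OF LIMSEQ_imp_Cauchy[OF Fz] pos(2)] by blast
    have "norm (z m - z n) < e" if mn: "m \<ge> max N1 N2" "n \<ge> max N1 N2" for m n
    proof -
      have "z m - z n \<in> M" using z(1) closed_csubspaceD(4)[OF L] by (auto simp: L_def)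
      from est[OF this] have "(d/2) * norm (z m - z n)
          \<le> norm (R (z m) - R (z n)) + K * norm (fproj F (z m) - fproj F (z n))"
        by (simp add: bcl_diff[OF R] bcl_diff[OF bounded_clinear_fproj])
      also have "norm (R (z m) - R (z n)) \<le> norm (R (z m)) + norm (R (z n))"
        by (rule norm_triangle_ineq4)
      also have "\<dots> \<le> e1 + e1" using N1[of m] N1[of n] mn by simp
      also have "K * norm (fproj F (z m) - fproj F (z n)) \<le> K * e2"
        using N2[of m n] mn K(1) by (intro mult_left_mono) auto
      also have "e1 + e1 + K * e2 = (d/2) * (3/4 * e)" using K(1) by (simp add: e1_def e2_def)
      finally have "norm (z m - z n) \<le> 3/4 * e" using d by simp
      then show ?thesis using e by simp
    qed
    then show "\<exists>N. \<forall>m\<ge>N. \<forall>n\<ge>N. norm (z m - z n) < e" by blast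
  qed
  then obtain w where w: "z \<longlonglongrightarrow> w" using Cauchy_convergent_iff convergent_def by blast
  have wL: "w \<in> L" using closed_sequentially[OF closed_csubspaceD(1)[OF L] _ w] z(1) by blast
  have "R w = 0" using LIMSEQ_unique[OF bcl_tendsto[OF R w] Rz] .
  then have "cinner w w = 0" using wL by (auto simp: L_def ortho_compl_def)
  moreover have "norm w = 1" using LIMSEQ_unique[OF tendsto_norm[OF w]] z(2) by simp
  ultimately show False by (simp add: cinner_self)
qed

lemma semi_fredholm_closed_image: "closed_csubspace (R ` M)"
proof -
  define N where "N = M \<inter> {x. R x = 0}"
  have N: "closed_csubspace N"
    unfolding N_def by (rule closed_csubspace_Int[OF M closed_csubspace_kernel[OF R]])
  have L: "closed_csubspace (M \<inter> ortho_compl N)"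
    by (rule closed_csubspace_Int[OF M closed_csubspace_ortho_compl])
  have "R ` M \<subseteq> R ` (M \<inter> ortho_compl N)"
  proof
    fix y assume "y \<in> R ` M"
    then obtain x where x: "x \<in> M" "y = R x" by blast
    have p: "proj N x \<in> M" "R (proj N x) = 0" using proj_in[OF N, of x] by (auto simp: N_def)
    have "x - proj N x \<in> M \<inter> ortho_compl N"
      using x(1) p(1) closed_csubspaceD(4)[OF M] proj_orth[OF N] by (simp add: ortho_compl_def)
    moreover have "y = R (x - proj N x)" using x(2) p(2) by (simp add: bcl_diff[OF R])
    ultimately show "y \<in> R ` (M \<inter> ortho_compl N)" by blast
  qed
  then have "R ` M = R ` (M \<inter> ortho_compl N)" by blast
  moreover obtain c where "c > 0" "\<forall>x\<in>M \<inter> ortho_compl N. c * norm x \<le> norm (R x)"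
    using semi_fredholm_bounded_below unfolding N_def by blast
  ultimately show ?thesis using closed_image_bounded_below[OF R L] by metis
qed

end

text \<open>The half of the Fredholm alternative that turns injectivity into a lower bound.\<close>

lemma injective_bounded_below:
  fixes R :: "'a::chilbert_space \<Rightarrow> 'b::chilbert_space" and S :: "'a \<Rightarrow> 'c::chilbert_space"
  assumes R: "bounded_clinear R" and S: "hilbert_schmidt S"
    and d: "d > 0" and below: "\<And>x. d * norm x - norm (S x) \<le> norm (R x)"
    and inj: "\<And>x. R x = 0 \<Longrightarrow> x = 0"
  shows "\<exists>c>0. \<forall>x. c * norm x \<le> norm (R x)"
proof -
  have "{x. R x = 0} = {0}" using inj bcl_zero[OF R] by auto
  then show ?thesis
    using semi_fredholm_bounded_below[OF R S closed_csubspace_UNIV d] below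
    by (simp add: ortho_compl_def)
qed

section \<open>Square roots\<close>

instance chilbert_space \<subseteq> banach ..

text \<open>\<open>B = 1 - (1 - D)\<^bsup>1/2\<^esup>\<close> is the fixed point of \<open>B \<mapsto> (D + B\<^sup>2)/2\<close>. With
  \<open>r = 1 - (1 - q)\<^bsup>1/2\<^esup>\<close> this map sends the ball of radius \<open>r\<close> into itself and contracts
  it by the factor \<open>r\<close>. Self-adjointness and commutation pass to the fixed point because the
  contraction acts on the closed set of operators with these properties.\<close>

lemma sqrt_one_minus:
  fixes D P :: "'a::chilbert_space \<Rightarrow> 'a"
  assumes D: "bounded_clinear D" and Dadj: "\<And>x y. cinner (D x) y = cinner x (D y)"
    and q: "0 \<le> q" "q < 1" "\<And>x. norm (D x) \<le> q * norm x"
    and P: "bounded_clinear P" and DP: "\<And>x. D (P x) = P (D x)"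
  obtains B r where "bounded_clinear B" "\<And>x y. cinner (B x) y = cinner x (B y)"
    "\<And>x. B (P x) = P (B x)" "\<And>x. 2 *\<^sub>R B x = D x + B (B x)"
    "0 \<le> r" "r < 1" "\<And>x. norm (B x) \<le> r * norm x"
proof -
  define r where "r = 1 - sqrt (1 - q)"
  have r: "0 \<le> r" "r < 1" using q by (simp_all add: r_def)
  \<comment> \<open>This makes the ball of radius \<open>r\<close> invariant.\<close>
  have rq: "(q + r * r) / 2 = r"
  proof -
    define s where "s = sqrt (1 - q)"
    have "s * s = 1 - q" using q by (simp add: s_def)
    then show ?thesis unfolding r_def s_def[symmetric] by (simp add: field_simps)
  qed
  define D' where "D' = Blinfun D"
  have D': "blinfun_apply D' x = D x" for x
    unfolding D'_def by (simp add: bounded_linear_Blinfun_apply bcl_bounded_linear[OF D])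
  have nD: "norm D' \<le> q" by (rule norm_blinfun_bound) (use q D' in auto)
  define X :: "('a \<Rightarrow>\<^sub>L 'a) set" where "X = {B. norm B \<le> r} \<inter>
    {B. \<forall>c x. blinfun_apply B (c *\<^sub>C x) = c *\<^sub>C blinfun_apply B x} \<inter>
    {B. \<forall>x y. cinner (blinfun_apply B x) y = cinner x (blinfun_apply B y)} \<inter>
    {B. \<forall>x. blinfun_apply B (P x) = P (blinfun_apply B x)}"
  define f where "f B = (1/2) *\<^sub>R (D' + (B o\<^sub>L B))" for B
  have fB: "blinfun_apply (f B) x = (1/2) *\<^sub>R (D x + blinfun_apply B (blinfun_apply B x))" for B x
    by (simp add: f_def blinfun.scaleR_left blinfun.add_left D')
  have "complete X"
    unfolding complete_eq_closed X_def
  proof (intro closed_Int closed_Collect_all closed_Collect_eq closed_Collect_le continuous_intros)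
    fix c x
    show "continuous_on UNIV (\<lambda>B. c *\<^sub>C blinfun_apply B x)"
      by (rule bounded_linear.continuous_on[OF bounded_linear_scaleC]) (intro continuous_intros)
  next
    fix x
    show "continuous_on UNIV (\<lambda>B. P (blinfun_apply B x))"
      by (rule bounded_linear.continuous_on[OF bcl_bounded_linear[OF P]]) (intro continuous_intros)
  qed
  moreover have "X \<noteq> {}"
  proof -
    have "0 \<in> X" using r by (simp add: X_def bcl_zero[OF P])
    then show ?thesis by blast
  qed
  moreover have "f ` X \<subseteq> X"
  proof
    fix A assume "A \<in> f ` X"
    then obtain B where A: "A = f B" and B: "B \<in> X" by blast
    have "norm (D' + (B o\<^sub>L B)) \<le> norm D' + norm (B o\<^sub>L B)" by (rule norm_triangle_ineq)
    also have "norm (B o\<^sub>L B) \<le> norm B * norm B" by (rule norm_blinfun_compose)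
    also have "\<dots> \<le> r * r" using B r by (intro mult_mono) (auto simp: X_def)
    finally have "norm (D' + (B o\<^sub>L B)) \<le> q + r * r" using nD by simp
    then have "norm A \<le> (q + r * r) / 2" by (simp add: A f_def)
    then have 1: "norm A \<le> r" using rq by simp
    have s: "(1/2) *\<^sub>R x = complex_of_real (1/2) *\<^sub>C x" for x :: 'a by (rule scaleC_of_real[symmetric])
    have B': "blinfun_apply B (c *\<^sub>C x) = c *\<^sub>C blinfun_apply B x"
      "cinner (blinfun_apply B x) y = cinner x (blinfun_apply B y)"
      "blinfun_apply B (P x) = P (blinfun_apply B x)" for c x y using B by (auto simp: X_def)
    have 2: "blinfun_apply A (c *\<^sub>C x) = c *\<^sub>C blinfun_apply A x" for c x
      by (simp only: A fB s B' bcl_scaleC[OF D]) (simp add: scaleC_add_right scaleC_scaleC mult.commute)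
    have 3: "cinner (blinfun_apply A x) y = cinner x (blinfun_apply A y)" for x y
      by (simp only: A fB s cinner_simps B' Dadj) simp
    have 4: "blinfun_apply A (P x) = P (blinfun_apply A x)" for x
      by (simp only: A fB s B' DP bcl_scaleC[OF P] bcl_add[OF P])
    show "A \<in> X" unfolding X_def using 1 2 3 4 by blast
  qed
  moreover have "dist (f A) (f B) \<le> r * dist A B" if "A \<in> X" "B \<in> X" for A B
  proof -
    have "f A - f B = (1/2) *\<^sub>R ((A o\<^sub>L (A - B)) + ((A - B) o\<^sub>L B))"
      by (rule blinfun_eqI)
         (simp add: fB blinfun.diff_left blinfun.diff_right blinfun.scaleR_left blinfun.add_left
           scaleR_right_diff_distrib[symmetric])
    then have "dist (f A) (f B) = (1/2) * norm ((A o\<^sub>L (A - B)) + ((A - B) o\<^sub>L B))"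
      by (simp add: dist_norm)
    also have "norm ((A o\<^sub>L (A - B)) + ((A - B) o\<^sub>L B)) \<le> norm (A o\<^sub>L (A - B)) + norm ((A - B) o\<^sub>L B)"
      by (rule norm_triangle_ineq)
    also have "\<dots> \<le> norm A * norm (A - B) + norm (A - B) * norm B"
      by (intro add_mono norm_blinfun_compose)
    also have "\<dots> \<le> r * norm (A - B) + norm (A - B) * r"
      using that by (intro add_mono mult_left_mono mult_right_mono) (auto simp: X_def)
    finally show ?thesis by (simp add: dist_norm mult.commute)
  qed
  ultimately obtain B where B: "B \<in> X" "f B = B"
    using Banach_fix[of X r f] r by metis
  show ?thesis
  proof (rule that[of "blinfun_apply B" r])
    show "bounded_clinear (blinfun_apply B)"
      unfolding bounded_clinear_def using B(1) by (auto simp: X_def blinfun.bounded_linear_right)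
    show "norm (blinfun_apply B x) \<le> r * norm x" for x
      using norm_blinfun[of B x] B(1) mult_right_mono[of "norm B" r "norm x"] by (simp add: X_def)
    have "blinfun_apply B x = (1/2) *\<^sub>R (D x + blinfun_apply B (blinfun_apply B x))" for x
      using fB[of B x] B(2) by simp
    then have "2 *\<^sub>R blinfun_apply B x = 2 *\<^sub>R (1/2) *\<^sub>R (D x + blinfun_apply B (blinfun_apply B x))" for x
      by (rule arg_cong)
    then show "2 *\<^sub>R blinfun_apply B x = D x + blinfun_apply B (blinfun_apply B x)" for x by simp
  qed (use B(1) r in \<open>auto simp: X_def\<close>)
qed

section \<open>Unitary perturbations of the identity and partial isometries\<close>

text \<open>Over the complex numbers the quadratic form determines the operator: comparing \<open>x + y\<close> with
  \<open>\<i> x + y\<close> isolates \<open>\<langle>A x, y\<rangle>\<close>.\<close>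

lemma polarization_zero:
  assumes A: "bounded_clinear A" and z: "\<And>x. cinner (A x) x = 0"
  shows "A x = (0 :: 'a::complex_inner)"
proof -
  have 1: "cinner (A x) y + cinner (A y) x = 0" for x y
    using z[of "x + y"] by (simp add: bcl_add[OF A] cinner_simps z add.commute)
  have 2: "cinner (A x) y - cinner (A y) x = 0" for x y
    using 1[of "\<i> *\<^sub>C x" y] by (simp add: bcl_scaleC[OF A] cinner_simps)
  have "cinner (A x) y = 0" for y
    using 1[of x y] 2[of x y] by simp
  from this[of "A x"] show ?thesis by simp
qed

lemma isometry_cinner:
  fixes T :: "'a::chilbert_space \<Rightarrow> 'b::chilbert_space"
  assumes T: "bounded_clinear T" and n: "\<And>x. norm (T x) = norm x"
  shows "cinner (T x) (T y) = cinner x y"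
proof -
  have b: "bounded_clinear (\<lambda>x. cadjoint T (T x) - x)"
    by (intro bounded_clinear_intros bounded_clinear_comp[OF bounded_clinear_cadjoint[OF T]] T)
  have "cadjoint T (T x) - x = 0" for x
    by (rule polarization_zero[OF b])
       (simp add: cinner_diff_left cadjoint'[OF T] cinner_self n)
  then have "cinner (cadjoint T (T x)) y = cinner x y" by simp
  then show ?thesis by (simp add: cadjoint'[OF T])
qed

lemma unitary_opI:
  assumes L: "bounded_clinear L" and "\<And>x y. cinner (L x) y = cinner x (M y)"
    and "\<And>x. L (M x) = x" "\<And>x. M (L x) = x"
  shows "unitary_op L" "cadjoint L = M"
proof -
  show "cadjoint L = M" by (rule cadjoint_eqI) (rule assms(2))
  then show "unitary_op L" using assms by (simp add: unitary_op_def fun_eq_iff)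
qed

lemma unitary_op_isometry_surj:
  fixes L :: "'a::chilbert_space \<Rightarrow> 'a"
  assumes L: "bounded_clinear L" and n: "\<And>x. norm (L x) = norm x" and s: "surj L"
  shows "unitary_op L"
proof -
  have 1: "cadjoint L (L x) = x" for x
    by (rule cinner_eqI) (simp add: cadjoint'[OF L] isometry_cinner[OF L n])
  then have "L (cadjoint L y) = y" for y using s by (metis surjD)
  then show ?thesis using L 1 by (simp add: unitary_op_def fun_eq_iff)
qed

definition u2_op :: "('a::chilbert_space \<Rightarrow> 'a) \<Rightarrow> bool" where
  "u2_op L \<longleftrightarrow> unitary_op L \<and> hilbert_schmidt (\<lambda>x. L x - x)"

lemma
  assumes "unitary_op L"
  shows unitary_bcl: "bounded_clinear L" and unitary_adj_left: "cadjoint L (L x) = x"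
    and unitary_adj_right: "L (cadjoint L x) = x" and unitary_norm: "norm (L x) = norm x"
    and unitary_cinner: "cinner (L x) (L y) = cinner x y"
proof -
  show L: "bounded_clinear L" and 1: "cadjoint L (L x) = x" and "L (cadjoint L x) = x" for x
    using assms by (simp_all add: unitary_op_def fun_eq_iff)
  show 2: "cinner (L x) (L y) = cinner x y" for x y using cadjoint[OF L, of x "L y"] 1 by simp
  show "norm (L x) = norm x"
    by (rule power2_eq_imp_eq) (simp_all add: norm_sq_cinner 2)
qed

lemma u2_unitary: "u2_op L \<Longrightarrow> unitary_op L" by (simp add: u2_op_def)

lemmas u2_bcl = unitary_bcl[OF u2_unitary]
  and u2_adj_left = unitary_adj_left[OF u2_unitary]
  and u2_adj_right = unitary_adj_right[OF u2_unitary]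
  and u2_norm = unitary_norm[OF u2_unitary]
  and u2_cinner = unitary_cinner[OF u2_unitary]

lemma u2_hs: "u2_op L \<Longrightarrow> hilbert_schmidt (\<lambda>x. L x - x)" by (simp add: u2_op_def)

lemma u2_id: "u2_op (\<lambda>x. x)"
proof -
  have "unitary_op (\<lambda>x :: 'a. x)" by (rule unitary_opI) (simp_all add: bounded_clinear_id)
  then show ?thesis by (simp add: u2_op_def hs_zero)
qed

lemma u2_cadjoint: assumes "u2_op L" shows "u2_op (cadjoint L)"
proof -
  note L = u2_bcl[OF assms]
  have "unitary_op (cadjoint L)"
    by (rule unitary_opI[of _ L])
       (simp_all add: bounded_clinear_cadjoint[OF L] cadjoint'[OF L] u2_adj_left[OF assms] u2_adj_right[OF assms])
  moreover have "cadjoint (\<lambda>x. L x - x) = (\<lambda>x. cadjoint L x - x)"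
    by (simp add: cadjoint_diff[OF L bounded_clinear_id] cadjoint_id)
  ultimately show ?thesis using hs_cadjoint[OF u2_hs[OF assms]] by (simp add: u2_op_def)
qed

lemma u2_comp:
  assumes K: "u2_op K" and L: "u2_op L" shows "u2_op (\<lambda>x. K (L x))"
proof -
  note b = u2_bcl[OF K] u2_bcl[OF L]
  have "unitary_op (\<lambda>x. K (L x))"
    by (rule unitary_opI[of _ "\<lambda>x. cadjoint L (cadjoint K x)"])
       (simp_all add: bounded_clinear_comp[OF b] cadjoint[OF b(1)] cadjoint[OF b(2)]
         u2_adj_left[OF K] u2_adj_left[OF L] u2_adj_right[OF K] u2_adj_right[OF L])
  moreover have "hilbert_schmidt (\<lambda>x. (K (L x) - L x) + (L x - x))"
    by (rule hs_add[OF u2_hs[OF L] hs_comp_right[OF u2_hs[OF K] b(2)]])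
  ultimately show ?thesis by (simp add: u2_op_def)
qed

definition is_proj :: "('a::chilbert_space \<Rightarrow> 'a) \<Rightarrow> bool" where
  "is_proj P \<longleftrightarrow> bounded_clinear P \<and> (\<forall>x. P (P x) = P x) \<and> (\<forall>x y. cinner (P x) y = cinner x (P y))"

lemma is_projD:
  assumes "is_proj P"
  shows "bounded_clinear P" "P (P x) = P x" "cinner (P x) y = cinner x (P y)"
  using assms by (simp_all add: is_proj_def)

lemma is_proj_norm_sq: "is_proj P \<Longrightarrow> cinner (P x) x = complex_of_real ((norm (P x))\<^sup>2)"
  using is_projD(2)[of P x] is_projD(3)[of P "P x" x] by (simp add: cinner_self[symmetric] del: of_real_power)

lemma is_proj_norm_le: assumes "is_proj P" shows "norm (P x) \<le> norm x"
proof -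
  have "(norm (P x))\<^sup>2 \<le> norm (P x) * norm x"
    using Re_cauchy_schwarz[of "P x" x] is_proj_norm_sq[OF assms, of x] by simp
  then show ?thesis by (cases "norm (P x) = 0") (auto simp: power2_eq_square)
qed

lemma is_proj_fproj: "finite G \<Longrightarrow> orthonormal G \<Longrightarrow> is_proj (fproj G :: 'a::chilbert_space \<Rightarrow> 'a)"
  unfolding is_proj_def
  by (simp add: bounded_clinear_fproj fproj_eq_self fproj_in_cspan)
     (simp add: fproj_eq_proj proj_selfadj[OF closed_csubspace_cspan])

lemma unitary_reflection:
  assumes P: "is_proj P" shows "unitary_op (\<lambda>x. x - P x - P x)"
proof (rule unitary_opI)
  note b = is_projD(1)[OF P]
  show "bounded_clinear (\<lambda>x. x - P x - P x)" by (intro bounded_clinear_intros b)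
  show "cinner (x - P x - P x) y = cinner x (y - P y - P y)" for x y
    by (simp add: cinner_simps is_projD(3)[OF P])
qed (simp_all add: bcl_simps[OF is_projD(1)[OF P]] is_projD(2)[OF P])

lemma u2_reflection:
  fixes G :: "'a::chilbert_space set"
  assumes "finite G" "orthonormal G" shows "u2_op (\<lambda>x. x - fproj G x - fproj G x)"
proof -
  have "hilbert_schmidt (\<lambda>x. - fproj G x - fproj G x)" by (intro hs_diff hs_minus hs_fproj)
  then show ?thesis using unitary_reflection[OF is_proj_fproj[OF assms]] by (simp add: u2_op_def)
qed

text \<open>The algebraic form of a partial isometry, which is symmetric in the operator and its adjoint.\<close>

definition pisom :: "('a::chilbert_space \<Rightarrow> 'b::chilbert_space) \<Rightarrow> bool" where
  "pisom X \<longleftrightarrow> bounded_clinear X \<and> (\<forall>x. X (cadjoint X (X x)) = X x)"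

lemma
  fixes X :: "'a::chilbert_space \<Rightarrow> 'b::chilbert_space"
  assumes "pisom X"
  shows pisom_bcl: "bounded_clinear X" and pisom_eq: "X (cadjoint X (X x)) = X x"
    and pisom_bcl_adj: "bounded_clinear (cadjoint X)"
    and pisom_adj_eq: "cadjoint X (X (cadjoint X y)) = cadjoint X y"
    and pisom_initial: "is_proj (\<lambda>x. cadjoint X (X x))"
    and pisom_final: "is_proj (\<lambda>y. X (cadjoint X y))"
    and pisom_norm: "norm (X x) = norm (cadjoint X (X x))"
    and pisom_norm_le: "norm (X x) \<le> norm x"
    and pisom_adj_norm_le: "norm (cadjoint X y) \<le> norm y"
proof -
  show b: "bounded_clinear X" and e: "X (cadjoint X (X x)) = X x" for x
    using assms by (simp_all add: pisom_def)
  show b': "bounded_clinear (cadjoint X)" by (rule bounded_clinear_cadjoint[OF b])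
  show e': "cadjoint X (X (cadjoint X y)) = cadjoint X y" for y
  proof (rule cinner_eqI)
    fix z
    have "cinner (cadjoint X (X (cadjoint X y))) z = cinner (cadjoint X y) (cadjoint X (X z))"
      by (simp only: cadjoint'[OF b, of "X (cadjoint X y)"] cadjoint[OF b])
    also have "\<dots> = cinner (cadjoint X y) z" by (simp only: cadjoint'[OF b] e)
    finally show "cinner (cadjoint X (X (cadjoint X y))) z = cinner (cadjoint X y) z" .
  qed
  show i: "is_proj (\<lambda>x. cadjoint X (X x))"
    unfolding is_proj_def by (simp add: bounded_clinear_comp[OF b' b] e cadjoint'[OF b] cadjoint[OF b])
  show f: "is_proj (\<lambda>y. X (cadjoint X y))"
    unfolding is_proj_def by (simp add: bounded_clinear_comp[OF b b'] e' cadjoint'[OF b] cadjoint[OF b])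
  show n: "norm (X x) = norm (cadjoint X (X x))" for x
    by (rule power2_eq_imp_eq) (simp_all add: norm_sq_cinner cadjoint'[OF b] e)
  show "norm (X x) \<le> norm x" using is_proj_norm_le[OF i, of x] n by simp
  have "norm (cadjoint X y) = norm (X (cadjoint X y))" using n[of "cadjoint X y"] e' by simp
  then show "norm (cadjoint X y) \<le> norm y" using is_proj_norm_le[OF f, of y] by simp
qed

lemma pisom_cadjoint: "pisom X \<Longrightarrow> pisom (cadjoint X)"
  by (simp add: pisom_def pisom_bcl_adj cadjoint_cadjoint[OF pisom_bcl] pisom_adj_eq)

text \<open>The second unitary is not starred since the group of these unitaries is closed under
  adjoints.\<close>

definition orbit_equiv :: "('a::chilbert_space \<Rightarrow> 'b::chilbert_space) \<Rightarrow> ('a \<Rightarrow> 'b) \<Rightarrow> bool" where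
  "orbit_equiv X Y \<longleftrightarrow> (\<exists>V W. u2_op V \<and> u2_op W \<and> Y = (\<lambda>x. V (X (W x))))"

lemma orbit_equivI: "u2_op V \<Longrightarrow> u2_op W \<Longrightarrow> orbit_equiv X (\<lambda>x. V (X (W x)))"
  unfolding orbit_equiv_def by (intro exI[of _ V] exI[of _ W]) simp

lemma orbit_equivE:
  assumes "orbit_equiv X Y"
  obtains V W where "u2_op V" "u2_op W" "Y = (\<lambda>x. V (X (W x)))"
  using assms unfolding orbit_equiv_def by (elim exE conjE)

lemma orbit_equiv_refl: "orbit_equiv X X"
  using orbit_equivI[OF u2_id u2_id, of X] by simp

lemma orbit_equiv_sym: assumes "orbit_equiv X Y" shows "orbit_equiv Y X"
proof -
  obtain V W where VW: "u2_op V" "u2_op W" "Y = (\<lambda>x. V (X (W x)))"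
    using assms orbit_equivE by metis
  have "X = (\<lambda>x. cadjoint V (Y (cadjoint W x)))"
    by (simp add: VW(3) u2_adj_left[OF VW(1)] u2_adj_right[OF VW(2)])
  then show ?thesis using orbit_equivI[OF u2_cadjoint[OF VW(1)] u2_cadjoint[OF VW(2)], of Y] by simp
qed

lemma orbit_equiv_trans:
  assumes "orbit_equiv X Y" "orbit_equiv Y Z" shows "orbit_equiv X Z"
proof -
  obtain V W where 1: "u2_op V" "u2_op W" "Y = (\<lambda>x. V (X (W x)))"
    using assms orbit_equivE by metis
  obtain V' W' where 2: "u2_op V'" "u2_op W'" "Z = (\<lambda>x. V' (Y (W' x)))"
    using assms orbit_equivE by metis
  have "Z = (\<lambda>x. V' (V (X (W (W' x)))))" by (simp add: 1 2)
  then show ?thesis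
    using orbit_equivI[OF u2_comp[OF 2(1) 1(1)] u2_comp[OF 1(2) 2(2)], of X] by simp
qed

lemma orbit_equiv_cadjoint:
  assumes X: "bounded_clinear X" and "orbit_equiv X Y"
  shows "orbit_equiv (cadjoint X) (cadjoint Y)"
proof -
  obtain V W where VW: "u2_op V" "u2_op W" "Y = (\<lambda>x. V (X (W x)))"
    using assms orbit_equivE by metis
  have "cadjoint Y = (\<lambda>y. cadjoint W (cadjoint X (cadjoint V y)))"
    by (rule cadjoint_eqI)
       (simp add: VW(3) cadjoint[OF u2_bcl[OF VW(1)]] cadjoint[OF u2_bcl[OF VW(2)]] cadjoint[OF X])
  then show ?thesis
    using orbit_equivI[OF u2_cadjoint[OF VW(2)] u2_cadjoint[OF VW(1)], of "cadjoint X"] by simp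
qed

lemma orbit_equiv_pisom:
  assumes X: "pisom X" and "orbit_equiv X Y"
  shows "pisom Y" "hilbert_schmidt (\<lambda>x. Y x - X x)"
proof -
  obtain V W where VW: "u2_op V" "u2_op W" "Y = (\<lambda>x. V (X (W x)))"
    using assms orbit_equivE by metis
  note b = u2_bcl[OF VW(1)] u2_bcl[OF VW(2)] pisom_bcl[OF X]
  have bXW: "bounded_clinear (\<lambda>x. X (W x))" by (rule bounded_clinear_comp[OF b(3,2)])
  have bY: "bounded_clinear Y" unfolding VW(3) by (rule bounded_clinear_comp[OF b(1) bXW])
  have "cadjoint Y = (\<lambda>y. cadjoint W (cadjoint X (cadjoint V y)))"
    by (rule cadjoint_eqI) (simp add: VW(3) cadjoint[OF b(1)] cadjoint[OF b(2)] cadjoint[OF b(3)])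
  then show "pisom Y"
    unfolding pisom_def using bY
    by (simp add: VW(3) u2_adj_left[OF VW(1)] u2_adj_right[OF VW(2)] pisom_eq[OF X])
  have "hilbert_schmidt (\<lambda>x. (V (X (W x)) - X (W x)) + X (W x - x))"
    by (rule hs_add[OF hs_comp_left[OF u2_hs[OF VW(2)] b(3)] hs_comp_right[OF u2_hs[OF VW(1)] bXW]])
  then show "hilbert_schmidt (\<lambda>x. Y x - X x)" by (simp add: VW(3) bcl_diff[OF b(3)])
qed

section \<open>Moving one projection to another\<close>

text \<open>\<open>T = QP + (1 - Q)(1 - P)\<close> intertwines \<open>P\<close> and \<open>Q\<close>, is invertible by the hypotheses on the
  intersections, and \<open>T\<^sup>* T = 1 - (P - Q)\<^sup>2\<close>. Its polar part \<open>T (T\<^sup>* T)\<^bsup>-1/2\<^esup>\<close> is the required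
  unitary.\<close>

lemma projections_u2_equivalent:
  fixes P Q :: "'a::chilbert_space \<Rightarrow> 'a"
  assumes P: "is_proj P" and Q: "is_proj Q" and hs: "hilbert_schmidt (\<lambda>x. P x - Q x)"
    and PQ: "\<And>x. P x = x \<Longrightarrow> Q x = 0 \<Longrightarrow> x = 0" and QP: "\<And>x. Q x = x \<Longrightarrow> P x = 0 \<Longrightarrow> x = 0"
  shows "\<exists>W. u2_op W \<and> (\<forall>x. W (P x) = Q (W x))"
proof -
  note bP = is_projD(1)[OF P] and bQ = is_projD(1)[OF Q]
  note sP = bcl_simps[OF bP] is_projD(2)[OF P] and sQ = bcl_simps[OF bQ] is_projD(2)[OF Q]
  note bQP = bounded_clinear_comp[OF bQ bP]
  define A where "A x = P x - Q x" for x
  define D where "D x = A (A x)" for x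
  define T where "T x = Q (P x) + Q (P x) + x - P x - Q x" for x
  define T' where "T' x = P (Q x) + P (Q x) + x - P x - Q x" for x
  define S where "S x = Q (A x) - A (P x)" for x
  have bA: "bounded_clinear A" unfolding A_def[abs_def] by (intro bounded_clinear_intros bP bQ)
  have bD: "bounded_clinear D" unfolding D_def[abs_def] by (rule bounded_clinear_comp[OF bA bA])
  have bT: "bounded_clinear T" unfolding T_def[abs_def] by (intro bounded_clinear_intros bP bQ bQP)
  have hA: "hilbert_schmidt A" using hs by (simp add: A_def[abs_def])
  have hD: "hilbert_schmidt D" unfolding D_def[abs_def] by (rule hs_comp_left[OF hA bA])
  have hS: "hilbert_schmidt S"
    unfolding S_def[abs_def] by (intro hs_diff hs_comp_left[OF hA bQ] hs_comp_right[OF hA bP])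
  have Aadj: "cinner (A x) y = cinner x (A y)" for x y
    by (simp add: A_def cinner_simps is_projD(3)[OF P] is_projD(3)[OF Q])
  have Dadj: "cinner (D x) y = cinner x (D y)" for x y by (simp add: D_def Aadj)
  have Tadj: "cinner (T x) y = cinner x (T' y)" for x y
    by (simp add: T_def T'_def cinner_simps is_projD(3)[OF P] is_projD(3)[OF Q])
  have T'T: "T' (T x) = x - D x" for x
    by (simp add: T_def T'_def D_def A_def sP sQ algebra_simps)
  have TP: "T (P x) = Q (T x)" for x by (simp add: T_def sP sQ)
  have DP: "D (P x) = P (D x)" for x by (simp add: D_def A_def sP sQ)
  have TS: "T x = x + S x" for x by (simp add: T_def S_def A_def sP sQ algebra_simps)
  have injT: "x = 0" if "T x = 0" for x
  proof -
    have "T (P x) = 0" using TP[of x] that by (simp add: sQ)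
    then have "Q (P x) = 0" by (simp add: T_def sP)
    then have "P x = 0" by (rule PQ[of "P x", rotated]) (simp add: sP)
    then have "Q x = x" using that by (simp add: T_def sQ)
    then show ?thesis using \<open>P x = 0\<close> by (rule QP)
  qed
  have injT': "x = 0" if "T' x = 0" for x
  proof -
    have "P (T' x) = P (Q x)" by (simp add: T'_def sP sQ)
    then have "P (Q x) = 0" using that by (simp add: sP)
    then have "Q x = 0" by (rule QP[of "Q x", rotated]) (simp add: sQ)
    then have "P x = x" using that by (simp add: T'_def sP)
    then show ?thesis using \<open>Q x = 0\<close> by (rule PQ)
  qed
  have "\<exists>c>0. \<forall>x. c * norm x \<le> norm (T x)"
  proof (rule injective_bounded_below[OF bT hS zero_less_one _ injT])
    show "1 * norm x - norm (S x) \<le> norm (T x)" for x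
      using norm_diff_ineq[of x "S x"] by (simp add: TS)
  qed
  then obtain c0 where c0: "c0 > 0" "\<And>x. c0 * norm x \<le> norm (T x)" by blast
  \<comment> \<open>With \<open>c \<le> 1\<close> the number \<open>q\<close> below is nonnegative.\<close>
  define c where "c = min c0 1"
  have c: "c > 0" "c \<le> 1" using c0(1) by (simp_all add: c_def)
  have cT: "c * norm x \<le> norm (T x)" for x
    using c0(2)[of x] mult_right_mono[of c c0 "norm x"] by (simp add: c_def)
  define q where "q = 1 - c\<^sup>2"
  have q: "0 \<le> q" "q < 1" using c by (simp_all add: q_def power_le_one)
  have nA: "(norm (A x))\<^sup>2 \<le> q * (norm x)\<^sup>2" for x
  proof -
    have "(norm (A x))\<^sup>2 = Re (cinner (D x) x)" by (simp add: norm_sq_cinner D_def Aadj)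
    also have "D x = x - T' (T x)" by (simp add: T'T)
    also have "Re (cinner (x - T' (T x)) x) = (norm x)\<^sup>2 - Re (cinner (T' (T x)) x)"
      by (simp add: cinner_diff_left norm_sq_cinner)
    also have "cinner (T' (T x)) x = cnj (cinner (T x) (T x))"
      using Tadj[of x "T x"] by (metis cinner_commute)
    also have "Re (cnj (cinner (T x) (T x))) = (norm (T x))\<^sup>2" by (simp add: norm_sq_cinner)
    finally have "(norm (A x))\<^sup>2 = (norm x)\<^sup>2 - (norm (T x))\<^sup>2" .
    moreover have "(c * norm x)\<^sup>2 \<le> (norm (T x))\<^sup>2" using cT c by (intro power_mono) auto
    ultimately show ?thesis by (simp add: q_def power_mult_distrib algebra_simps)
  qed
  have nD: "norm (D x) \<le> q * norm x" for x
  proof (rule power2_le_imp_le)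
    have "(norm (D x))\<^sup>2 \<le> q * (norm (A x))\<^sup>2" unfolding D_def by (rule nA)
    also have "\<dots> \<le> q * (q * (norm x)\<^sup>2)" by (intro mult_left_mono nA q)
    finally show "(norm (D x))\<^sup>2 \<le> (q * norm x)\<^sup>2" by (simp add: power2_eq_square mult_ac)
  qed (use q in simp)
  obtain B r where bB: "bounded_clinear B" and Badj: "\<And>x y. cinner (B x) y = cinner x (B y)"
    and BP: "\<And>x. B (P x) = P (B x)" and BB: "\<And>x. 2 *\<^sub>R B x = D x + B (B x)"
    and r: "0 \<le> r" "r < 1" "\<And>x. norm (B x) \<le> r * norm x"
    using sqrt_one_minus[OF bD Dadj q nD bP DP] by metis
  have hB: "hilbert_schmidt B"
  proof (rule hs_dominated[OF hD bB, of 1])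
    fix x
    have "2 * norm (B x) = norm (D x + B (B x))" by (simp flip: BB)
    also have "\<dots> \<le> norm (D x) + norm (B (B x))" by (rule norm_triangle_ineq)
    also have "norm (B (B x)) \<le> 1 * norm (B x)"
      using r(3)[of "B x"] mult_right_mono[of r 1 "norm (B x)"] r(2) by simp
    finally show "norm (B x) \<le> 1 * norm (D x)" by simp
  qed
  define R where "R x = x - B x" for x
  have bR: "bounded_clinear R" unfolding R_def[abs_def] by (intro bounded_clinear_intros bB)
  have RR: "R (R x) = T' (T x)" for x
  proof -
    have "R (R x) = x - 2 *\<^sub>R B x + B (B x)" by (simp add: R_def bcl_diff[OF bB] scaleR_2)
    then show ?thesis by (simp add: BB T'T)
  qed
  have Radj: "cinner (R x) y = cinner x (R y)" for x y by (simp add: R_def cinner_simps Badj)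
  have Rbelow: "(1 - r) * norm x \<le> norm (R x)" for x
    using norm_triangle_ineq2[of x "B x"] r(3)[of x] by (simp add: R_def algebra_simps)
  have rpos: "1 - r > 0" using r by simp
  have "surj R"
  proof (rule surj_if_bounded_below[OF bR rpos Rbelow])
    fix y assume "cadjoint R y = 0"
    moreover have "cadjoint R = R" by (rule cadjoint_eqI) (rule Radj)
    ultimately have "(1 - r) * norm y \<le> 0" using Rbelow[of y] by simp
    then show "y = 0" using rpos by (simp add: mult_le_0_iff)
  qed
  note Ri = bounded_clinear_inverse[OF bR rpos Rbelow this]
  define W where "W x = T (finv R x)" for x
  have bW: "bounded_clinear W" unfolding W_def[abs_def] by (rule bounded_clinear_comp[OF bT Ri(1)])
  have nW: "norm (W x) = norm x" for x
  proof (rule power2_eq_imp_eq)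
    have "cinner (W x) (W x) = cinner (finv R x) (T' (T (finv R x)))"
      by (simp add: W_def Tadj)
    also have "\<dots> = cinner (R (finv R x)) (R (finv R x))" by (simp add: Radj flip: RR)
    finally show "(norm (W x))\<^sup>2 = (norm x)\<^sup>2" by (simp add: norm_sq_cinner Ri(2))
  qed simp_all
  have "surj T"
  proof (rule surj_if_bounded_below[OF bT c(1) cT])
    fix y assume "cadjoint T y = 0"
    moreover have "cadjoint T = T'" by (rule cadjoint_eqI) (rule Tadj)
    ultimately show "y = 0" using injT' by simp
  qed
  then have "surj W" unfolding W_def[abs_def] surj_def using Ri(3) by metis
  then have "unitary_op W" by (rule unitary_op_isometry_surj[OF bW nW])
  moreover have "hilbert_schmidt (\<lambda>x. W x - x)"
  proof -
    have "hilbert_schmidt (\<lambda>x. S (finv R x) + B (finv R x))"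
      by (intro hs_add hs_comp_right[OF hS Ri(1)] hs_comp_right[OF hB Ri(1)])
    moreover have "W x - x = S (finv R x) + B (finv R x)" for x
    proof -
      have "W x - x = T (finv R x) - R (finv R x)" by (simp add: W_def Ri(2))
      then show ?thesis by (simp add: TS R_def)
    qed
    ultimately show ?thesis by simp
  qed
  moreover have "W (P x) = Q (W x)" for x
  proof -
    have "R (P (finv R x)) = P x" by (simp add: R_def BP bcl_diff[OF bP, symmetric]) (simp add: R_def[symmetric] Ri(2))
    then have "finv R (P x) = P (finv R x)" using Ri(3) by metis
    then show ?thesis by (simp add: W_def TP)
  qed
  ultimately show ?thesis unfolding u2_op_def by blast
qed

section \<open>Moving a partial isometry with prescribed initial space\<close>

text \<open>For isometries \<open>G\<close> and \<open>X\<close> on the same space with \<open>Z = 1 + X\<^sup>* G\<close> invertible,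
  \<open>1 - (G + X) Z\<^bsup>-1\<^esup> (G + X)\<^sup>*\<close> is unitary and maps \<open>G x\<close> to \<open>- X x\<close>; for a one-dimensional
  space this is the Householder reflection. The next computation is one half of its unitarity; the other
  half is the same statement with \<open>G\<close> and \<open>X\<close> exchanged.\<close>

lemma householder_inverse:
  fixes G X :: "'a::chilbert_space \<Rightarrow> 'b::chilbert_space"
  assumes G: "pisom G" and X: "pisom X" and eq: "\<And>x. cadjoint G (G x) = cadjoint X (X x)"
    and Z: "\<And>x. z (x + cadjoint X (G x)) = x" and Zb: "bounded_clinear z"
    and Y: "\<And>x. y x + cadjoint G (X (y x)) = x"
  defines "D \<equiv> \<lambda>x. G x + X x" and "D' \<equiv> \<lambda>v. cadjoint G v + cadjoint X v"
  shows "(v - D (y (D' v))) - D (z (D' (v - D (y (D' v))))) = v"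
proof -
  note bG = pisom_bcl[OF G] and bX = pisom_bcl[OF X]
  note bG' = pisom_bcl_adj[OF G] and bX' = pisom_bcl_adj[OF X]
  have bD: "bounded_clinear D" unfolding D_def by (intro bounded_clinear_intros bG bX)
  have bD': "bounded_clinear D'" unfolding D'_def by (intro bounded_clinear_intros bG' bX')
  define q where "q x = cadjoint X (X x)" for x
  have Gq: "G (q x) = G x" and Xq: "X (q x) = X x" for x
    using pisom_eq[OF G, of x] pisom_eq[OF X, of x] eq by (simp_all add: q_def)
  define w where "w = y (D' v)"
  have w: "D' v = w + cadjoint G (X w)" using Y[of "D' v"] by (simp add: w_def)
  have D'D: "D' (D w) = q w + q w + cadjoint G (X w) + cadjoint X (G w)"
    by (simp add: D_def D'_def bcl_add[OF bG'] bcl_add[OF bX'] eq q_def)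
  \<comment> \<open>The component of \<open>w\<close> outside the common initial space, up to sign; it is invisible to \<open>D\<close>.\<close>
  define u where "u = q w - w"
  have Gu: "G u = 0" and Xu: "X u = 0" by (simp_all add: u_def bcl_diff[OF bG] bcl_diff[OF bX] Gq Xq)
  have zu: "z u = u" using Z[of u] by (simp add: Gu bcl_zero[OF bX'])
  have "D' (D w) - D' v = (w + cadjoint X (G w)) + u + u"
    unfolding w D'D by (simp add: u_def)
  moreover have "z ((w + cadjoint X (G w)) + u + u) = z (w + cadjoint X (G w)) + z u + z u"
    by (simp only: bcl_add[OF Zb])
  ultimately have "z (D' (D w) - D' v) = w + u + u" by (simp only: Z zu)
  then have "D (z (D' (D w) - D' v)) = D w"
    by (simp add: bcl_add[OF bD]) (simp add: D_def Gu Xu)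
  moreover have "z (D' (v - D w)) = - z (D' (D w) - D' v)"
    by (simp add: bcl_diff[OF bD'] flip: bcl_minus[OF Zb])
  ultimately have "D (z (D' (v - D w))) = - D w" by (simp add: bcl_minus[OF bD])
  then show ?thesis unfolding w_def[symmetric] by simp
qed

text \<open>\<open>1 + X\<^sup>* G\<close> differs by a Hilbert-Schmidt operator from \<open>1 + X\<^sup>* X \<ge> 1\<close>.\<close>

lemma pisom_cross_lower_bound:
  fixes G X :: "'a::chilbert_space \<Rightarrow> 'b::chilbert_space"
  assumes X: "pisom X"
  shows "1 * norm x - norm (cadjoint X (G x - X x)) \<le> norm (x + cadjoint X (G x))"
proof -
  define q where "q = cadjoint X (X x)"
  have "(norm x)\<^sup>2 \<le> (norm (x + q))\<^sup>2"
    using norm_add_sq[of x q] is_proj_norm_sq[OF pisom_initial[OF X], of x] Re_cinner_commute[of x q]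
    by (simp add: q_def)
  then have "norm x \<le> norm (x + q)" by (rule power2_le_imp_le) simp
  moreover have e: "x + cadjoint X (G x) = (x + q) + cadjoint X (G x - X x)"
    by (simp add: q_def bcl_diff[OF pisom_bcl_adj[OF X]])
  ultimately show ?thesis
    unfolding e using norm_diff_ineq[of "x + q" "cadjoint X (G x - X x)"] by linarith
qed

lemma u2_extension_invertible:
  fixes G X :: "'a::chilbert_space \<Rightarrow> 'b::chilbert_space"
  assumes G: "pisom G" and X: "pisom X" and eq: "\<And>x. cadjoint G (G x) = cadjoint X (X x)"
    and hs: "hilbert_schmidt (\<lambda>x. G x - X x)"
    and inj: "\<And>x. x + cadjoint X (G x) = 0 \<Longrightarrow> x = 0"
  shows "\<exists>V. u2_op V \<and> (\<forall>x. V (G x) = X x)"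
proof -
  note bG = pisom_bcl[OF G] and bX = pisom_bcl[OF X]
  note bG' = pisom_bcl_adj[OF G] and bX' = pisom_bcl_adj[OF X]
  note XG = bounded_clinear_comp[OF bX' bG]
  define D where "D = (\<lambda>x. G x + X x)"
  define D' where "D' = (\<lambda>v. cadjoint G v + cadjoint X v)"
  have bD: "bounded_clinear D" unfolding D_def by (intro bounded_clinear_intros bG bX)
  have bD': "bounded_clinear D'" unfolding D'_def by (intro bounded_clinear_intros bG' bX')
  have Dadj: "cinner (D x) v = cinner x (D' v)" for x v
    by (simp add: D_def D'_def cinner_simps cadjoint[OF bG] cadjoint[OF bX])
  define Z where "Z x = x + cadjoint X (G x)" for x
  have bZ: "bounded_clinear Z" unfolding Z_def[abs_def] by (intro bounded_clinear_intros XG)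
  define q where "q x = cadjoint X (X x)" for x
  have hS: "hilbert_schmidt (\<lambda>x. cadjoint X (G x - X x))" by (rule hs_comp_left[OF hs bX'])
  have Zadj: "cadjoint Z = (\<lambda>x. x + cadjoint G (X x))"
    by (rule cadjoint_eqI) (simp add: Z_def cinner_simps cadjoint'[OF bX] cadjoint[OF bG])
  have injZ: "x = 0" if "Z x = 0" for x using inj[of x] that unfolding Z_def by simp
  have "\<exists>c>0. \<forall>x. c * norm x \<le> norm (Z x)"
    by (rule injective_bounded_below[OF bZ hS zero_less_one _ injZ])
       (unfold Z_def, rule pisom_cross_lower_bound[OF X])
  then obtain c where c: "c > 0" "\<And>x. c * norm x \<le> norm (Z x)" by blast
  have "surj Z"
  proof (rule surj_if_bounded_below[OF bZ c])
    fix x assume "cadjoint Z x = 0"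
    then have x: "cadjoint G (X x) = - x" by (simp add: Zadj eq_neg_iff_add_eq_0 add.commute)
    have "cinner (cadjoint X (G x)) x = cinner (G x) (X x)" by (rule cadjoint'[OF bX])
    also have "\<dots> = cinner x (- x)" by (simp only: cadjoint[OF bG] x)
    finally have "Re (cinner (cadjoint X (G x)) x) = - (norm x)\<^sup>2" by (simp add: norm_sq_cinner)
    moreover have "norm (cadjoint X (G x)) \<le> norm x"
      using pisom_adj_norm_le[OF X] pisom_norm_le[OF G] order_trans by blast
    then have "(norm (cadjoint X (G x)))\<^sup>2 \<le> (norm x)\<^sup>2" by (intro power_mono) simp_all
    ultimately have "(norm (Z x))\<^sup>2 \<le> 0"
      using norm_add_sq[of x "cadjoint X (G x)"] Re_cinner_commute[of x] by (simp add: Z_def)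
    then show "x = 0" using inj[of x] by (simp add: Z_def)
  qed
  note Zi = bounded_clinear_inverse[OF bZ c this]
  define z where "z = finv Z"
  define y where "y = cadjoint z"
  have bz: "bounded_clinear z" using Zi(1) by (simp add: z_def)
  have by': "bounded_clinear y" unfolding y_def by (rule bounded_clinear_cadjoint[OF bz])
  have zZ: "z (x + cadjoint X (G x)) = x" and Zz: "z x + cadjoint X (G (z x)) = x" for x
    using Zi(2,3)[of x] by (simp_all add: z_def Z_def)
  have yY: "y (x + cadjoint G (X x)) = x" for x
  proof (rule cinner_eqI)
    fix w
    have "cinner (y (x + cadjoint G (X x))) w = cinner (cadjoint Z x) (z w)"
      by (simp add: y_def cadjoint'[OF bz] Zadj)
    then show "cinner (y (x + cadjoint G (X x))) w = cinner x w"
      by (simp add: cadjoint'[OF bZ] z_def Zi(2))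
  qed
  have Yy: "y x + cadjoint G (X (y x)) = x" for x
  proof (rule cinner_eqI)
    fix w
    have "cinner (y x + cadjoint G (X (y x))) w = cinner (cadjoint Z (y x)) w" by (simp add: Zadj)
    also have "\<dots> = cinner x (z (Z w))" by (simp add: cadjoint'[OF bZ] y_def cadjoint'[OF bz])
    finally show "cinner (y x + cadjoint G (X (y x))) w = cinner x w" by (simp add: z_def Zi(3))
  qed
  define H where "H v = v - D (z (D' v))" for v
  define H' where "H' v = v - D (y (D' v))" for v
  have bH: "bounded_clinear H"
    unfolding H_def[abs_def]
    by (intro bounded_clinear_intros bounded_clinear_comp[OF bD] bounded_clinear_comp[OF bz] bD')
  have HH': "H (H' v) = v" for v
    unfolding H_def H'_def D_def D'_def by (rule householder_inverse[OF G X eq zZ bz Yy])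
  have H'H: "H' (H v) = v" for v
    using householder_inverse[OF X G eq[symmetric] yY by' Zz, of v]
    by (simp add: H_def H'_def D_def D'_def add.commute)
  have "unitary_op H"
  proof (rule unitary_opI(1)[OF bH _ HH' H'H])
    fix x v
    have "cinner (D (z (D' x))) v = cinner x (D (y (D' v)))"
      by (simp add: Dadj y_def cadjoint[OF bz])
         (metis Dadj cinner_commute)
    then show "cinner (H x) v = cinner x (H' v)" by (simp add: H_def H'_def cinner_simps)
  qed
  \<comment> \<open>\<open>H\<close> sends \<open>G x\<close> to \<open>- X x\<close>; composed with the reflection that is \<open>-1\<close> on the range of \<open>G\<close>
    it is close to the identity and has the right sign.\<close>
  define K where "K v = v - G (cadjoint G v) - G (cadjoint G v)" for v
  have uK: "unitary_op K" unfolding K_def[abs_def] by (rule unitary_reflection[OF pisom_final[OF G]])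
  have HG: "H (G x) = - X x" for x
  proof -
    have "D' (G x) = q x + cadjoint X (G (q x))"
      using pisom_eq[OF G, of x] eq[of x] by (simp add: D'_def q_def)
    then have "z (D' (G x)) = q x" by (simp add: zZ)
    moreover have "D (q x) = G x + X x"
      using pisom_eq[OF G, of x] pisom_eq[OF X, of x] eq[of x] by (simp add: D_def q_def)
    ultimately show ?thesis by (simp add: H_def)
  qed
  define V where "V v = H (K v)" for v
  have V: "V v = v - D (z (D' v)) + X (cadjoint G v) + X (cadjoint G v)" for v
    by (simp add: V_def K_def bcl_diff[OF bH] HG) (simp add: H_def)
  have "V (G x) = X x" for x
  proof -
    have "K (G x) = - G x" by (simp add: K_def pisom_eq[OF G])
    then show ?thesis by (simp add: V_def bcl_minus[OF bH] HG)
  qed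
  moreover have "unitary_op V"
    using unitary_opI[of V "\<lambda>v. cadjoint K (cadjoint H v)"] \<open>unitary_op H\<close> uK
    by (simp add: V_def[abs_def] bounded_clinear_comp unitary_bcl unitary_adj_left unitary_adj_right cadjoint)
  moreover have "hilbert_schmidt (\<lambda>v. V v - v)"
  proof -
    \<comment> \<open>\<open>D = X Z + E\<close>, which cancels \<open>Z\<^bsup>-1\<^esup>\<close> in \<open>V\<close> up to a Hilbert-Schmidt term.\<close>
    define E where "E x = (G x - X x) - X (cadjoint X (G x - X x))" for x
    have hE: "hilbert_schmidt E" unfolding E_def[abs_def] by (intro hs_diff hs hs_comp_left[OF hS bX])
    have "D x = X (Z x) + E x" for x
      by (simp add: D_def Z_def E_def bcl_add[OF bX] bcl_diff[OF bX] bcl_diff[OF bX'] pisom_eq[OF X])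
    then have "D (z (D' v)) = X (D' v) + E (z (D' v))" for v by (simp add: z_def Zi(2))
    then have "V v - v = X (cadjoint G v - cadjoint X v) - E (z (D' v))" for v
      by (simp add: V D'_def bcl_add[OF bX] bcl_diff[OF bX])
    moreover have "hilbert_schmidt (\<lambda>v. X (cadjoint G v - cadjoint X v) - E (z (D' v)))"
    proof (rule hs_diff)
      have "hilbert_schmidt (\<lambda>v. cadjoint G v - cadjoint X v)"
        using hs_cadjoint[OF hs] by (simp add: cadjoint_diff[OF bG bX])
      then show "hilbert_schmidt (\<lambda>v. X (cadjoint G v - cadjoint X v))" by (rule hs_comp_left[OF _ bX])
      show "hilbert_schmidt (\<lambda>v. E (z (D' v)))"
        by (rule hs_comp_right[OF hE bounded_clinear_comp[OF bz bD']])
    qed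
    ultimately show ?thesis by simp
  qed
  ultimately show ?thesis unfolding u2_op_def by blast
qed

text \<open>If \<open>1 + X\<^sup>* G\<close> has a kernel, then \<open>G n = - X n\<close> there, and reversing the sign of \<open>G\<close> on this
  finite-dimensional space makes the operator injective.\<close>

lemma orbit_equiv_same_initial:
  fixes G X :: "'a::chilbert_space \<Rightarrow> 'b::chilbert_space"
  assumes G: "pisom G" and X: "pisom X" and eq: "\<And>x. cadjoint G (G x) = cadjoint X (X x)"
    and hs: "hilbert_schmidt (\<lambda>x. G x - X x)"
  shows "orbit_equiv G X"
proof -
  note bG = pisom_bcl[OF G] and bX = pisom_bcl[OF X]
  note bG' = pisom_bcl_adj[OF G] and bX' = pisom_bcl_adj[OF X]
  note XG = bounded_clinear_comp[OF bX' bG]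
  define q where "q x = cadjoint X (X x)" for x
  have q: "is_proj q" unfolding q_def[abs_def] by (rule pisom_initial[OF X])
  have Gq: "G (q x) = G x" for x using pisom_eq[OF G, of x] eq by (simp add: q_def)
  define Z where "Z x = x + cadjoint X (G x)" for x
  have bZ: "bounded_clinear Z" unfolding Z_def[abs_def] by (intro bounded_clinear_intros XG)
  have hS: "hilbert_schmidt (\<lambda>x. cadjoint X (G x - X x))" by (rule hs_comp_left[OF hs bX'])
  have "\<exists>N. finite N \<and> orthonormal N \<and> cspan N = UNIV \<inter> {x. Z x = 0}"
    by (rule semi_fredholm_kernel[OF bZ hS closed_csubspace_UNIV zero_less_one])
       (unfold Z_def, rule pisom_cross_lower_bound[OF X])
  then obtain N where N: "finite N" "orthonormal N" "\<And>x. x \<in> cspan N \<longleftrightarrow> Z x = 0" by auto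
  have pN: "is_proj (fproj N)" by (rule is_proj_fproj[OF N(1,2)])
  note bN = is_projD(1)[OF pN]
  have ZN: "Z (fproj N x) = 0" for x using N(3) fproj_in_cspan by blast
  have qN: "q (fproj N x) = fproj N x" for x
  proof -
    have "fproj N x = - cadjoint X (G (fproj N x))" using ZN[of x] by (simp add: Z_def eq_neg_iff_add_eq_0)
    then show ?thesis
      by (metis bcl_minus[OF is_projD(1)[OF q]] q_def pisom_adj_eq[OF X])
  qed
  have Nq: "fproj N (q x) = fproj N x" for x
    by (rule cinner_eqI) (simp add: is_projD(3)[OF pN] is_projD(3)[OF q] qN)
  have GXN: "G (fproj N x) = - X (fproj N x)" for x
  proof -
    define n where "n = fproj N x"
    have "cinner (G n) (X n) = cinner (cadjoint X (G n)) n" by (rule cadjoint'[OF bX, symmetric])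
    also have "cadjoint X (G n) = - n" using ZN[of x] by (simp add: Z_def n_def eq_neg_iff_add_eq_0 add.commute)
    finally have "Re (cinner (G n) (X n)) = - (norm n)\<^sup>2" by (simp add: norm_sq_cinner)
    moreover have "norm (G n) \<le> norm n" "norm (X n) \<le> norm n"
      using pisom_norm_le[OF G] pisom_norm_le[OF X] by blast+
    then have "(norm (G n))\<^sup>2 \<le> (norm n)\<^sup>2" "(norm (X n))\<^sup>2 \<le> (norm n)\<^sup>2" by (simp_all add: power_mono)
    ultimately have "(norm (G n + X n))\<^sup>2 \<le> 0" using norm_add_sq[of "G n" "X n"] by linarith
    then show ?thesis by (simp add: n_def eq_neg_iff_add_eq_0)
  qed
  define R where "R x = x - fproj N x - fproj N x" for x
  have uR: "u2_op R" unfolding R_def[abs_def] by (rule u2_reflection[OF N(1,2)])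
  have Radj: "cadjoint R = R"
    by (rule cadjoint_eqI) (simp add: R_def cinner_simps is_projD(3)[OF pN])
  define G1 where "G1 = (\<lambda>x. G (R x))"
  have eqv: "orbit_equiv G G1"
    unfolding G1_def using orbit_equivI[OF u2_id uR, of G] by simp
  note G1 = orbit_equiv_pisom[OF G eqv]
  have G1adj: "cadjoint G1 = (\<lambda>y. R (cadjoint G y))"
    unfolding G1_def by (simp add: cadjoint_comp[OF bG u2_bcl[OF uR]] Radj)
  have "\<exists>V. u2_op V \<and> (\<forall>x. V (G1 x) = X x)"
  proof (rule u2_extension_invertible[OF G1(1) X])
    show "cadjoint G1 (G1 x) = cadjoint X (X x)" for x
      by (simp add: G1adj) (simp add: G1_def eq flip: q_def,
         simp add: R_def bcl_diff[OF is_projD(1)[OF q]] bcl_diff[OF bN] qN Nq is_projD(2)[OF pN])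
    show "hilbert_schmidt (\<lambda>x. G1 x - X x)"
      using hs_add[OF hs G1(2)] by (simp add: add.commute)
    show "x = 0" if x: "x + cadjoint X (G1 x) = 0" for x
    proof -
      define n where "n = fproj N x"
      define m where "m = x - n"
      have Nm: "fproj N m = 0" by (simp add: m_def n_def bcl_diff[OF bN] is_projD(2)[OF pN])
      have mn: "cinner m n = 0"
        using is_projD(3)[OF pN, of m x] by (simp add: n_def Nm)
      have Zn: "cadjoint X (G n) = - n"
        using ZN[of x] by (simp add: Z_def n_def eq_neg_iff_add_eq_0 add.commute)
      have "R x = m - n" by (simp add: R_def m_def n_def)
      then have "cadjoint X (G1 x) = cadjoint X (G m) + n"
        by (simp add: G1_def bcl_diff[OF bG] bcl_diff[OF bX'] Zn)
      then have sum: "m + n + cadjoint X (G m) + n = 0" using x by (simp add: m_def algebra_simps)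
      have "cinner (cadjoint X (G m)) n = cinner (G m) (X n)" by (rule cadjoint'[OF bX])
      also have "X n = - G n" using GXN[of x] by (simp add: n_def)
      also have "cinner (G m) (- G n) = - cinner m (q n)" by (simp add: cadjoint[OF bG] eq q_def)
      also have "\<dots> = 0" using mn qN[of x] by (simp add: n_def)
      finally have "cinner (m + n + cadjoint X (G m) + n) n = cinner n n + cinner n n"
        by (simp add: cinner_add_left mn)
      then have "n = 0" using sum by (simp add: cinner_self flip: mult_2)
      then have "Z m = 0" using sum by (simp add: Z_def)
      then have "m = fproj N m" using N(3) fproj_eq_self[OF N(1,2)] by simp
      then show "x = 0" using Nm \<open>n = 0\<close> by (simp add: m_def)
    qed
  qed
  then obtain V where V: "u2_op V" "\<And>x. V (G1 x) = X x" by blast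
  then have "orbit_equiv G1 X" using orbit_equivI[OF V(1) u2_id, of G1] by simp
  then show ?thesis by (rule orbit_equiv_trans[OF eqv])
qed

section \<open>Classification of partial isometries modulo Hilbert-Schmidt operators\<close>

definition restr :: "('a::chilbert_space \<Rightarrow> 'b::chilbert_space) \<Rightarrow> 'a set \<Rightarrow> 'a \<Rightarrow> 'b" where
  "restr X G = (\<lambda>x. X (x - fproj G x))"

text \<open>\<open>X\<^sup>* X g = g\<close> says that \<open>g\<close> lies in the initial space of \<open>X\<close>, the orthogonal complement of
  the kernel.\<close>

definition initial_on :: "('a::chilbert_space \<Rightarrow> 'b::chilbert_space) \<Rightarrow> 'a set \<Rightarrow> bool" where
  "initial_on X G \<longleftrightarrow> finite G \<and> orthonormal G \<and> (\<forall>g\<in>G. cadjoint X (X g) = g)"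

lemma initial_onD:
  assumes "initial_on X G"
  shows "finite G" "orthonormal G" "g \<in> G \<Longrightarrow> cadjoint X (X g) = g" "is_proj (fproj G)"
  using assms is_proj_fproj[of G] unfolding initial_on_def by blast+

lemma initial_on_subset: "initial_on X G \<Longrightarrow> H \<subseteq> G \<Longrightarrow> initial_on X H"
  unfolding initial_on_def using orthonormal_subset finite_subset by (metis subsetD)

lemma fproj_eq_0: "(\<And>g. g \<in> G \<Longrightarrow> cinner x g = 0) \<Longrightarrow> fproj G x = 0"
  unfolding fproj_def by (rule sum.neutral) simp

lemma fproj_image:
  assumes "inj_on f G" shows "fproj (f ` G) x = (\<Sum>g\<in>G. cinner x (f g) *\<^sub>C f g)"
  unfolding fproj_def by (simp add: sum.reindex[OF assms])

context
  fixes X :: "'a::chilbert_space \<Rightarrow> 'b::chilbert_space" and G :: "'a set"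
  assumes X: "pisom X" and G: "initial_on X G"
begin

lemma initial_fproj: "cadjoint X (X (fproj G x)) = fproj G x"
  unfolding fproj_def bcl_sum[OF is_projD(1)[OF pisom_initial[OF X]]]
  by (rule sum.cong) (simp_all add: bcl_scaleC[OF is_projD(1)[OF pisom_initial[OF X]]] initial_onD(3)[OF G])

lemma fproj_initial: "fproj G (cadjoint X (X x)) = fproj G x"
  by (rule cinner_eqI)
     (simp add: is_projD(3)[OF initial_onD(4)[OF G]] is_projD(3)[OF pisom_initial[OF X]] initial_fproj)

lemma bounded_clinear_restr: "bounded_clinear (restr X G)"
  unfolding restr_def
  by (intro bounded_clinear_comp[OF pisom_bcl[OF X]] bounded_clinear_intros bounded_clinear_fproj)

lemma cadjoint_restr: "cadjoint (restr X G) = (\<lambda>y. cadjoint X y - fproj G (cadjoint X y))"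
  by (rule cadjoint_eqI)
     (simp add: restr_def cadjoint[OF pisom_bcl[OF X]] cinner_simps is_projD(3)[OF initial_onD(4)[OF G]])

lemma restr_initial: "cadjoint (restr X G) (restr X G x) = cadjoint X (X x) - fproj G x"
proof -
  note p = initial_onD(4)[OF G]
  have "cadjoint X (X (x - fproj G x)) = cadjoint X (X x) - fproj G x"
    by (simp add: bcl_diff[OF is_projD(1)[OF pisom_initial[OF X]]] initial_fproj)
  then show ?thesis
    by (simp add: cadjoint_restr) (simp add: restr_def bcl_diff[OF bounded_clinear_fproj] fproj_initial is_projD(2)[OF p])
qed

lemma pisom_restr: "pisom (restr X G)"
  unfolding pisom_def
  by (simp add: bounded_clinear_restr restr_initial)
     (simp add: restr_def bcl_diff[OF pisom_bcl[OF X]] bcl_diff[OF bounded_clinear_fproj]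
       pisom_eq[OF X] fproj_initial is_projD(2)[OF initial_onD(4)[OF G]] bcl_zero[OF pisom_bcl[OF X]])

lemma hs_restr: "hilbert_schmidt (\<lambda>x. X x - restr X G x)"
  unfolding restr_def by (simp add: bcl_diff[OF pisom_bcl[OF X]] hs_comp_left[OF hs_fproj pisom_bcl[OF X]])

lemma initial_cinner: "g \<in> G \<Longrightarrow> cinner (X x) (X g) = cinner x g"
  by (simp add: cadjoint[OF pisom_bcl[OF X]] initial_onD(3)[OF G])

lemma initial_inj: "inj_on X G"
  by (rule inj_on_inverseI[of _ "cadjoint X"]) (rule initial_onD(3)[OF G])

lemma initial_on_cadjoint: "initial_on (cadjoint X) (X ` G)"
proof -
  have "orthonormal (X ` G)"
  proof (rule orthonormalI)
    fix y assume "y \<in> X ` G"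
    then obtain g where g: "g \<in> G" "y = X g" by blast
    have "(norm y)\<^sup>2 = (norm g)\<^sup>2" using g by (simp add: norm_sq_cinner initial_cinner)
    then show "norm y = 1" using orthonormalD(1)[OF initial_onD(2)[OF G] g(1)]
      by (metis norm_ge_zero power2_eq_imp_eq)
  next
    fix y z assume "y \<in> X ` G" "z \<in> X ` G" and ne: "y \<noteq> z"
    then obtain g h where g: "g \<in> G" "y = X g" "h \<in> G" "z = X h" by blast
    with ne have "g \<noteq> h" by blast
    then show "cinner y z = 0"
      using orthonormalD(2)[OF initial_onD(2)[OF G] g(1,3)] by (simp add: g initial_cinner)
  qed
  then show ?thesis
    by (simp add: initial_on_def initial_onD(1)[OF G] cadjoint_cadjoint[OF pisom_bcl[OF X]] pisom_eq[OF X])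
qed

lemma restr_cadjoint: "restr (cadjoint X) (X ` G) = cadjoint (restr X G)"
proof
  fix y
  have "fproj (X ` G) y = X (fproj G (cadjoint X y))"
    unfolding fproj_image[OF initial_inj] unfolding fproj_def bcl_sum[OF pisom_bcl[OF X]]
    by (simp add: bcl_scaleC[OF pisom_bcl[OF X]] cadjoint'[OF pisom_bcl[OF X]])
  then show "restr (cadjoint X) (X ` G) y = cadjoint (restr X G) y"
    by (simp add: cadjoint_restr) (simp add: restr_def bcl_diff[OF pisom_bcl_adj[OF X]] initial_fproj)
qed

end

lemma restr_Un:
  assumes G: "finite G" and H: "finite H" and disj: "G \<inter> H = {}"
    and o: "\<And>g h. g \<in> G \<Longrightarrow> h \<in> H \<Longrightarrow> cinner h g = 0"
  shows "restr (restr X G) H = restr X (G \<union> H)"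
proof
  fix x
  have "fproj G (fproj H x) = 0"
    by (rule fproj_eq_0) (simp add: fproj_def cinner_sum_left cinner_scaleC_left o)
  moreover have "fproj (G \<union> H) x = fproj G x + fproj H x"
    unfolding fproj_def by (rule sum.union_disjoint[OF G H disj])
  ultimately show "restr (restr X G) H x = restr X (G \<union> H) x"
    by (simp add: restr_def bcl_diff[OF bounded_clinear_fproj] algebra_simps)
qed

text \<open>A vector \<open>x\<close> in the initial space of \<open>Y\<close> is orthogonal to \<open>E'\<close>, which lies in the kernel of
  \<open>Y\<close>. If the restriction of \<open>X\<close> annihilates \<open>x\<close>, so does \<open>X\<close>, and \<open>x\<close> belongs
  to the span of \<open>E\<close>, to which it is orthogonal.\<close>

lemma restr_initial_disjoint:
  fixes X Y :: "'a::chilbert_space \<Rightarrow> 'b::chilbert_space"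
  assumes X: "pisom X" and Y: "pisom Y" and i: "initial_on Y E" and E': "\<And>g. g \<in> E' \<Longrightarrow> Y g = 0"
    and E: "cspan E = {x. cadjoint Y (Y x) = x \<and> X x = 0}"
    and x: "cadjoint Y (Y x) - fproj E x = x" "cadjoint X (X x) - fproj E' x = 0"
  shows "x = 0"
proof -
  note p = initial_onD(4)[OF i]
  have "fproj E (cadjoint Y (Y x) - fproj E x) = 0"
    by (simp add: bcl_diff[OF is_projD(1)[OF p]] fproj_initial[OF Y i] is_projD(2)[OF p])
  then have Ex: "fproj E x = 0" by (simp add: x(1))
  then have Yx: "cadjoint Y (Y x) = x" using x(1) by simp
  have "fproj E' x = 0"
  proof (rule fproj_eq_0)
    fix g assume "g \<in> E'"
    then have "cinner (cadjoint Y (Y x)) g = 0" using E' by (simp add: cadjoint'[OF pisom_bcl[OF Y]])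
    then show "cinner x g = 0" by (simp add: Yx)
  qed
  then have "X x = 0" using x(2) pisom_norm[OF X, of x] by simp
  then have "x \<in> cspan E" using E Yx by simp
  then show ?thesis using fproj_eq_self[OF initial_onD(1,2)[OF i]] Ex by simp
qed

text \<open>Two partial isometries that differ by a Hilbert-Schmidt operator become orbit equivalent once
  each is made to vanish on the vectors of its initial space that the other one annihilates: a
  unitary of \<open>projections_u2_equivalent\<close> then aligns the initial spaces.\<close>

lemma orbit_equiv_restr:
  fixes X Y :: "'a::chilbert_space \<Rightarrow> 'b::chilbert_space"
  assumes X: "pisom X" and Y: "pisom Y" and hs: "hilbert_schmidt (\<lambda>x. X x - Y x)"
    and E: "finite E" "orthonormal E" "cspan E = {x. cadjoint Y (Y x) = x \<and> X x = 0}"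
    and E': "finite E'" "orthonormal E'" "cspan E' = {x. cadjoint X (X x) = x \<and> Y x = 0}"
  shows "orbit_equiv (restr Y E) (restr X E')"
proof -
  have iE: "initial_on Y E" and iE': "initial_on X E'"
    using E E' complex_vector.span_superset[of E] complex_vector.span_superset[of E']
    by (auto simp: initial_on_def)
  define X1 Y1 where "X1 = restr X E'" and "Y1 = restr Y E"
  have pX1: "pisom X1" and pY1: "pisom Y1"
    unfolding X1_def Y1_def by (rule pisom_restr[OF X iE'], rule pisom_restr[OF Y iE])
  define P Q where "P x = cadjoint Y1 (Y1 x)" and "Q x = cadjoint X1 (X1 x)" for x
  have P: "is_proj P" and Q: "is_proj Q"
    unfolding P_def[abs_def] Q_def[abs_def] by (rule pisom_initial[OF pY1], rule pisom_initial[OF pX1])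
  have P': "P x = cadjoint Y (Y x) - fproj E x" for x
    unfolding P_def Y1_def by (rule restr_initial[OF Y iE])
  have Q': "Q x = cadjoint X (X x) - fproj E' x" for x
    unfolding Q_def X1_def by (rule restr_initial[OF X iE'])
  have hs1: "hilbert_schmidt (\<lambda>x. Y1 x - X1 x)"
  proof -
    have "hilbert_schmidt (\<lambda>x. (X x - X1 x) - ((Y x - Y1 x) + (X x - Y x)))"
      unfolding X1_def Y1_def by (intro hs_diff hs_add hs hs_restr[OF X iE'] hs_restr[OF Y iE])
    moreover have "(X x - X1 x) - ((Y x - Y1 x) + (X x - Y x)) = Y1 x - X1 x" for x by simp
    ultimately show ?thesis by simp
  qed
  have hsPQ: "hilbert_schmidt (\<lambda>x. P x - Q x)"
  proof -
    have "hilbert_schmidt (\<lambda>y. cadjoint Y1 y - cadjoint X1 y)"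
      using hs_cadjoint[OF hs1] by (simp add: cadjoint_diff[OF pisom_bcl[OF pY1] pisom_bcl[OF pX1]])
    then have "hilbert_schmidt (\<lambda>x. cadjoint Y1 (Y1 x - X1 x) + (cadjoint Y1 (X1 x) - cadjoint X1 (X1 x)))"
      by (intro hs_add hs_comp_left[OF hs1 pisom_bcl_adj[OF pY1]] hs_comp_right[OF _ pisom_bcl[OF pX1]])
    then show ?thesis by (simp add: P_def Q_def bcl_diff[OF pisom_bcl_adj[OF pY1]])
  qed
  have "\<exists>W. u2_op W \<and> (\<forall>x. W (P x) = Q (W x))"
  proof (rule projections_u2_equivalent[OF P Q hsPQ])
    have "Y g = 0" if "g \<in> E'" for g using E'(3) complex_vector.span_base[OF that] by blast
    from restr_initial_disjoint[OF X Y iE this E(3)]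
    show "x = 0" if "P x = x" "Q x = 0" for x using that by (simp only: P' Q')
    have "X g = 0" if "g \<in> E" for g using E(3) complex_vector.span_base[OF that] by blast
    from restr_initial_disjoint[OF Y X iE' this E'(3)]
    show "x = 0" if "Q x = x" "P x = 0" for x using that by (simp only: P' Q')
  qed
  then obtain W where W: "u2_op W" "\<And>x. W (P x) = Q (W x)" by blast
  define G where "G = (\<lambda>x. Y1 (cadjoint W x))"
  have eqv: "orbit_equiv Y1 G"
    unfolding G_def using orbit_equivI[OF u2_id u2_cadjoint[OF W(1)], of Y1] by simp
  note G = orbit_equiv_pisom[OF pY1 eqv]
  have "cadjoint G = (\<lambda>y. W (cadjoint Y1 y))"
    unfolding G_def
    by (simp add: cadjoint_comp[OF pisom_bcl[OF pY1] bounded_clinear_cadjoint[OF u2_bcl[OF W(1)]]]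
        cadjoint_cadjoint[OF u2_bcl[OF W(1)]])
  then have "cadjoint G (G x) = cadjoint X1 (X1 x)" for x
    by (simp add: G_def) (simp add: W(2) u2_adj_right[OF W(1)] flip: P_def Q_def)
  moreover have "hilbert_schmidt (\<lambda>x. G x - X1 x)" using hs_add[OF G(2) hs1] by simp
  ultimately have "orbit_equiv G X1" by (rule orbit_equiv_same_initial[OF G(1) pX1])
  then show ?thesis using orbit_equiv_trans[OF eqv] unfolding X1_def Y1_def by blast
qed

text \<open>On the initial space of \<open>Y\<close>, \<open>X\<close> is bounded below by \<open>1\<close> up to the Hilbert-Schmidt operator
  \<open>X - Y\<close>.\<close>

lemma finite_intersection:
  fixes X Y :: "'a::chilbert_space \<Rightarrow> 'b::chilbert_space"
  assumes X: "pisom X" and Y: "pisom Y" and hs: "hilbert_schmidt (\<lambda>x. X x - Y x)"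
  shows "\<exists>E. finite E \<and> orthonormal E \<and> cspan E = {x. cadjoint Y (Y x) = x \<and> X x = 0}"
proof -
  have bq: "bounded_clinear (\<lambda>x. cadjoint Y (Y x) - x)"
    by (intro bounded_clinear_intros is_projD(1)[OF pisom_initial[OF Y]])
  have M: "closed_csubspace {x. cadjoint Y (Y x) = x}"
    using closed_csubspace_kernel[OF bq] by simp
  have "\<exists>E. finite E \<and> orthonormal E \<and> cspan E = {x. cadjoint Y (Y x) = x} \<inter> {x. X x = 0}"
  proof (rule semi_fredholm_kernel[OF pisom_bcl[OF X] hs M zero_less_one])
    fix x assume "x \<in> {x. cadjoint Y (Y x) = x}"
    then have "norm (Y x) = norm x" using pisom_norm[OF Y, of x] by simp
    then show "1 * norm x - norm (X x - Y x) \<le> norm (X x)"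
      using norm_diff_ineq[of "Y x" "X x - Y x"] by simp
  qed
  then show ?thesis by (simp add: Collect_conj_eq)
qed

text \<open>Orbits are open: nearby partial isometries annihilate nothing of each other's initial space.\<close>

lemma orbit_equiv_near:
  fixes X Y :: "'a::chilbert_space \<Rightarrow> 'b::chilbert_space"
  assumes X: "pisom X" and Y: "pisom Y" and hs: "hilbert_schmidt (\<lambda>x. X x - Y x)"
    and near: "\<And>x. x \<noteq> 0 \<Longrightarrow> norm (X x - Y x) < norm x"
  shows "orbit_equiv Y X"
proof -
  have 0: "x = 0" if "cadjoint A (A x) = x" "B x = 0" "norm (B x - A x) = norm (X x - Y x)" "pisom A"
    for A B :: "'a \<Rightarrow> 'b" and x
    using near[of x] pisom_norm[OF that(4), of x] that(1-3) by (cases "x = 0") auto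
  have "{x. cadjoint Y (Y x) = x \<and> X x = 0} = {0}" "{x. cadjoint X (X x) = x \<and> Y x = 0} = {0}"
    using 0[of Y _ X] 0[of X _ Y] X Y bcl_zero[OF pisom_bcl[OF X]] bcl_zero[OF pisom_bcl[OF Y]]
      bcl_zero[OF pisom_bcl_adj[OF X]] bcl_zero[OF pisom_bcl_adj[OF Y]]
    by (auto simp: norm_minus_commute)
  then have "orbit_equiv (restr Y {}) (restr X {})"
    by (intro orbit_equiv_restr X Y hs) simp_all
  then show ?thesis by (simp add: restr_def fproj_def)
qed

text \<open>Both sets are completed to orthonormal bases of the span of their union, and the unitary is the
  change of basis there and the identity on the orthogonal complement.\<close>

lemma u2_move:
  fixes G H :: "'a::chilbert_space set"
  assumes G: "finite G" "orthonormal G" and H: "finite H" "orthonormal H" and \<pi>: "bij_betw \<pi> G H"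
  shows "\<exists>W. u2_op W \<and> (\<forall>g\<in>G. W g = \<pi> g) \<and> (\<forall>s. (\<forall>x\<in>G \<union> H. cinner s x = 0) \<longrightarrow> W s = s)"
proof -
  obtain N where N: "finite N" "orthonormal N" "G \<subseteq> N" "cspan N = cspan (G \<union> H)"
    using orthonormal_extend[OF H(1) G] by blast
  obtain N' where N': "finite N'" "orthonormal N'" "H \<subseteq> N'" "cspan N' = cspan (H \<union> G)"
    using orthonormal_extend[OF G(1) H] by blast
  have sp: "cspan N' = cspan N" using N(4) N'(4) by (simp add: Un_commute)
  have pp: "fproj N' = fproj N" by (simp only: fproj_eq_proj[OF N(1,2)] fproj_eq_proj[OF N'(1,2)] sp)
  have "card N = card N'" using cdim_cspan[OF N(2,1)] cdim_cspan[OF N'(2,1)] sp by simp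
  moreover have "card G = card H" using bij_betw_same_card[OF \<pi>] .
  ultimately have "card (N - G) = card (N' - H)"
    using N(3) N'(3) G(1) H(1) by (simp add: card_Diff_subset)
  then obtain \<sigma> where \<sigma>: "bij_betw \<sigma> (N - G) (N' - H)"
    using finite_same_card_bij N(1) N'(1) by (metis finite_Diff)
  define \<rho> where "\<rho> x = (if x \<in> G then \<pi> x else \<sigma> x)" for x
  have "bij_betw \<rho> (G \<union> (N - G)) (H \<union> (N' - H))"
  proof (rule bij_betw_combine)
    show "bij_betw \<rho> G H" using \<pi> by (rule bij_betw_cong[THEN iffD1, rotated]) (simp add: \<rho>_def)
    show "bij_betw \<rho> (N - G) (N' - H)"
      using \<sigma> by (rule bij_betw_cong[THEN iffD1, rotated]) (simp add: \<rho>_def)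
  qed auto
  moreover have "G \<union> (N - G) = N" "H \<union> (N' - H) = N'" using N(3) N'(3) by auto
  ultimately have \<rho>: "bij_betw \<rho> N N'" by simp
  have \<rho>N: "\<rho> g \<in> N'" if "g \<in> N" for g using \<rho> that by (auto simp: bij_betw_def)
  define T where "T x = (\<Sum>g\<in>N. cinner x g *\<^sub>C \<rho> g)" for x
  have bT: "bounded_clinear T" unfolding T_def[abs_def] by (intro bounded_clinear_intros)
  define W where "W x = x - fproj N x + T x" for x
  have bW: "bounded_clinear W"
    unfolding W_def[abs_def] by (intro bounded_clinear_intros bounded_clinear_fproj bT)
  have T: "cinner (T x) (\<rho> g) = cinner x g" if "g \<in> N" for x g
    unfolding T_def using \<rho> N'(2) by (intro cinner_sum_orthonormal N(1) that) (auto simp: bij_betw_def)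
  have TN: "T x \<in> cspan N" for x
    unfolding T_def sp[symmetric]
    by (intro complex_vector.span_sum complex_vector.span_scale complex_vector.span_base \<rho>N)
  have nT: "(norm (T x))\<^sup>2 = (norm (fproj N x))\<^sup>2" for x
  proof -
    have "fproj N' (T x) = T x" using fproj_eq_self[OF N'(1,2)] TN sp by simp
    then have "(norm (T x))\<^sup>2 = (\<Sum>h\<in>N'. (cmod (cinner (T x) h))\<^sup>2)"
      using norm_fproj[OF N'(1,2), of "T x"] by simp
    also have "\<dots> = (\<Sum>g\<in>N. (cmod (cinner (T x) (\<rho> g)))\<^sup>2)"
      by (rule sum.reindex_bij_betw[OF \<rho>, symmetric])
    also have "\<dots> = (norm (fproj N x))\<^sup>2" by (simp add: T norm_fproj[OF N(1,2)])
    finally show ?thesis .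
  qed
  have nW: "norm (W x) = norm x" for x
  proof (rule power2_eq_imp_eq)
    have "(norm (W x))\<^sup>2 = (norm (x - fproj N x))\<^sup>2 + (norm (T x))\<^sup>2"
      unfolding W_def by (rule pythagoras[OF fproj_orth[OF N(1,2) TN]])
    also have "\<dots> = (norm x)\<^sup>2"
      using fproj_pythagoras[OF N(1,2), of x] by (simp add: nT norm_fproj[OF N(1,2)])
    finally show "(norm (W x))\<^sup>2 = (norm x)\<^sup>2" .
  qed simp_all
  have "\<exists>x. W x = z" for z
  proof -
    define t where "t = (\<Sum>g\<in>N. cinner z (\<rho> g) *\<^sub>C g)"
    define x where "x = z - fproj N z + t"
    have tN: "t \<in> cspan N"
      unfolding t_def by (intro complex_vector.span_sum complex_vector.span_scale complex_vector.span_base)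
    have xg: "cinner x g = cinner z (\<rho> g)" if "g \<in> N" for g
    proof -
      have "cinner t g = cinner z (\<rho> g)"
        unfolding t_def using cinner_sum_orthonormal[OF N(1) that, of "\<lambda>x. x"] N(2) by simp
      then show ?thesis
        using fproj_orth[OF N(1,2) complex_vector.span_base[OF that], of z]
        by (simp add: x_def cinner_add_left)
    qed
    have "fproj N x = t" by (simp add: fproj_def xg t_def)
    moreover have "T x = fproj N' z"
      unfolding T_def fproj_def by (simp add: xg sum.reindex_bij_betw[OF \<rho>, symmetric])
    ultimately have "W x = z" by (simp add: W_def x_def pp)
    then show ?thesis ..
  qed
  then have "surj W" unfolding surj_def by metis
  then have "unitary_op W" by (rule unitary_op_isometry_surj[OF bW nW])
  moreover have "hilbert_schmidt (\<lambda>x. W x - x)"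
  proof -
    have "hilbert_schmidt (\<lambda>x. T x - fproj N x)"
      unfolding T_def by (intro hs_diff hs_sum hs_rank1 hs_fproj)
    then show ?thesis by (simp add: W_def algebra_simps)
  qed
  moreover have "W g = \<pi> g" if "g \<in> G" for g
  proof -
    have gN: "g \<in> N" using that N(3) by blast
    have "T g = (\<Sum>h\<in>N. (if g = h then 1 else 0) *\<^sub>C \<rho> h)"
      unfolding T_def by (rule sum.cong) (simp_all add: orthonormal_cinner[OF N(2) gN])
    also have "\<dots> = \<rho> g" using gN N(1) by (simp add: if_distrib[of "\<lambda>a. a *\<^sub>C _"] cong: if_cong)
    finally have "T g = \<pi> g" using that by (simp add: \<rho>_def)
    moreover have "fproj N g = g" by (rule fproj_eq_self[OF N(1,2) complex_vector.span_base[OF gN]])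
    ultimately show ?thesis by (simp add: W_def)
  qed
  moreover have "W s = s" if s: "\<forall>x\<in>G \<union> H. cinner s x = 0" for s
  proof -
    have "cspan (G \<union> H) \<subseteq> {z. cinner s z = 0}"
      using s by (intro complex_vector.span_minimal csubspace_orth) blast
    then have 0: "cinner s g = 0" if "g \<in> N" for g
      using N(4) complex_vector.span_base[OF that] by blast
    then show ?thesis by (simp add: W_def T_def fproj_eq_0)
  qed
  ultimately show ?thesis unfolding u2_op_def by blast
qed

text \<open>Both operators extend \<open>Y = restr X G\<close>. Unitaries that move \<open>G\<close> to \<open>G'\<close> and \<open>X ` G\<close> to
  \<open>X' ` G'\<close> and fix what is orthogonal to these sets leave \<open>Y\<close> unchanged.\<close>

lemma orbit_equiv_same_rank:
  fixes X X' :: "'a::chilbert_space \<Rightarrow> 'b::chilbert_space"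
  assumes X: "pisom X" and X': "pisom X'" and G: "initial_on X G" and G': "initial_on X' G'"
    and eq: "restr X G = restr X' G'" and card: "card G = card G'"
  shows "orbit_equiv X X'"
proof -
  note bX = pisom_bcl[OF X] and bX' = pisom_bcl[OF X']
  note oG = initial_onD(1,2)[OF G] and oG' = initial_onD(1,2)[OF G']
  define Y where "Y = restr X G"
  have bY: "bounded_clinear Y" unfolding Y_def by (rule bounded_clinear_restr[OF X G])
  have Y': "Y = restr X' G'" by (simp add: Y_def eq)
  obtain \<pi> where \<pi>: "bij_betw \<pi> G G'" using finite_same_card_bij[OF oG(1) oG'(1) card] by blast
  obtain W where W: "u2_op W" "\<And>g. g \<in> G \<Longrightarrow> W g = \<pi> g"
    "\<And>s. (\<forall>x\<in>G \<union> G'. cinner s x = 0) \<Longrightarrow> W s = s"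
    using u2_move[OF oG oG' \<pi>] by blast
  define \<rho> where "\<rho> y = X' (\<pi> (cadjoint X y))" for y
  have \<rho>: "bij_betw \<rho> (X ` G) (X' ` G')"
  proof -
    have 1: "bij_betw (cadjoint X) (X ` G) G"
      unfolding bij_betw_def
    proof
      show "inj_on (cadjoint X) (X ` G)"
        by (rule inj_on_inverseI[of _ X]) (use initial_onD(3)[OF G] in auto)
      show "cadjoint X ` X ` G = G" using initial_onD(3)[OF G] by force
    qed
    have 2: "bij_betw X' G' (X' ` G')" using initial_inj[OF X' G'] by (simp add: bij_betw_def)
    have "bij_betw (X' \<circ> (\<pi> \<circ> cadjoint X)) (X ` G) (X' ` G')"
      by (rule bij_betw_trans[OF bij_betw_trans[OF 1 \<pi>] 2])
    then show ?thesis by (simp add: \<rho>_def[abs_def] comp_def)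
  qed
  note XG = initial_on_cadjoint[OF X G] and XG' = initial_on_cadjoint[OF X' G']
  obtain V where V: "u2_op V" "\<And>y. y \<in> X ` G \<Longrightarrow> V y = \<rho> y"
    "\<And>s. (\<forall>x\<in>X ` G \<union> X' ` G'. cinner s x = 0) \<Longrightarrow> V s = s"
    using u2_move[OF initial_onD(1,2)[OF XG] initial_onD(1,2)[OF XG'] \<rho>] by blast
  have VX: "V (X g) = X' (\<pi> g)" if "g \<in> G" for g
    using V(2)[of "X g"] that initial_onD(3)[OF G that] by (simp add: \<rho>_def)
  have Yorth: "cinner (Y x) z = 0" if "z \<in> X ` G \<union> X' ` G'" for x z
  proof -
    have "cinner (restr A H x) (A h) = 0" if "pisom A" "initial_on A H" "h \<in> H" for A H h
      using fproj_orth[OF initial_onD(1,2)[OF that(2)] complex_vector.span_base[OF that(3)], of x]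
        initial_cinner[OF that(1,2,3)] by (simp add: restr_def)
    from this[OF X G] this[OF X' G'] show ?thesis using that unfolding Y'[symmetric] Y_def[symmetric] by blast
  qed
  have Ykill: "Y g = 0" if "g \<in> G \<union> G'" for g
  proof -
    have "restr A H h = 0" if "pisom A" "initial_on A H" "h \<in> H" for A :: "'a \<Rightarrow> 'b" and H h
      using fproj_eq_self[OF initial_onD(1,2)[OF that(2)] complex_vector.span_base[OF that(3)]]
        bcl_zero[OF pisom_bcl[OF that(1)]] by (simp add: restr_def)
    from this[OF X G] this[OF X' G'] show ?thesis using that unfolding Y'[symmetric] Y_def[symmetric] by blast
  qed
  have WY: "W (cadjoint Y v) = cadjoint Y v" for v
    by (rule W(3)) (simp add: cadjoint'[OF bY] Ykill)
  have YW: "Y (W y) = Y y" for y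
    by (rule cinner_eqI) (metis WY cadjoint[OF bY] u2_cinner[OF W(1)])
  have "V (X x) = X' (W x)" for x
  proof -
    define y where "y = x - fproj G x"
    have yG: "cinner y g = 0" if "g \<in> G" for g
      unfolding y_def by (rule fproj_orth[OF oG complex_vector.span_base[OF that]])
    have "V (X y) = X y"
      by (rule V(3)) (use Yorth[of _ x] in \<open>simp add: Y_def restr_def y_def\<close>)
    moreover have "X y = Y y" by (simp add: Y_def restr_def fproj_eq_0 yG)
    moreover have "X' (W y) = Y (W y)"
    proof -
      have "cinner (W y) h = 0" if h: "h \<in> G'" for h
      proof -
        obtain g where "g \<in> G" "h = \<pi> g" using \<pi> h by (auto simp: bij_betw_def)
        then show ?thesis using u2_cinner[OF W(1), of y g] W(2) yG by simp
      qed
      then show ?thesis by (simp add: Y' restr_def fproj_eq_0)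
    qed
    ultimately have 1: "V (X y) = X' (W y)" by (simp add: YW)
    have 2: "V (X (fproj G x)) = X' (W (fproj G x))"
      by (simp add: fproj_def bcl_sum[OF bX] bcl_sum[OF bX'] bcl_sum[OF u2_bcl[OF V(1)]]
          bcl_sum[OF u2_bcl[OF W(1)]] bcl_scaleC[OF bX] bcl_scaleC[OF bX']
          bcl_scaleC[OF u2_bcl[OF V(1)]] bcl_scaleC[OF u2_bcl[OF W(1)]] VX W(2))
    have "x = y + fproj G x" by (simp add: y_def)
    then show ?thesis
      using 1 2 by (metis bcl_add[OF bX] bcl_add[OF bX'] bcl_add[OF u2_bcl[OF V(1)]] bcl_add[OF u2_bcl[OF W(1)]])
  qed
  then have "X' = (\<lambda>x. V (X (cadjoint W x)))" by (simp add: u2_adj_right[OF W(1)])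
  then show ?thesis using orbit_equivI[OF V(1) u2_cadjoint[OF W(1)], of X] by simp
qed

text \<open>An orbit contains no proper restriction of one of its members: otherwise some unitary \<open>Z\<close>
  of the group maps the initial space onto a proper subspace, and for a unit vector \<open>u\<close> orthogonal
  to the latter the vectors \<open>Z\<^bsup>n\<^esup> u\<close> are orthonormal, with \<open>\<parallel>(Z - 1) Z\<^bsup>n\<^esup> u\<parallel>\<^sup>2 = 2\<close> for all \<open>n\<close>.\<close>

lemma not_orbit_equiv_restr:
  fixes X :: "'a::chilbert_space \<Rightarrow> 'b::chilbert_space"
  assumes X: "pisom X" and G: "initial_on X G" and ne: "G \<noteq> {}"
  shows "\<not> orbit_equiv X (restr X G)"
proof
  assume "orbit_equiv X (restr X G)"
  then obtain V W where VW: "u2_op V" "u2_op W" "restr X G = (\<lambda>x. V (X (W x)))"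
    by (rule orbit_equivE)
  note b = u2_bcl[OF VW(1)] u2_bcl[OF VW(2)] pisom_bcl[OF X]
  define q where "q x = cadjoint X (X x)" for x
  define p where "p x = q x - fproj G x" for x
  have q: "is_proj q" unfolding q_def[abs_def] by (rule pisom_initial[OF X])
  have p: "is_proj p"
    using pisom_initial[OF pisom_restr[OF X G]] restr_initial[OF X G] by (simp add: p_def[abs_def] q_def)
  have qp: "q (p x) = p x" for x
    by (simp add: p_def q_def bcl_diff[OF b(3)] bcl_diff[OF pisom_bcl_adj[OF X]] pisom_adj_eq[OF X] initial_fproj[OF X G])
  define Z where "Z = cadjoint W"
  have Z: "u2_op Z" unfolding Z_def by (rule u2_cadjoint[OF VW(2)])
  have "cadjoint (restr X G) = (\<lambda>y. cadjoint W (cadjoint X (cadjoint V y)))"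
    by (rule cadjoint_eqI) (simp add: VW(3) cadjoint[OF b(1)] cadjoint[OF b(2)] cadjoint[OF b(3)])
  then have "p x = Z (q (W x))" for x
    using restr_initial[OF X G, of x]
    by (simp add: VW(3) p_def q_def Z_def u2_adj_left[OF VW(1)])
  then have pZ: "p (Z x) = Z (q x)" for x by (simp add: Z_def u2_adj_right[OF VW(2)])
  obtain u where u: "u \<in> G" using ne by blast
  have nu: "norm u = 1" by (rule orthonormalD(1)[OF initial_onD(2)[OF G] u])
  have qu: "q u = u" using initial_onD(3)[OF G u] by (simp add: q_def)
  have pu: "p u = 0"
    using fproj_eq_self[OF initial_onD(1,2)[OF G] complex_vector.span_base[OF u]] by (simp add: p_def qu)
  define v where "v n = (Z ^^ n) u" for n :: nat
  have v: "v 0 = u" "v (Suc n) = Z (v n)" for n by (simp_all add: v_def)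
  have qv: "q (v n) = v n" for n
    by (induction n) (simp_all add: v qu, metis pZ qp)
  have v0: "cinner (v (Suc n)) u = 0" for n
  proof -
    have "v (Suc n) = p (v (Suc n))" by (simp add: v pZ qv)
    then have "cinner (v (Suc n)) u = cinner (v (Suc n)) (p u)" using is_projD(3)[OF p] by metis
    then show ?thesis by (simp add: pu)
  qed
  have vmn: "cinner (v (m + k)) (v m) = cinner (v k) u" for m k
    by (induction m) (simp_all add: v u2_cinner[OF Z])
  have nv: "norm (v n) = 1" for n by (induction n) (simp_all add: v nu u2_norm[OF Z])
  have vo: "cinner (v m) (v n) = 0" if "m \<noteq> n" for m n
  proof -
    have *: "cinner (v m) (v n) = 0" if nm: "n < m" for m n
    proof -
      obtain k where "m = n + Suc k" using less_imp_Suc_add[OF nm] by (metis add_Suc_right)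
      then show ?thesis using vmn[of n "Suc k"] v0 by simp
    qed
    show ?thesis using that *[of m n] *[of n m] cinner_eq_0_commute by (metis nat_neq_iff)
  qed
  have inj: "inj v"
  proof (rule injI, rule ccontr)
    fix m n assume "v m = v n" "m \<noteq> n"
    then have "cinner (v m) (v m) = 0" using vo[of m n] by simp
    then show False using nv[of m] by simp
  qed
  have orth: "orthonormal (v ` {..<N})" for N
    by (rule orthonormalI) (use nv in force, use vo in \<open>metis imageE\<close>)
  obtain C where C: "hs_bound (\<lambda>x. Z x - x) C" using hsE[OF u2_hs[OF Z]] by blast
  have "(norm (Z (v n) - v n))\<^sup>2 = 2" for n
    using vo[of "Suc n" n] norm_diff_sq[of "v (Suc n)" "v n"] nv
    by (simp add: v(2) u2_norm[OF Z])
  then have "(\<Sum>x\<in>v ` {..<N}. (norm (Z x - x))\<^sup>2) = 2 * real N" for N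
    by (simp add: sum.reindex inj_on_subset[OF inj])
  then have "2 * real N \<le> C" for N using hs_boundD[OF C _ orth[of N]] by simp
  moreover obtain N where "C < real N" using reals_Archimedean2 by blast
  ultimately show False by (metis mult_2 not_less le_add_same_cancel1 of_nat_0_le_iff order_trans)
qed

text \<open>The relative index of \<open>X\<close> with respect to \<open>U\<close>: up to orbit equivalence the two have a common
  restriction, of corank \<open>card G\<close> in \<open>U\<close> and of corank \<open>card H\<close> in \<open>X\<close>.\<close>

definition rel_index :: "('a::chilbert_space \<Rightarrow> 'b::chilbert_space) \<Rightarrow> ('a \<Rightarrow> 'b) \<Rightarrow> int \<Rightarrow> bool" where
  "rel_index U X k \<longleftrightarrow> (\<exists>X' G H. orbit_equiv X X' \<and> initial_on U G \<and> initial_on X' H \<and>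
     restr U G = restr X' H \<and> k = int (card G) - int (card H))"

text \<open>Removing the span of \<open>G1 \<union> G2\<close> from \<open>U\<close> restricts both given restrictions further, and the
  coranks in \<open>X1\<close> and \<open>X2\<close> grow by the number of vectors added to \<open>G1\<close> and \<open>G2\<close>.\<close>

lemma common_restriction:
  fixes U X1 X2 :: "'a::chilbert_space \<Rightarrow> 'b::chilbert_space"
  assumes U: "pisom U" and X1: "pisom X1" and X2: "pisom X2"
    and G: "initial_on U G1" "initial_on U G2" and H: "initial_on X1 H1" "initial_on X2 H2"
    and eq: "restr U G1 = restr X1 H1" "restr U G2 = restr X2 H2"
  shows "\<exists>K1 K2. initial_on X1 K1 \<and> initial_on X2 K2 \<and> restr X1 K1 = restr X2 K2 \<and>
    card K1 + card G1 + card H2 = card K2 + card G2 + card H1"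
proof -
  note g1 = initial_onD(1,2)[OF G(1)] and g2 = initial_onD(1,2)[OF G(2)]
  obtain N1 where N1: "finite N1" "orthonormal N1" "G1 \<subseteq> N1" "cspan N1 = cspan (G1 \<union> G2)"
    using orthonormal_extend[OF g2(1) g1] by blast
  obtain N2 where N2: "finite N2" "orthonormal N2" "G2 \<subseteq> N2" "cspan N2 = cspan (G2 \<union> G1)"
    using orthonormal_extend[OF g1(1) g2] by blast
  have sp: "cspan N1 = cspan N2" using N1(4) N2(4) by (simp add: Un_commute)
  have cardN: "card N1 = card N2" using cdim_cspan[OF N1(2,1)] cdim_cspan[OF N2(2,1)] sp by simp
  have bq: "bounded_clinear (\<lambda>x. cadjoint U (U x) - x)"
    by (intro bounded_clinear_intros is_projD(1)[OF pisom_initial[OF U]])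
  have sub: "csubspace {x. cadjoint U (U x) = x}"
    using closed_csubspace_kernel[OF bq] by (simp add: closed_csubspace_def)
  have "cspan (G1 \<union> G2) \<subseteq> {x. cadjoint U (U x) = x}"
    by (rule cspan_subset[OF sub]) (use initial_onD(3)[OF G(1)] initial_onD(3)[OF G(2)] in auto)
  then have N: "cadjoint U (U x) = x" if "x \<in> N1 \<union> N2" for x
    using that N1(4) sp complex_vector.span_base[of x N1] complex_vector.span_base[of x N2] by auto
  have main: "initial_on X (H \<union> (N - G)) \<and> restr X (H \<union> (N - G)) = restr U N \<and>
      card (H \<union> (N - G)) + card G = card H + card N"
    if X: "pisom X" and G: "initial_on U G" and H: "initial_on X H" and eq: "restr U G = restr X H"
      and N: "finite N" "orthonormal N" "G \<subseteq> N" "\<And>x. x \<in> N \<Longrightarrow> cadjoint U (U x) = x" for X G H N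
  proof -
    note oG = initial_onD(1,2)[OF G] and oH = initial_onD(1,2)[OF H]
    have Gd: "cinner d g = 0" if "d \<in> N - G" "g \<in> G" for d g
      using that orthonormalD(2)[OF N(2), of d g] N(3) by blast
    have qd: "cadjoint X (X d) - fproj H d = d" if "d \<in> N - G" for d
    proof -
      have "cadjoint X (X d) - fproj H d = cadjoint U (U d) - fproj G d"
        using restr_initial[OF X H, of d] restr_initial[OF U G, of d] eq by simp
      then show ?thesis using N(4)[of d] that Gd by (simp add: fproj_eq_0)
    qed
    have Hd: "fproj H d = 0" if "d \<in> N - G" for d
    proof -
      have "fproj H d = fproj H (cadjoint X (X d) - fproj H d)" by (simp add: qd[OF that])
      then show ?thesis
        by (simp add: bcl_diff[OF bounded_clinear_fproj] fproj_initial[OF X H] is_projD(2)[OF initial_onD(4)[OF H]])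
    qed
    have Xd: "cadjoint X (X d) = d" if "d \<in> N - G" for d using qd[OF that] Hd[OF that] by simp
    have dh: "cinner d h = 0" if "d \<in> N - G" "h \<in> H" for d h
      using cinner_fproj[OF oH that(2), of d] Hd[OF that(1)] by simp
    have hd: "cinner h d = 0" if "h \<in> H" "d \<in> N - G" for d h
      using dh[OF that(2,1)] by (simp only: cinner_eq_0_commute)
    have oD: "orthonormal (N - G)" "finite (N - G)" using orthonormal_subset[OF N(2)] N(1) by auto
    note u = orthonormal_Un[OF oH(2) oD(1) hd]
    have "initial_on X (H \<union> (N - G))"
      unfolding initial_on_def using u(1) oH(1) oD(2) Xd initial_onD(3)[OF H] by blast
    moreover have "restr X (H \<union> (N - G)) = restr (restr X H) (N - G)"
      by (rule restr_Un[symmetric]) (use oH oD u(2) dh in auto)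
    moreover have "restr (restr U G) (N - G) = restr U (G \<union> (N - G))"
      by (rule restr_Un) (use oG oD Gd in auto)
    moreover have "G \<union> (N - G) = N" using N(3) by blast
    moreover have "card (H \<union> (N - G)) = card H + card (N - G)"
      by (rule card_Un_disjoint) (use oH oD u in auto)
    moreover have "card (N - G) + card G = card N"
      using card_Diff_subset[OF oG(1) N(3)] card_mono[OF N(1,3)] by simp
    ultimately show ?thesis using eq by simp
  qed
  have "restr U N1 = restr U N2"
    unfolding restr_def fproj_eq_proj[OF N1(1,2)] fproj_eq_proj[OF N2(1,2)] sp ..
  then show ?thesis
    using main[OF X1 G(1) H(1) eq(1) N1(1,2,3)] main[OF X2 G(2) H(2) eq(2) N2(1,2,3)] N cardN
    by (intro exI[of _ "H1 \<union> (N1 - G1)"] exI[of _ "H2 \<union> (N2 - G2)"]) simp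
qed

lemma rel_index_orbit_equiv:
  fixes U X Z :: "'a::chilbert_space \<Rightarrow> 'b::chilbert_space"
  assumes U: "pisom U" and X: "pisom X" and Z: "pisom Z"
    and k: "rel_index U X k" "rel_index U Z k"
  shows "orbit_equiv X Z"
proof -
  obtain X1 G1 H1 where 1: "orbit_equiv X X1" "initial_on U G1" "initial_on X1 H1"
    "restr U G1 = restr X1 H1" "k = int (card G1) - int (card H1)"
    using k(1) unfolding rel_index_def by (elim exE conjE)
  obtain X2 G2 H2 where 2: "orbit_equiv Z X2" "initial_on U G2" "initial_on X2 H2"
    "restr U G2 = restr X2 H2" "k = int (card G2) - int (card H2)"
    using k(2) unfolding rel_index_def by (elim exE conjE)
  note p1 = orbit_equiv_pisom(1)[OF X 1(1)] and p2 = orbit_equiv_pisom(1)[OF Z 2(1)]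
  obtain K1 K2 where K: "initial_on X1 K1" "initial_on X2 K2" "restr X1 K1 = restr X2 K2"
    "card K1 + card G1 + card H2 = card K2 + card G2 + card H1"
    using common_restriction[OF U p1 p2 1(2) 2(2) 1(3) 2(3) 1(4) 2(4)] by (elim exE conjE)
  have "card K1 = card K2" using K(4) 1(5) 2(5) by linarith
  then have "orbit_equiv X1 X2" by (rule orbit_equiv_same_rank[OF p1 p2 K(1-3)])
  then show ?thesis using 1(1) 2(1) orbit_equiv_trans orbit_equiv_sym by metis
qed

text \<open>If \<open>X2\<close> had the larger corank, a proper restriction of it would extend the common restriction by
  the same rank as \<open>X1\<close>, and would thus lie in the orbit of \<open>X2\<close>.\<close>

lemma orbit_equiv_rank_le:
  fixes X1 X2 :: "'a::chilbert_space \<Rightarrow> 'b::chilbert_space"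
  assumes p1: "pisom X1" and p2: "pisom X2" and K: "initial_on X1 K1" "initial_on X2 K2"
    and eq: "restr X1 K1 = restr X2 K2" and e: "orbit_equiv X1 X2"
  shows "card K2 \<le> card K1"
proof (rule ccontr)
  assume "\<not> card K2 \<le> card K1"
  then have lt: "card K1 < card K2" by simp
  then obtain J where J: "J \<subseteq> K2" "card J = card K1" "finite J"
    using obtain_subset_with_card_n[of "card K1" K2] by auto
  define L where "L = K2 - J"
  have L: "initial_on X2 L" using initial_on_subset[OF K(2)] by (auto simp: L_def)
  note p3 = pisom_restr[OF p2 L]
  have o: "cinner d g = 0" if "d \<in> J" "g \<in> L" for d g
    using that J(1) orthonormalD(2)[OF initial_onD(2)[OF K(2)], of d g] by (auto simp: L_def)
  have iJ: "initial_on (restr X2 L) J"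
    unfolding initial_on_def
  proof (intro conjI ballI)
    show "finite J" by fact
    show "orthonormal J" by (rule orthonormal_subset[OF initial_onD(2)[OF K(2)] J(1)])
    fix g assume g: "g \<in> J"
    have "cadjoint X2 (X2 g) = g" using initial_onD(3)[OF K(2)] g J(1) by blast
    then show "cadjoint (restr X2 L) (restr X2 L g) = g"
      using o[OF g] by (simp add: restr_initial[OF p2 L] fproj_eq_0)
  qed
  have "restr (restr X2 L) J = restr X2 (L \<union> J)"
    by (rule restr_Un) (use initial_onD(1)[OF L] J o in \<open>auto simp: L_def\<close>)
  also have "L \<union> J = K2" using J(1) by (auto simp: L_def)
  finally have "restr X1 K1 = restr (restr X2 L) J" by (simp add: eq)
  then have "orbit_equiv X1 (restr X2 L)"
    using orbit_equiv_same_rank[OF p1 p3 K(1) iJ] J(2) by simp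
  then have "orbit_equiv X2 (restr X2 L)" using e orbit_equiv_trans orbit_equiv_sym by metis
  moreover have "L \<noteq> {}" using lt J by (auto simp: L_def)
  ultimately show False using not_orbit_equiv_restr[OF p2 L] by blast
qed

lemma rel_index_unique:
  fixes U X :: "'a::chilbert_space \<Rightarrow> 'b::chilbert_space"
  assumes U: "pisom U" and X: "pisom X" and k: "rel_index U X k" "rel_index U X l"
  shows "k = l"
proof -
  obtain X1 G1 H1 where 1: "orbit_equiv X X1" "initial_on U G1" "initial_on X1 H1"
    "restr U G1 = restr X1 H1" "k = int (card G1) - int (card H1)"
    using k(1) unfolding rel_index_def by (elim exE conjE)
  obtain X2 G2 H2 where 2: "orbit_equiv X X2" "initial_on U G2" "initial_on X2 H2"
    "restr U G2 = restr X2 H2" "l = int (card G2) - int (card H2)"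
    using k(2) unfolding rel_index_def by (elim exE conjE)
  note p1 = orbit_equiv_pisom(1)[OF X 1(1)] and p2 = orbit_equiv_pisom(1)[OF X 2(1)]
  obtain K1 K2 where K: "initial_on X1 K1" "initial_on X2 K2" "restr X1 K1 = restr X2 K2"
    "card K1 + card G1 + card H2 = card K2 + card G2 + card H1"
    using common_restriction[OF U p1 p2 1(2) 2(2) 1(3) 2(3) 1(4) 2(4)] by (elim exE conjE)
  have e: "orbit_equiv X1 X2" "orbit_equiv X2 X1"
    using 1(1) 2(1) orbit_equiv_trans orbit_equiv_sym by metis+
  have "card K1 = card K2"
    using orbit_equiv_rank_le[OF p1 p2 K(1,2,3) e(1)] orbit_equiv_rank_le[OF p2 p1 K(2,1) K(3)[symmetric] e(2)]
    by simp
  then show ?thesis using K(4) 1(5) 2(5) by linarith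
qed

lemma rel_index_invariant: "rel_index U X k \<Longrightarrow> orbit_equiv X Z \<Longrightarrow> rel_index U Z k"
  unfolding rel_index_def using orbit_equiv_trans orbit_equiv_sym by metis

lemma rel_index_cadjoint:
  fixes U X :: "'a::chilbert_space \<Rightarrow> 'b::chilbert_space"
  assumes U: "pisom U" and X: "pisom X" and k: "rel_index U X k"
  shows "rel_index (cadjoint U) (cadjoint X) k"
proof -
  obtain X1 G H where 1: "orbit_equiv X X1" "initial_on U G" "initial_on X1 H"
    "restr U G = restr X1 H" "k = int (card G) - int (card H)"
    using k unfolding rel_index_def by (elim exE conjE)
  note p1 = orbit_equiv_pisom(1)[OF X 1(1)]
  show ?thesis
    unfolding rel_index_def
  proof (intro exI conjI)
    show "orbit_equiv (cadjoint X) (cadjoint X1)" by (rule orbit_equiv_cadjoint[OF pisom_bcl[OF X] 1(1)])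
    show "initial_on (cadjoint U) (U ` G)" by (rule initial_on_cadjoint[OF U 1(2)])
    show "initial_on (cadjoint X1) (X1 ` H)" by (rule initial_on_cadjoint[OF p1 1(3)])
    show "restr (cadjoint U) (U ` G) = restr (cadjoint X1) (X1 ` H)"
      by (simp add: restr_cadjoint[OF U 1(2)] restr_cadjoint[OF p1 1(3)] 1(4))
    show "k = int (card (U ` G)) - int (card (X1 ` H))"
      by (simp add: 1(5) card_image initial_inj[OF U 1(2)] initial_inj[OF p1 1(3)])
  qed
qed

text \<open>The unitaries of \<open>orbit_equiv_restr\<close> carry \<open>X\<close> to an extension of the restriction of \<open>U\<close>.\<close>

lemma rel_index_intersections:
  fixes U X :: "'a::chilbert_space \<Rightarrow> 'b::chilbert_space"
  assumes U: "pisom U" and X: "pisom X" and hs: "hilbert_schmidt (\<lambda>x. X x - U x)"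
    and E: "finite E" "orthonormal E" "cspan E = {x. cadjoint U (U x) = x \<and> X x = 0}"
    and E': "finite E'" "orthonormal E'" "cspan E' = {x. cadjoint X (X x) = x \<and> U x = 0}"
  shows "rel_index U X (int (card E) - int (card E'))"
proof -
  have iE: "initial_on U E" and iE': "initial_on X E'"
    using E E' complex_vector.span_superset[of E] complex_vector.span_superset[of E']
    by (auto simp: initial_on_def)
  obtain V W where VW: "u2_op V" "u2_op W" "restr X E' = (\<lambda>x. V (restr U E (W x)))"
    using orbit_equivE[OF orbit_equiv_restr[OF X U hs E E']] by blast
  note aV = u2_cadjoint[OF VW(1)] and aW = u2_cadjoint[OF VW(2)]
  define X' where "X' = (\<lambda>x. cadjoint V (X (cadjoint W x)))"
  have e: "orbit_equiv X X'" unfolding X'_def by (rule orbit_equivI[OF aV aW])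
  have bXV: "bounded_clinear (\<lambda>x. cadjoint V (X x))" by (rule bounded_clinear_comp[OF u2_bcl[OF aV] pisom_bcl[OF X]])
  have X'adj: "cadjoint X' = (\<lambda>y. W (cadjoint X (V y)))"
    unfolding X'_def
    by (simp add: cadjoint_comp[OF bXV u2_bcl[OF aW]] cadjoint_comp[OF u2_bcl[OF aV] pisom_bcl[OF X]]
        cadjoint_cadjoint[OF u2_bcl[OF VW(1)]] cadjoint_cadjoint[OF u2_bcl[OF VW(2)]])
  have inj: "inj_on W E'" by (rule inj_on_inverseI[of _ "cadjoint W"]) (rule u2_adj_left[OF VW(2)])
  have "orthonormal (W ` E')"
  proof (rule orthonormalI)
    fix y assume "y \<in> W ` E'"
    then show "norm y = 1" using orthonormalD(1)[OF E'(2)] u2_norm[OF VW(2)] by auto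
  next
    fix y z assume "y \<in> W ` E'" "z \<in> W ` E'" and ne: "y \<noteq> z"
    then obtain g h where g: "g \<in> E'" "y = W g" "h \<in> E'" "z = W h" by blast
    with ne have "g \<noteq> h" by blast
    then show "cinner y z = 0"
      using orthonormalD(2)[OF E'(2) g(1,3)] by (simp add: g u2_cinner[OF VW(2)])
  qed
  then have iH: "initial_on X' (W ` E')"
    unfolding initial_on_def using E'(1) initial_onD(3)[OF iE']
    by (simp add: X'adj) (simp add: X'_def u2_adj_left[OF VW(2)] u2_adj_right[OF VW(1)])
  have "restr X' (W ` E') x = restr U E x" for x
  proof -
    have "cadjoint W (fproj (W ` E') x) = fproj E' (cadjoint W x)"
      unfolding fproj_image[OF inj] bcl_sum[OF u2_bcl[OF aW]] unfolding fproj_def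
      by (rule sum.cong) (simp_all add: bcl_scaleC[OF u2_bcl[OF aW]] u2_adj_left[OF VW(2)] cadjoint'[OF u2_bcl[OF VW(2)]])
    then have "restr X' (W ` E') x = cadjoint V (restr X E' (cadjoint W x))"
      by (simp add: restr_def X'_def bcl_diff[OF u2_bcl[OF aW]])
    also have "\<dots> = restr U E x"
      by (simp add: VW(3) u2_adj_left[OF VW(1)] u2_adj_right[OF VW(2)])
    finally show ?thesis .
  qed
  then have "restr U E = restr X' (W ` E')" by (simp add: fun_eq_iff)
  moreover have "card (W ` E') = card E'" by (rule card_image[OF inj])
  ultimately show ?thesis
    unfolding rel_index_def using e iE iH
    by (intro exI[of _ X'] exI[of _ E] exI[of _ "W ` E'"]) simp
qed

section \<open>Paths in the unitary group\<close>

text \<open>If \<open>1 + W\<close> is injective, it is invertible, and \<open>K = (1 - W) (1 + W)\<^bsup>-1\<^esup>\<close> is skew-adjoint and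
  Hilbert-Schmidt. The Cayley transforms \<open>(1 - t K) (1 + t K)\<^bsup>-1\<^esup> = 2 (1 + t K)\<^bsup>-1\<^esup> - 1\<close> form a
  Lipschitz path from the identity to \<open>W\<close>.\<close>

lemma cayley_path:
  fixes W :: "'a::chilbert_space \<Rightarrow> 'a"
  assumes W: "u2_op W" and inj: "\<And>x. x + W x = 0 \<Longrightarrow> x = 0"
  shows "\<exists>\<gamma> C. \<gamma> (0::real) = (\<lambda>x. x) \<and> \<gamma> 1 = W \<and> (\<forall>t. u2_op (\<gamma> t)) \<and>
    (\<forall>s t. hs_bound (\<lambda>x. \<gamma> t x - \<gamma> s x) ((2 * \<bar>t - s\<bar>)\<^sup>2 * C))"
proof -
  note bW = u2_bcl[OF W]
  define Z where "Z x = x + W x" for x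
  have bZ: "bounded_clinear Z" unfolding Z_def[abs_def] by (intro bounded_clinear_intros bW)
  have injZ: "x = 0" if "Z x = 0" for x using inj[of x] that unfolding Z_def by simp
  have "\<exists>c>0. \<forall>x. c * norm x \<le> norm (Z x)"
  proof (rule injective_bounded_below[OF bZ u2_hs[OF W] zero_less_numeral[of "num.Bit0 num.One"] _ injZ])
    fix x
    have "Z x = 2 *\<^sub>R x + (W x - x)" by (simp add: Z_def scaleR_2)
    then show "2 * norm x - norm (W x - x) \<le> norm (Z x)"
      using norm_diff_ineq[of "2 *\<^sub>R x" "W x - x"] by simp
  qed
  then obtain c where c: "c > 0" "\<And>x. c * norm x \<le> norm (Z x)" by blast
  have "surj Z"
  proof (rule surj_if_bounded_below[OF bZ c])
    fix x assume x: "cadjoint Z x = 0"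
    have "cadjoint Z = (\<lambda>x. x + cadjoint W x)"
      by (rule cadjoint_eqI) (simp add: Z_def cinner_simps cadjoint[OF bW])
    then have "W (x + cadjoint W x) = 0" using x by (simp add: bcl_zero[OF bW])
    then show "x = 0" using injZ[of x] by (simp add: Z_def bcl_add[OF bW] u2_adj_right[OF W] add.commute)
  qed
  note Zi = bounded_clinear_inverse[OF bZ c this]
  define K where "K x = finv Z x - W (finv Z x)" for x
  have hK: "hilbert_schmidt K"
    using hs_minus[OF hs_comp_right[OF u2_hs[OF W] Zi(1)]] by (simp add: K_def[abs_def])
  note bK = hs_bcl[OF hK]
  have KZ: "K (Z y) = y - W y" for y by (simp add: K_def Zi(3))
  have skew: "Re (cinner (K x) x) = 0" for x
  proof -
    have "Re (cinner (y - W y) (y + W y)) = 0" for y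
      using norm_sq_cinner[of y] norm_sq_cinner[of "W y"] u2_norm[OF W, of y] Re_cinner_commute[of y "W y"]
      by (simp add: cinner_simps)
    then show ?thesis using KZ[of "finv Z x"] by (metis Z_def Zi(2))
  qed
  define N where "N t x = x + complex_of_real t *\<^sub>C K x" for t x
  have bN: "bounded_clinear (N t)" for t unfolding N_def[abs_def] by (intro bounded_clinear_intros bK)
  have skew': "Re (cinner x (complex_of_real t *\<^sub>C K x)) = 0" for t x
    using skew[of x] Re_cinner_commute[of x "K x"] by (simp add: cinner_scaleC_right)
  have nN: "(norm (N t x))\<^sup>2 = (norm x)\<^sup>2 + (norm (complex_of_real t *\<^sub>C K x))\<^sup>2" for t x
    unfolding N_def norm_add_sq skew' by simp
  have N1: "1 * norm x \<le> norm (N t x)" for t x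
    by (rule power2_le_imp_le) (simp_all add: nN)
  have sN: "surj (N t)" for t
  proof (rule surj_if_bounded_below[OF bN zero_less_one N1])
    fix y assume "cadjoint (N t) y = 0"
    then have "cinner y (N t y) = 0" using cadjoint'[OF bN, of t y y] by simp
    then have "cinner y y + cinner y (complex_of_real t *\<^sub>C K y) = 0"
      by (simp only: N_def cinner_add_right)
    then have "Re (cinner y y) + Re (cinner y (complex_of_real t *\<^sub>C K y)) = 0"
      by (metis plus_complex.sel(1) zero_complex.sel(1))
    then have "(norm y)\<^sup>2 = 0" unfolding skew' norm_sq_cinner by simp
    then show "y = 0" by simp
  qed
  note R = bounded_clinear_inverse[OF bN zero_less_one N1 sN]
  define \<gamma> where "\<gamma> t x = finv (N t) x + finv (N t) x - x" for t x
  have b\<gamma>: "bounded_clinear (\<gamma> t)" for t unfolding \<gamma>_def[abs_def] by (intro bounded_clinear_intros R(1))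
  have \<gamma>N: "\<gamma> t (N t x) = N (- t) x" for t x by (simp add: \<gamma>_def R(3)) (simp add: N_def)
  obtain C where C: "hs_bound K C" using hsE[OF hK] by blast
  have diff: "hs_bound (\<lambda>x. \<gamma> t x - \<gamma> s x) ((2 * \<bar>t - s\<bar>)\<^sup>2 * C)" for s t
  proof (rule hs_bound_dominated[of "\<lambda>x. K (finv (N s) x)"])
    show "hs_bound (\<lambda>x. K (finv (N s) x)) C"
      using hs_bound_comp_right[OF bK C R(1)[of s], of 1] R(4)[of s] by simp
    fix x
    define y where "y = finv (N s) x"
    have "N t y - N s y = complex_of_real (t - s) *\<^sub>C K y"
      by (simp add: N_def complex_vector.scale_left_diff_distrib)
    then have "finv (N t) (N t y - N s y) = complex_of_real (t - s) *\<^sub>C finv (N t) (K y)"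
      by (simp only: bcl_scaleC[OF R(1)])
    then have "y - finv (N t) x = complex_of_real (t - s) *\<^sub>C finv (N t) (K y)"
      by (simp add: bcl_diff[OF R(1)] R(3)) (simp add: y_def R(2))
    then have "norm (y - finv (N t) x) \<le> \<bar>t - s\<bar> * norm (K y)"
      using R(4)[of t "K y"] by (simp add: norm_scaleC mult_left_mono del: of_real_diff)
    moreover have "\<gamma> t x - \<gamma> s x = - (2 *\<^sub>R (y - finv (N t) x))"
      by (simp add: \<gamma>_def y_def scaleR_2)
    then have "norm (\<gamma> t x - \<gamma> s x) = 2 * norm (y - finv (N t) x)" by (simp only: norm_minus_cancel) simp
    ultimately show "norm (\<gamma> t x - \<gamma> s x) \<le> 2 * \<bar>t - s\<bar> * norm (K (finv (N s) x))"
      by (simp add: y_def)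
  qed
  have N0: "N 0 x = x" for x by (simp add: N_def)
  have \<gamma>0: "\<gamma> 0 = (\<lambda>x. x)" using \<gamma>N[of 0] by (simp add: N0 fun_eq_iff)
  have \<gamma>1: "\<gamma> 1 = W"
  proof
    fix y
    have "N 1 (Z y) = y + y" by (simp add: N_def KZ) (simp add: Z_def)
    then have "finv (N 1) (y + y) = Z y" using R(3)[of 1 "Z y"] by simp
    then show "\<gamma> 1 y = W y" by (simp add: \<gamma>_def bcl_add[OF R(1)] Z_def)
  qed
  have "u2_op (\<gamma> t)" for t
  proof -
    have nN': "norm (N (- t) x) = norm (N t x)" for x
      by (rule power2_eq_imp_eq) (simp_all add: nN norm_scaleC)
    have "norm (\<gamma> t x) = norm x" for x
      using \<gamma>N[of t "finv (N t) x"] nN'[of "finv (N t) x"] by (simp add: R(2))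
    moreover have "surj (\<gamma> t)" unfolding surj_def using \<gamma>N sN[of "- t"] by (metis surjD)
    ultimately have "unitary_op (\<gamma> t)" by (rule unitary_op_isometry_surj[OF b\<gamma>])
    moreover have "hilbert_schmidt (\<lambda>x. \<gamma> t x - x)"
    proof (rule hsI)
      show "bounded_clinear (\<lambda>x. \<gamma> t x - x)" by (intro bounded_clinear_intros b\<gamma>)
      show "hs_bound (\<lambda>x. \<gamma> t x - x) ((2 * \<bar>t - 0\<bar>)\<^sup>2 * C)" using diff[of t 0] by (simp add: \<gamma>0)
    qed
    ultimately show ?thesis by (simp add: u2_op_def)
  qed
  then show ?thesis using \<gamma>0 \<gamma>1 diff by (intro exI[of _ \<gamma>] exI[of _ C]) blast
qed

text \<open>The eigenvalue \<open>-1\<close> has finite multiplicity. On its eigenspace multiplication by \<open>-1\<close> is the square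
  of multiplication by \<open>\<i>\<close>, so that \<open>W\<close> becomes a product of three unitaries without this eigenvalue.\<close>

lemma u2_factorization:
  fixes W :: "'a::chilbert_space \<Rightarrow> 'a"
  assumes W: "u2_op W"
  obtains W1 W2 where "u2_op W1" "u2_op W2" "\<And>x. x + W1 x = 0 \<Longrightarrow> x = 0" "\<And>x. x + W2 x = 0 \<Longrightarrow> x = 0"
    "W = (\<lambda>x. W1 (W2 (W2 x)))"
proof -
  note bW = u2_bcl[OF W]
  have bZ: "bounded_clinear (\<lambda>x. x + W x)" by (intro bounded_clinear_intros bW)
  have "\<exists>E. finite E \<and> orthonormal E \<and> cspan E = UNIV \<inter> {x. x + W x = 0}"
  proof (rule semi_fredholm_kernel[OF bZ u2_hs[OF W] closed_csubspace_UNIV zero_less_numeral[of "num.Bit0 num.One"]])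
    fix x
    have e: "2 *\<^sub>R x + (W x - x) = x + W x" by (simp add: scaleR_2)
    show "2 * norm x - norm (W x - x) \<le> norm (x + W x)"
      using norm_diff_ineq[of "2 *\<^sub>R x" "W x - x"] unfolding e by simp
  qed
  then obtain E where E: "finite E" "orthonormal E" "\<And>x. x \<in> cspan E \<longleftrightarrow> x + W x = 0" by auto
  define p where "p = fproj E"
  have p: "is_proj p" unfolding p_def by (rule is_proj_fproj[OF E(1,2)])
  note bp = is_projD(1)[OF p]
  have Wp: "W (p x) = - p x" for x
    using E(3)[of "p x"] fproj_in_cspan[of E x] by (simp add: p_def eq_neg_iff_add_eq_0 add.commute)
  have rp: "u2_op (\<lambda>x. x - p x - p x)" unfolding p_def by (rule u2_reflection[OF E(1,2)])
  define W1 where "W1 x = W (x - p x - p x)" for x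
  define W2 where "W2 x = x + (\<i> - 1) *\<^sub>C p x" for x
  have u1: "u2_op W1" unfolding W1_def[abs_def] by (rule u2_comp[OF W rp])
  have bW2: "bounded_clinear W2" unfolding W2_def[abs_def] by (intro bounded_clinear_intros bp)
  have pW2: "p (x + a *\<^sub>C p x) = (1 + a) *\<^sub>C p x" for x a
    by (simp add: bcl_add[OF bp] bcl_scaleC[OF bp] is_projD(2)[OF p] scaleC_add_left)
  have mult: "x + a *\<^sub>C p x + b *\<^sub>C p (x + a *\<^sub>C p x) = x + (a + b + a * b) *\<^sub>C p x" for a b x
    unfolding pW2 by (simp add: scaleC_add_left scaleC_scaleC algebra_simps)
  have u2: "u2_op W2"
    unfolding u2_op_def
  proof
    show "unitary_op W2"
    proof (rule unitary_opI(1)[of _ "\<lambda>x. x + (- \<i> - 1) *\<^sub>C p x"])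
      show "bounded_clinear W2" by (rule bW2)
      show "cinner (W2 x) y = cinner x (y + (- \<i> - 1) *\<^sub>C p y)" for x y
        by (simp add: W2_def cinner_simps is_projD(3)[OF p] algebra_simps)
      show "W2 (x + (- \<i> - 1) *\<^sub>C p x) = x" for x
        unfolding W2_def mult by (simp add: algebra_simps)
      show "W2 x + (- \<i> - 1) *\<^sub>C p (W2 x) = x" for x
        unfolding W2_def mult by (simp add: algebra_simps)
    qed
    show "hilbert_schmidt (\<lambda>x. W2 x - x)"
      by (simp add: W2_def p_def hs_scaleC[OF hs_fproj])
  qed
  have i2: "x = 0" if "x + W2 x = 0" for x
  proof -
    have "p x + (1 + (\<i> - 1)) *\<^sub>C p x = p (x + W2 x)" by (simp only: W2_def pW2 bcl_add[OF bp, of x])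
    then have "(1 + \<i>) *\<^sub>C p x = 0" using that by (simp add: bcl_zero[OF bp] scaleC_add_left)
    then have px: "p x = 0" by (simp add: complex_eq_iff)
    then have "2 *\<^sub>R x = 0" using that by (simp add: W2_def scaleR_2)
    then show ?thesis by simp
  qed
  have i1: "x = 0" if "x + W1 x = 0" for x
  proof -
    define m where "m = x - p x"
    have pm: "p m = 0" by (simp add: m_def bcl_diff[OF bp] is_projD(2)[OF p])
    have mn: "cinner m (p x) = 0" using is_projD(3)[OF p, of m x] by (simp add: pm)
    have "W1 x = W m + p x" by (simp add: W1_def m_def bcl_diff[OF bW] Wp)
    then have sum: "m + W m + p x + p x = 0" using that by (simp add: m_def algebra_simps)
    have "cinner (W m) (p x) = - cinner (W m) (W (p x))" by (simp add: Wp)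
    also have "\<dots> = 0" by (simp add: u2_cinner[OF W] mn)
    finally have "cinner (m + W m + p x + p x) (p x) = cinner (p x) (p x) + cinner (p x) (p x)"
      by (simp add: cinner_add_left mn)
    then have px: "p x = 0" using sum by (simp flip: mult_2)
    then have "m + W m = 0" using sum by simp
    then have "p m = m" using E(3) fproj_eq_self[OF E(1,2)] by (simp add: p_def)
    then show "x = 0" using pm px by (simp add: m_def)
  qed
  have "W x = W1 (W2 (W2 x))" for x
  proof -
    have "W2 (W2 x) = x + (- 2) *\<^sub>C p x" unfolding W2_def mult by (simp add: algebra_simps)
    also have "\<dots> = x - p x - p x" using scaleC_of_real[of "- 2" "p x"] by (simp add: scaleR_2 scaleC_add_left)
    finally have "W2 (W2 x) = x - p x - p x" .
    then show ?thesis by (simp add: W1_def bcl_diff[OF bp] is_projD(2)[OF p])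
  qed
  then show ?thesis using that[OF u1 u2 i1 i2] by blast
qed

section \<open>Frames and their synthesis operators\<close>

lemma cinner_ell2_basis: "cinner y (ell2_basis i) = ell2_coord y i"
proof transfer
  fix y :: "nat \<Rightarrow> complex" and i
  have "(\<Sum>j. y j * cnj (if i = j then 1 else 0)) = (\<Sum>j\<in>{i}. y j * cnj (if i = j then 1 else 0))"
    by (rule suminf_finite) auto
  then show "(\<Sum>j. y j * cnj (if i = j then 1 else 0)) = y i" by simp
qed

lemma cinner_ell2_basis_basis: "cinner (ell2_basis i) (ell2_basis j) = (if i = j then 1 else 0)"
  by (simp add: cinner_ell2_basis ell2_basis.rep_eq)

lemma inj_ell2_basis: "inj ell2_basis"
proof (rule injI, rule ccontr)
  fix i j assume "ell2_basis i = ell2_basis j" "i \<noteq> j"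
  then show False using cinner_ell2_basis_basis[of i i] cinner_ell2_basis_basis[of i j] by simp
qed

lemma orthonormal_ell2_basis: "orthonormal (ell2_basis ` A)"
proof (rule orthonormalI)
  fix x assume "x \<in> ell2_basis ` A"
  then obtain i where "x = ell2_basis i" by blast
  then have "(norm x)\<^sup>2 = 1" by (simp add: norm_sq_cinner cinner_ell2_basis_basis)
  then show "norm x = 1" by (simp add: power2_eq_1_iff) (metis abs_norm_cancel abs_neg_one norm_ge_zero)
next
  fix x y assume "x \<in> ell2_basis ` A" "y \<in> ell2_basis ` A" "x \<noteq> y"
  then obtain i j where "x = ell2_basis i" "y = ell2_basis j" "i \<noteq> j" by blast
  then show "cinner x y = 0" by (simp add: cinner_ell2_basis_basis)
qed

lemma norm_ell2_sq:
  "summable (\<lambda>i. (cmod (ell2_coord y i))\<^sup>2)" "(norm y)\<^sup>2 = (\<Sum>i. (cmod (ell2_coord y i))\<^sup>2)"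
proof -
  show 1: "summable (\<lambda>i. (cmod (ell2_coord y i))\<^sup>2)" using ell2_coord[of y] by simp
  show "(norm y)\<^sup>2 = (\<Sum>i. (cmod (ell2_coord y i))\<^sup>2)"
    unfolding norm_ell2.rep_eq by (intro real_sqrt_pow2 suminf_nonneg 1) simp
qed

lemma orthonormal_basis_ell2: "orthonormal_basis (range ell2_basis)"
proof -
  have "y \<in> closure (cspan (range ell2_basis))" for y
    unfolding closure_approachable
  proof (intro allI impI)
    fix e :: real assume e: "e > 0"
    have "(\<lambda>n. \<Sum>i<n. (cmod (ell2_coord y i))\<^sup>2) \<longlonglongrightarrow> (norm y)\<^sup>2"
      unfolding norm_ell2_sq(2) by (rule summable_LIMSEQ[OF norm_ell2_sq(1)])
    moreover have "(norm y)\<^sup>2 - e\<^sup>2 < (norm y)\<^sup>2" using e by simp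
    ultimately have "\<forall>\<^sub>F n in sequentially. (norm y)\<^sup>2 - e\<^sup>2 < (\<Sum>i<n. (cmod (ell2_coord y i))\<^sup>2)"
      by (rule order_tendstoD(1))
    then obtain n where n: "(norm y)\<^sup>2 - e\<^sup>2 < (\<Sum>i<n. (cmod (ell2_coord y i))\<^sup>2)"
      by (auto simp: eventually_sequentially)
    define F where "F = ell2_basis ` {..<n}"
    have F: "finite F" "orthonormal F" by (simp_all add: F_def orthonormal_ell2_basis)
    have "(\<Sum>f\<in>F. (cmod (cinner y f))\<^sup>2) = (\<Sum>i<n. (cmod (ell2_coord y i))\<^sup>2)"
      unfolding F_def by (simp add: sum.reindex inj_on_subset[OF inj_ell2_basis] cinner_ell2_basis)
    then have "(norm (y - fproj F y))\<^sup>2 < e\<^sup>2" using fproj_pythagoras[OF F, of y] n by simp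
    then have "norm (y - fproj F y) < e" using e by (simp add: power2_less_imp_less)
    moreover have "fproj F y \<in> cspan (range ell2_basis)"
      using fproj_in_cspan[of F y] complex_vector.span_mono[of F "range ell2_basis"] by (auto simp: F_def)
    ultimately show "\<exists>x\<in>cspan (range ell2_basis). dist x y < e"
      by (auto simp: dist_norm norm_minus_commute)
  qed
  then show ?thesis
    using orthonormalD[OF orthonormal_ell2_basis[of UNIV]] unfolding orthonormal_basis_def by blast
qed

definition col :: "(ell2 \<Rightarrow> 'h::chilbert_space) \<Rightarrow> nat \<Rightarrow> 'h" where
  "col X = (\<lambda>i. X (ell2_basis i))"

lemma col_inject:
  fixes S T :: "ell2 \<Rightarrow> 'h::chilbert_space"
  assumes S: "bounded_clinear S" and T: "bounded_clinear T" and eq: "col S = col T"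
  shows "S = T"
proof
  fix y
  have D: "bounded_clinear (\<lambda>x. S x - T x)" by (intro bounded_clinear_intros S T)
  note N = closed_csubspace_kernel[OF D]
  have "range ell2_basis \<subseteq> {x. S x - T x = 0}" using eq by (auto simp: col_def fun_eq_iff)
  then have "cspan (range ell2_basis) \<subseteq> {x. S x - T x = 0}"
    using N by (intro cspan_subset) (simp_all add: closed_csubspace_def)
  then have "closure (cspan (range ell2_basis)) \<subseteq> {x. S x - T x = 0}"
    by (intro closure_minimal closed_csubspaceD(1)[OF N])
  then show "S y = T y" using orthonormal_basis_ell2 by (auto simp: orthonormal_basis_def)
qed

lemma synthesis_col:
  assumes "bounded_clinear X" shows "synthesis (col X) = X"
  unfolding synthesis_def
proof (rule the_equality)
  show "bounded_clinear X \<and> (\<forall>i. X (ell2_basis i) = col X i)" using assms by (simp add: col_def)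
  fix F assume "bounded_clinear F \<and> (\<forall>i. F (ell2_basis i) = col X i)"
  then show "F = X" using col_inject[OF _ assms, of F] by (simp add: col_def fun_eq_iff)
qed

lemma hs_bound_col:
  fixes T :: "ell2 \<Rightarrow> 'h::chilbert_space"
  assumes T: "bounded_clinear T" and s: "summable (\<lambda>i. (norm (T (ell2_basis i)))\<^sup>2)"
  shows "hs_bound T (\<Sum>i. (norm (T (ell2_basis i)))\<^sup>2)"
proof (rule hs_bound_of_basis[OF T orthonormal_basis_ell2])
  fix F assume F: "finite F" "F \<subseteq> range ell2_basis"
  then obtain A where A: "F = ell2_basis ` A" "finite A"
    using finite_subset_image by (metis)
  have "(\<Sum>x\<in>F. (norm (T x))\<^sup>2) = (\<Sum>i\<in>A. (norm (T (ell2_basis i)))\<^sup>2)"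
    unfolding A(1) by (simp add: sum.reindex inj_on_subset[OF inj_ell2_basis])
  also have "\<dots> \<le> (\<Sum>i. (norm (T (ell2_basis i)))\<^sup>2)" by (rule sum_le_suminf[OF s A(2)]) simp
  finally show "(\<Sum>x\<in>F. (norm (T x))\<^sup>2) \<le> (\<Sum>i. (norm (T (ell2_basis i)))\<^sup>2)" .
qed

lemma col_of_hs_bound:
  fixes T :: "ell2 \<Rightarrow> 'h::chilbert_space"
  assumes "hs_bound T C"
  shows "summable (\<lambda>i. (norm (T (ell2_basis i)))\<^sup>2)" "(\<Sum>i. (norm (T (ell2_basis i)))\<^sup>2) \<le> C"
proof -
  have le: "(\<Sum>i<n. (norm (T (ell2_basis i)))\<^sup>2) \<le> C" for n
    using hs_boundD[OF assms _ orthonormal_ell2_basis[of "{..<n}"]]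
    by (simp add: sum.reindex inj_on_subset[OF inj_ell2_basis])
  show "summable (\<lambda>i. (norm (T (ell2_basis i)))\<^sup>2)"
    by (rule summableI_nonneg_bounded[OF _ le]) simp
  then show "(\<Sum>i. (norm (T (ell2_basis i)))\<^sup>2) \<le> C" by (rule suminf_le_const[OF _ le])
qed

lemma hs_iff_col:
  fixes T :: "ell2 \<Rightarrow> 'h::chilbert_space"
  assumes "bounded_clinear T"
  shows "hilbert_schmidt T \<longleftrightarrow> summable (\<lambda>i. (norm (T (ell2_basis i)))\<^sup>2)"
  using hs_bound_col[OF assms] col_of_hs_bound[of T] hsE[of T] hsI[OF assms] by metis

lemma pisom_range:
  assumes X: "pisom X"
  shows "range X = {y. X (cadjoint X y) = y}" "closed_csubspace (range X)"
proof -
  show 1: "range X = {y. X (cadjoint X y) = y}"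
  proof
    show "range X \<subseteq> {y. X (cadjoint X y) = y}" using pisom_eq[OF X] by auto
    show "{y. X (cadjoint X y) = y} \<subseteq> range X" by (metis (mono_tags) mem_Collect_eq rangeI subsetI)
  qed
  have "bounded_clinear (\<lambda>y. X (cadjoint X y) - y)"
    by (intro bounded_clinear_intros is_projD(1)[OF pisom_final[OF X]])
  from closed_csubspace_kernel[OF this] show "closed_csubspace (range X)" by (simp add: 1)
qed

lemma closure_cspan_col:
  assumes X: "pisom X" shows "closure (cspan (range (col X))) = range X"
proof
  have "cspan (range (col X)) \<subseteq> range X"
    using pisom_range(2)[OF X] by (intro cspan_subset) (auto simp: col_def closed_csubspace_def)
  then show "closure (cspan (range (col X))) \<subseteq> range X"
    by (intro closure_minimal closed_csubspaceD(1)[OF pisom_range(2)[OF X]])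
  have "csubspace {y. X y \<in> cspan (range (col X))}"
    by (rule complex_vector.subspaceI)
       (simp_all add: bcl_simps[OF pisom_bcl[OF X]] complex_vector.span_zero complex_vector.span_add complex_vector.span_scale)
  moreover have "range ell2_basis \<subseteq> {y. X y \<in> cspan (range (col X))}"
    by (auto simp: col_def intro: complex_vector.span_base)
  ultimately have "cspan (range ell2_basis) \<subseteq> {y. X y \<in> cspan (range (col X))}" by (rule cspan_subset)
  also have "\<dots> \<subseteq> X -` closure (cspan (range (col X)))" using closure_subset by blast
  finally have "closure (cspan (range ell2_basis)) \<subseteq> X -` closure (cspan (range (col X)))"
    by (rule closure_minimal) (intro closed_vimage closed_closure bcl_continuous[OF pisom_bcl[OF X]])
  then show "range X \<subseteq> closure (cspan (range (col X)))"
    using orthonormal_basis_ell2 by (auto simp: orthonormal_basis_def)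
qed

text \<open>The synthesis operator is obtained as the adjoint of the analysis operator
  \<open>g \<mapsto> (\<langle>g, f\<^sub>i\<rangle>)\<^sub>i\<close>, which the upper frame bound makes bounded.\<close>

lemma synthesis_exists:
  fixes f :: "nat \<Rightarrow> 'h::chilbert_space"
  assumes K: "closed_csubspace K" and f: "range f \<subseteq> K" and b: "frame_bounds K f A B"
  obtains F where "bounded_clinear F" "col F = f" "\<And>g. cadjoint F (proj K g) = cadjoint F g"
    "\<And>x. F x \<in> K"
    "\<And>g. (norm (cadjoint F g))\<^sup>2 = (\<Sum>i. (cmod (cinner (proj K g) (f i)))\<^sup>2)"
proof -
  have pf: "cinner (proj K g) (f i) = cinner g (f i)" for g i
    using proj_eq_self[OF K, of "f i"] f by (simp add: proj_selfadj[OF K] image_subset_iff)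
  define a where "a g = Abs_ell2 (\<lambda>i. cinner g (f i))" for g
  have s: "summable (\<lambda>i. (cmod (cinner g (f i)))\<^sup>2)"
    and u: "(\<Sum>i. (cmod (cinner g (f i)))\<^sup>2) \<le> B * (norm (proj K g))\<^sup>2" for g
    using b proj_in[OF K, of g] by (auto simp: frame_bounds_def pf dest!: bspec[where x = "proj K g"])
  have a: "ell2_coord (a g) i = cinner g (f i)" for g i
    unfolding a_def by (subst Abs_ell2_inverse) (simp_all add: s)
  have na: "(norm (a g))\<^sup>2 = (\<Sum>i. (cmod (cinner g (f i)))\<^sup>2)" for g
    by (simp add: norm_ell2_sq(2) a)
  have eqI: "y = z" if "\<And>i. ell2_coord y i = ell2_coord z i" for y z
    using that by (simp add: ell2_coord_inject[symmetric] fun_eq_iff)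
  have ba: "bounded_clinear a"
  proof (rule bounded_clinearI[where K = "sqrt (max B 0)"])
    fix g h :: 'h and c :: complex
    show "a (g + h) = a g + a h" by (rule eqI) (simp add: a plus_ell2.rep_eq cinner_add_left)
    show "a (c *\<^sub>C g) = c *\<^sub>C a g" by (rule eqI) (simp add: a scaleC_ell2.rep_eq cinner_scaleC_left)
    show "norm (a g) \<le> sqrt (max B 0) * norm g"
    proof (rule power2_le_imp_le)
      have "(norm (a g))\<^sup>2 \<le> B * (norm (proj K g))\<^sup>2" unfolding na by (rule u)
      also have "\<dots> \<le> max B 0 * (norm g)\<^sup>2"
        using proj_norm_le[OF K, of g] by (intro mult_mono power_mono) auto
      finally show "(norm (a g))\<^sup>2 \<le> (sqrt (max B 0) * norm g)\<^sup>2" by (simp add: power_mult_distrib)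
    qed simp
  qed
  define F where "F = cadjoint a"
  have bF: "bounded_clinear F" unfolding F_def by (rule bounded_clinear_cadjoint[OF ba])
  have Fa: "cadjoint F = a" unfolding F_def by (rule cadjoint_cadjoint[OF ba])
  have ap: "a (proj K g) = a g" for g by (rule eqI) (simp add: a pf)
  show ?thesis
  proof (rule that[OF bF])
    have "F (ell2_basis i) = f i" for i
    proof (rule cinner_eqI)
      fix g
      have "cinner (F (ell2_basis i)) g = cnj (cinner (a g) (ell2_basis i))"
        unfolding F_def cadjoint'[OF ba] by (rule cinner_commute)
      then show "cinner (F (ell2_basis i)) g = cinner (f i) g"
        by (simp add: cinner_ell2_basis a) (rule cinner_commute[symmetric])
    qed
    then show "col F = f" by (simp add: col_def)
    show "cadjoint F (proj K g) = cadjoint F g" for g by (simp add: Fa ap)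
    show "F x \<in> K" for x
    proof -
      have "proj K (F x) = F x"
        by (rule cinner_eqI) (simp add: proj_selfadj[OF K] cadjoint[OF bF] Fa ap)
      then show ?thesis using proj_in[OF K] by metis
    qed
    show "(norm (cadjoint F g))\<^sup>2 = (\<Sum>i. (cmod (cinner (proj K g) (f i)))\<^sup>2)" for g
      by (simp add: Fa na pf)
  qed
qed

text \<open>For a Parseval frame \<open>\<parallel>X\<^sup>* g\<parallel>\<close> is the norm of the projection of \<open>g\<close> to \<open>L\<close>, so by polarization
  \<open>X X\<^sup>*\<close> is that projection.\<close>

lemma parseval_frame_pisom:
  assumes "parseval_frame_in L x" shows "\<exists>X. pisom X \<and> x = col X"
proof -
  have L: "closed_csubspace L" "range x \<subseteq> L" and b: "frame_bounds L x 1 1"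
    using assms by (auto simp: parseval_frame_in_def)
  obtain X where X: "bounded_clinear X" "col X = x" "\<And>y. X y \<in> L"
    "\<And>g. (norm (cadjoint X g))\<^sup>2 = (\<Sum>i. (cmod (cinner (proj L g) (x i)))\<^sup>2)"
    using synthesis_exists[OF L b] by metis
  have n: "(norm (cadjoint X g))\<^sup>2 = (norm (proj L g))\<^sup>2" for g
    using b proj_in[OF L(1), of g] by (auto simp: X(4) frame_bounds_def dest!: bspec[where x = "proj L g"])
  have bA: "bounded_clinear (\<lambda>g. X (cadjoint X g) - proj L g)"
    by (intro bounded_clinear_intros bounded_clinear_comp[OF X(1) bounded_clinear_cadjoint[OF X(1)]]
        bounded_clinear_proj[OF L(1)])
  have "X (cadjoint X g) - proj L g = 0" for g
  proof (rule polarization_zero[OF bA])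
    fix g
    have "cinner (proj L g) g = complex_of_real ((norm (proj L g))\<^sup>2)"
      using proj_selfadj[OF L(1), of "proj L g" g] proj_eq_self[OF L(1) proj_in[OF L(1)], of g]
      by (simp add: cinner_self[symmetric] del: of_real_power)
    moreover have "cinner (X (cadjoint X g)) g = complex_of_real ((norm (cadjoint X g))\<^sup>2)"
      by (simp only: cadjoint[OF X(1)] cinner_self)
    ultimately show "cinner (X (cadjoint X g) - proj L g) g = 0"
      by (simp only: cinner_diff_left n) simp
  qed
  then have "X (cadjoint X (X y)) = X y" for y using proj_eq_self[OF L(1) X(3)] by simp
  then show ?thesis using X(1,2) by (auto simp: pisom_def)
qed

lemma pisom_parseval_frame:
  assumes X: "pisom X" shows "parseval_frame_in (range X) (col X)"
proof -
  have "summable (\<lambda>i. (cmod (cinner g (col X i)))\<^sup>2) \<and> (\<Sum>i. (cmod (cinner g (col X i)))\<^sup>2) = (norm g)\<^sup>2"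
    if "g \<in> range X" for g
  proof -
    have c: "cinner g (col X i) = ell2_coord (cadjoint X g) i" for i
      by (simp add: col_def cinner_ell2_basis flip: cadjoint'[OF pisom_bcl[OF X]])
    have "norm (cadjoint X g) = norm g"
      using pisom_norm[OF X, of "cadjoint X g"] that pisom_range(1)[OF X] pisom_adj_eq[OF X, of g] by simp
    then show ?thesis using norm_ell2_sq[of "cadjoint X g"] by (simp add: c)
  qed
  then show ?thesis
    using pisom_range(2)[OF X] by (auto simp: parseval_frame_in_def frame_bounds_def col_def)
qed

lemma parseval_near_iff:
  fixes F :: "ell2 \<Rightarrow> 'h::chilbert_space"
  assumes F: "bounded_clinear F"
  shows "x \<in> parseval_near (col F) \<longleftrightarrow> (\<exists>X. pisom X \<and> hilbert_schmidt (\<lambda>y. X y - F y) \<and> x = col X)"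
proof -
  have *: "hilbert_schmidt (\<lambda>y. X y - F y) \<longleftrightarrow> summable (\<lambda>i. (norm (col X i - col F i))\<^sup>2)"
    if "pisom X" for X
    using hs_iff_col[OF bounded_clinear_diff[OF pisom_bcl[OF that] F]] by (simp add: col_def)
  show ?thesis
    unfolding parseval_near_def mem_Collect_eq
    using parseval_frame_pisom pisom_parseval_frame * by blast
qed

section \<open>The polar part of the synthesis operator\<close>

lemma partial_isometry_pisom:
  fixes U :: "'a::chilbert_space \<Rightarrow> 'b::chilbert_space"
  assumes "partial_isometry U" shows "pisom U" "cadjoint U (U x) = x - proj (op_ker U) x"
proof -
  have U: "bounded_clinear U" and n: "\<And>x. x \<in> ortho_compl (op_ker U) \<Longrightarrow> norm (U x) = norm x"
    using assms by (auto simp: partial_isometry_def)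
  have N: "closed_csubspace (op_ker U)" unfolding op_ker_def by (rule closed_csubspace_kernel[OF U])
  have Up: "U (proj (op_ker U) x) = 0" for x using proj_in[OF N, of x] by (simp add: op_ker_def)
  have bp: "bounded_clinear (proj (op_ker U))" by (rule bounded_clinear_proj[OF N])
  have bA: "bounded_clinear (\<lambda>x. cadjoint U (U x) - (x - proj (op_ker U) x))"
    by (intro bounded_clinear_intros bounded_clinear_comp[OF bounded_clinear_cadjoint[OF U] U] bp)
  have "cadjoint U (U x) - (x - proj (op_ker U) x) = 0" for x
  proof (rule polarization_zero[OF bA])
    fix x
    define y where "y = x - proj (op_ker U) x"
    have "y \<in> ortho_compl (op_ker U)" using proj_orth[OF N] by (simp add: y_def ortho_compl_def)
    then have "norm (U x) = norm y" using n[of y] by (simp add: y_def bcl_diff[OF U] Up)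
    moreover have "cinner y x = cinner y y"
      using proj_orth[OF N proj_in[OF N, of x], of x] by (simp add: y_def cinner_diff_right)
    ultimately show "cinner (cadjoint U (U x) - (x - proj (op_ker U) x)) x = 0"
      by (simp add: cinner_diff_left[of "cadjoint U (U x)"] cadjoint'[OF U] cinner_self flip: y_def)
  qed
  then show e: "cadjoint U (U x) = x - proj (op_ker U) x" for x by simp
  show "pisom U" using U by (simp add: pisom_def e bcl_diff[OF U] Up)
qed

text \<open>If some Parseval frame is near \<open>f\<close>, so is the canonical one. For a partial isometry \<open>X\<close> with
  \<open>X - F\<close> Hilbert-Schmidt, \<open>X\<^sup>* X - A\<^sup>2\<close> is Hilbert-Schmidt where \<open>A = |F|\<close>, and so is
  \<open>A\<^sup>4 - A\<^sup>2 = A\<^sup>2 (A + 1) (A - 1)\<close> since \<open>X\<^sup>* X\<close> is idempotent. The lower frame bound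
  makes \<open>A\<^sup>2 (A + 1)\<close> bounded below on the orthogonal complement of the kernel, whence
  \<open>U - F = U (1 - A)\<close> is Hilbert-Schmidt.\<close>

lemma canonical_parseval:
  fixes F U :: "ell2 \<Rightarrow> 'h::chilbert_space"
  assumes frame: "frame_in K f" and ne: "parseval_near f \<noteq> {}" and F: "F = synthesis f"
    and polar: "polar_decomposition F U A"
  shows "bounded_clinear F" "col F = f" "pisom U" "hilbert_schmidt (\<lambda>x. U x - F x)" "range U = K"
    "op_ker F = {x. cadjoint U (U x) = 0}" "ortho_compl (op_ker F) = {x. cadjoint U (U x) = x}"
    "ortho_compl (range F) = {y. U (cadjoint U y) = 0}"
proof -
  obtain a B where K: "closed_csubspace K" "range f \<subseteq> K" and a: "a > 0" and fb: "frame_bounds K f a B"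
    using frame by (auto simp: frame_in_def)
  obtain F0 where F0: "bounded_clinear F0" "col F0 = f" "\<And>g. cadjoint F0 (proj K g) = cadjoint F0 g"
    "\<And>x. F0 x \<in> K" "\<And>g. (norm (cadjoint F0 g))\<^sup>2 = (\<Sum>i. (cmod (cinner (proj K g) (f i)))\<^sup>2)"
    using synthesis_exists[OF K fb] by metis
  have "F = F0" using synthesis_col[OF F0(1)] F0(2) F by simp
  note F' = F0[folded this]
  show bF: "bounded_clinear F" and colF: "col F = f" by (rule F'(1), rule F'(2))
  define C where "C = cadjoint F"
  have bC: "bounded_clinear C" unfolding C_def by (rule bounded_clinear_cadjoint[OF bF])
  have CF: "cinner (C g) y = cinner g (F y)" for g y unfolding C_def by (rule cadjoint'[OF bF])
  define s where "s = sqrt a"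
  have s: "s > 0" using a by (simp add: s_def)
  have Cs: "s * norm g \<le> norm (C g)" if "g \<in> K" for g
  proof (rule power2_le_imp_le)
    have "a * (norm g)\<^sup>2 \<le> (norm (C g))\<^sup>2"
      using fb that proj_eq_self[OF K(1) that] by (simp add: C_def F'(5) frame_bounds_def)
    then show "(s * norm g)\<^sup>2 \<le> (norm (C g))\<^sup>2" using a by (simp add: s_def power_mult_distrib)
  qed simp
  have CK: "closed_csubspace (C ` K)" by (rule closed_image_bounded_below[OF bC K(1) s Cs])
  define N where "N = op_ker F"
  have NC: "N = ortho_compl (C ` K)"
  proof
    show "N \<subseteq> ortho_compl (C ` K)"
    proof
      fix y assume "y \<in> N"
      then have "cinner (C g) y = 0" for g by (simp add: CF N_def op_ker_def)
      then show "y \<in> ortho_compl (C ` K)" by (auto simp: ortho_compl_def cinner_eq_0_commute[of y])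
    qed
    show "ortho_compl (C ` K) \<subseteq> N"
    proof
      fix y assume y: "y \<in> ortho_compl (C ` K)"
      have "cinner y (C (F y)) = 0" using y F'(4)[of y] by (auto simp: ortho_compl_def)
      then have "cinner (F y) (F y) = 0" using CF[of "F y" y] by (simp add: cinner_eq_0_commute[of y])
      then show "y \<in> N" by (simp add: N_def op_ker_def)
    qed
  qed
  have N: "closed_csubspace N" unfolding NC by (rule closed_csubspace_ortho_compl)
  have NC': "ortho_compl N = C ` K" unfolding NC by (rule ortho_compl_ortho_compl[OF CK])
  have Fs: "s * norm y \<le> norm (F y)" if "y \<in> ortho_compl N" for y
  proof -
    obtain g where g: "g \<in> K" "y = C g" using \<open>y \<in> _\<close> NC' by blast
    show ?thesis
    proof (cases "norm g = 0")
      case True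
      then show ?thesis using g(2) bcl_zero[OF bC] by simp
    next
      case False
      have "(s * norm y) * norm g \<le> norm y * norm y"
        using mult_left_mono[OF Cs[OF g(1)], of "norm y"] by (simp add: g(2) mult_ac)
      also have "\<dots> = Re (cinner (F y) g)"
        using norm_sq_cinner[of y] CF[of g y] Re_cinner_commute[of g "F y"]
        by (simp add: g(2) power2_eq_square)
      also have "\<dots> \<le> norm (F y) * norm g" by (rule Re_cauchy_schwarz)
      finally show ?thesis using False by simp
    qed
  qed
  have pos: "positive_op A" and AA: "A (A x) = C (F x)" and pU: "partial_isometry U"
    and FUA: "F x = U (A x)" and ker: "op_ker U = N" for x
    using polar by (auto simp: polar_decomposition_def fun_eq_iff C_def N_def)
  have bA: "bounded_clinear A" using pos by (simp add: positive_op_def)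
  show U: "pisom U" by (rule partial_isometry_pisom(1)[OF pU])
  note bU = pisom_bcl[OF U]
  have UU: "cadjoint U (U x) = x - proj N x" for x
    using partial_isometry_pisom(2)[OF pU] ker by simp
  have kU: "cadjoint U (U x) = 0 \<longleftrightarrow> x \<in> N" for x
    unfolding UU right_minus_eq using proj_eq_self_iff[OF N, of x] by metis
  show "op_ker F = {x. cadjoint U (U x) = 0}" by (simp add: kU N_def)
  have "cadjoint U (U x) = x \<longleftrightarrow> x \<in> ortho_compl N" for x
    by (simp add: UU proj_eq_0_iff[OF N])
  then show "ortho_compl (op_ker F) = {x. cadjoint U (U x) = x}" by (simp add: N_def)
  have Aadj: "cinner (A x) y = cinner x (A y)" for x y
  proof -
    have bD: "bounded_clinear (\<lambda>x. A x - cadjoint A x)"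
      by (intro bounded_clinear_intros bA bounded_clinear_cadjoint[OF bA])
    have "A x - cadjoint A x = 0" for x
    proof (rule polarization_zero[OF bD])
      fix x
      have "cinner (A x) x \<in> \<real>" using pos by (simp add: positive_op_def)
      then have "cinner (A x) x = cinner x (A x)" by (metis Reals_cnj_iff cinner_commute)
      then show "cinner (A x - cadjoint A x) x = 0" by (simp add: cinner_diff_left cadjoint'[OF bA])
    qed
    then show ?thesis using cadjoint'[OF bA, of x y] by simp
  qed
  have nA: "norm (A x) = norm (F x)" for x
    by (rule power2_eq_imp_eq) (simp_all add: norm_sq_cinner Aadj AA flip: CF, metis CF Re_cinner_commute)
  have AN: "A n = 0" if "n \<in> N" for n using nA[of n] that by (simp add: N_def op_ker_def)
  have A_in: "A x \<in> ortho_compl N" for x using AN by (simp add: ortho_compl_def Aadj)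
  have As: "s * norm y \<le> norm (A y)" if "y \<in> ortho_compl N" for y using Fs[OF that] nA by simp
  define M where "M x = A (A x)" for x
  have bM: "bounded_clinear M" unfolding M_def[abs_def] by (rule bounded_clinear_comp[OF bA bA])
  have Ms: "s\<^sup>2 * norm y \<le> norm (M y)" if "y \<in> ortho_compl N" for y
  proof -
    have "s\<^sup>2 * norm y = s * (s * norm y)" by (simp add: power2_eq_square)
    also have "\<dots> \<le> s * norm (A y)" using As[OF that] s by (intro mult_left_mono) auto
    also have "\<dots> \<le> norm (M y)" unfolding M_def by (rule As[OF A_in])
    finally show ?thesis .
  qed
  define T where "T x = M (M x) - M x" for x
  have hT: "hilbert_schmidt T"
  proof -
    obtain X where X: "pisom X" "hilbert_schmidt (\<lambda>y. X y - F y)"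
      using ne parseval_near_iff[OF bF] by (auto simp: colF)
    note bX = pisom_bcl[OF X(1)] and bX' = pisom_bcl_adj[OF X(1)]
    define P where "P x = cadjoint X (X x)" for x
    note P = pisom_initial[OF X(1), folded P_def]
    have "hilbert_schmidt (\<lambda>y. cadjoint X y - C y)"
      using hs_cadjoint[OF X(2)] by (simp add: cadjoint_diff[OF bX bF] C_def)
    then have "hilbert_schmidt (\<lambda>x. cadjoint X (X x - F x) + (cadjoint X (F x) - C (F x)))"
      by (intro hs_add hs_comp_left[OF X(2) bX'] hs_comp_right[OF _ bF])
    then have hPM: "hilbert_schmidt (\<lambda>x. P x - M x)" by (simp add: bcl_diff[OF bX'] P_def M_def AA)
    then have hMP: "hilbert_schmidt (\<lambda>x. M x - P x)" using hs_minus[OF hPM] by simp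
    have "hilbert_schmidt (\<lambda>x. M (M x - P x) + ((M (P x) - P (P x)) + (P x - M x)))"
      by (intro hs_add hPM hs_comp_left[OF hMP bM] hs_comp_right[OF hMP is_projD(1)[OF P]])
    then show ?thesis by (simp add: T_def[abs_def] bcl_diff[OF bM] is_projD(2)[OF P])
  qed
  have bUF: "bounded_clinear (\<lambda>x. U x - F x)" by (intro bounded_clinear_intros bU bF)
  show "hilbert_schmidt (\<lambda>x. U x - F x)"
  proof (rule hs_dominated[OF hT bUF, of "1 / s\<^sup>2"])
    fix x
    define y where "y = x - proj N x"
    have yN: "y \<in> ortho_compl N" using proj_orth[OF N] by (simp add: y_def ortho_compl_def)
    have pN: "proj N x \<in> N" by (rule proj_in[OF N])
    define w where "w = A y - y"
    have wN: "w \<in> ortho_compl N" "A w + w \<in> ortho_compl N"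
      using closed_csubspaceD(3,4)[OF closed_csubspace_ortho_compl] A_in yN unfolding w_def by blast+
    have Ux: "U x = U y" using pN ker by (simp add: y_def bcl_diff[OF bU] op_ker_def set_eq_iff)
    have Fx: "F x = F y" using pN by (simp add: y_def bcl_diff[OF bF] N_def op_ker_def)
    have "A x = A y" using AN[OF pN] by (simp add: y_def bcl_diff[OF bA])
    then have Mx: "M x = M y" by (simp add: M_def)
    have "U x - F x = - U w" unfolding Ux Fx FUA[of y] w_def bcl_diff[OF bU] by simp
    moreover have "T x = M (A w + w)"
    proof -
      have "A w + w = M y - y" by (simp add: w_def bcl_diff[OF bA] M_def)
      then show ?thesis by (simp add: T_def Mx bcl_diff[OF bM])
    qed
    ultimately have 1: "norm (U x - F x) \<le> norm w" and T: "norm (T x) = norm (M (A w + w))"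
      using pisom_norm_le[OF U, of w] by simp_all
    note 1
    also have "norm w \<le> norm (A w + w)"
    proof (rule power2_le_imp_le)
      have "0 \<le> Re (cinner (A w) w)" using pos by (simp add: positive_op_def)
      then show "(norm w)\<^sup>2 \<le> (norm (A w + w))\<^sup>2" by (simp add: norm_add_sq)
    qed simp
    finally have "s\<^sup>2 * norm (U x - F x) \<le> s\<^sup>2 * norm (A w + w)" by (rule mult_left_mono) simp
    also have "\<dots> \<le> norm (T x)" unfolding T by (rule Ms[OF wN(2)])
    finally show "norm (U x - F x) \<le> 1 / s\<^sup>2 * norm (T x)" using s by (simp add: field_simps)
  qed
  have 1: "C y = 0 \<longleftrightarrow> cadjoint U y = 0" for y
  proof
    assume "cadjoint U y = 0"
    then have "cinner (C y) z = 0" for z by (simp add: CF FUA flip: cadjoint'[OF bU])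
    then show "C y = 0" using cinner_self_eq_0 by blast
  next
    assume "C y = 0"
    then have "cinner (A (cadjoint U y)) z = 0" for z
      using CF[of y z] by (simp add: Aadj cadjoint'[OF bU] FUA)
    then have "A (cadjoint U y) = 0" using cinner_self_eq_0 by blast
    then have "cadjoint U y \<in> N" using nA[of "cadjoint U y"] by (simp add: N_def op_ker_def)
    then have "U (cadjoint U y) = 0" using ker by (auto simp: op_ker_def)
    then show "cadjoint U y = 0"
      using pisom_adj_eq[OF U, of y] by (simp add: bcl_zero[OF pisom_bcl_adj[OF U]])
  qed
  have 2: "U (cadjoint U y) = 0 \<longleftrightarrow> C y = 0" for y
    unfolding 1 using pisom_adj_eq[OF U, of y] bcl_zero[OF bU] bcl_zero[OF pisom_bcl_adj[OF U]] by metis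
  have 3: "y \<in> ortho_compl (range F) \<longleftrightarrow> C y = 0" for y
  proof -
    have "y \<in> ortho_compl (range F) \<longleftrightarrow> (\<forall>z. cinner (C y) z = 0)" by (simp add: ortho_compl_def CF)
    also have "\<dots> \<longleftrightarrow> C y = 0" using cinner_self_eq_0 by (metis cinner_zero_left)
    finally show ?thesis .
  qed
  show "ortho_compl (range F) = {y. U (cadjoint U y) = 0}" using 2 3 by blast
  have "C y = 0 \<longleftrightarrow> y \<in> ortho_compl K" for y
  proof -
    have "C y = 0 \<longleftrightarrow> C (proj K y) = 0" by (simp add: C_def F'(3))
    also have "\<dots> \<longleftrightarrow> proj K y = 0"
      using Cs[OF proj_in[OF K(1)], of y] s bcl_zero[OF bC] by (auto simp: mult_le_0_iff)
    finally show ?thesis by (simp add: proj_eq_0_iff[OF K(1)])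
  qed
  then have 4: "ortho_compl K = {y. U (cadjoint U y) = 0}" using 2 by blast
  have "ortho_compl (range U) = {y. U (cadjoint U y) = 0}"
  proof -
    have "y \<in> ortho_compl (range U) \<longleftrightarrow> (\<forall>z. cinner (cadjoint U y) z = 0)" for y
      by (simp add: ortho_compl_def cadjoint'[OF bU])
    moreover have "(\<forall>z. cinner (cadjoint U y) z = 0) \<longleftrightarrow> cadjoint U y = 0" for y
      using cinner_self_eq_0 by (metis cinner_zero_left)
    ultimately show ?thesis using 1 2 by blast
  qed
  then show "range U = K"
    using ortho_compl_ortho_compl[OF K(1)] ortho_compl_ortho_compl[OF pisom_range(2)[OF U]] 4 by metis
qed

section \<open>Fredholm pairs\<close>

lemma initial_eq_0_iff: "pisom Y \<Longrightarrow> cadjoint Y (Y x) = 0 \<longleftrightarrow> Y x = 0"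
  using pisom_norm[of Y x] by (metis norm_eq_zero)

lemma pisom_norm_of_initial: "pisom Y \<Longrightarrow> cadjoint Y (Y x) = x \<Longrightarrow> norm (Y x) = norm x"
  using pisom_norm[of Y x] by simp

lemma range_initial: "pisom Y \<Longrightarrow> range (cadjoint Y \<circ> Y) = {x. cadjoint Y (Y x) = x}"
  using is_projD(2)[OF pisom_initial[of Y]] by (auto simp: comp_def) (metis rangeI)

lemma closed_initial: 
  assumes "pisom Y" shows "closed_csubspace {x. cadjoint Y (Y x) = x}"
proof -
  have "bounded_clinear (\<lambda>x. cadjoint Y (Y x) - x)"
    by (intro bounded_clinear_intros is_projD(1)[OF pisom_initial[OF assms]])
  from closed_csubspace_kernel[OF this] show ?thesis by simp
qed

lemma orthogonal_projection_initial:
  assumes "pisom Y" shows "orthogonal_projection (cadjoint Y \<circ> Y)"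
proof -
  note p = is_projD[OF pisom_initial[OF assms]]
  have "cadjoint (cadjoint Y \<circ> Y) = cadjoint Y \<circ> Y"
    by (rule cadjoint_eqI) (simp add: p(3))
  then show ?thesis using p by (simp add: orthogonal_projection_def comp_def)
qed

text \<open>The isometry \<open>Y\<close> carries an intersection inside its initial space to one inside its range, which
  compares the operator \<open>X U\<^sup>*\<close> with the pair of initial projections.\<close>

lemma cspan_image_initial:
  fixes Y Z :: "'a::chilbert_space \<Rightarrow> 'b::chilbert_space"
  assumes Y: "pisom Y" and E: "finite E" "orthonormal E" "cspan E = {x. cadjoint Y (Y x) = x \<and> Z x = 0}"
  shows "cspan (Y ` E) = {y. Y (cadjoint Y y) = y \<and> Z (cadjoint Y y) = 0}"
    "finite (Y ` E)" "orthonormal (Y ` E)" "card (Y ` E) = card E"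
proof -
  have i: "initial_on Y E"
    using E complex_vector.span_superset[of E] by (auto simp: initial_on_def)
  note i' = initial_on_cadjoint[OF Y i]
  show 1: "finite (Y ` E)" and 2: "orthonormal (Y ` E)" by (rule initial_onD(1)[OF i'], rule initial_onD(2)[OF i'])
  show "card (Y ` E) = card E" by (rule card_image[OF initial_inj[OF Y i]])
  have f: "fproj (Y ` E) y = Y (fproj E (cadjoint Y y))" for y
    unfolding fproj_image[OF initial_inj[OF Y i]] unfolding fproj_def bcl_sum[OF pisom_bcl[OF Y]]
    by (simp add: bcl_scaleC[OF pisom_bcl[OF Y]] cadjoint'[OF pisom_bcl[OF Y]])
  show "cspan (Y ` E) = {y. Y (cadjoint Y y) = y \<and> Z (cadjoint Y y) = 0}"
  proof (intro Set.set_eqI iffI)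
    fix y assume "y \<in> cspan (Y ` E)"
    then have y: "Y (fproj E (cadjoint Y y)) = y" using fproj_eq_self[OF 1 2] f by simp
    have "fproj E (cadjoint Y y) \<in> {x. cadjoint Y (Y x) = x \<and> Z x = 0}"
      using fproj_in_cspan E(3) by blast
    then show "y \<in> {y. Y (cadjoint Y y) = y \<and> Z (cadjoint Y y) = 0}" using y by (metis (mono_tags, lifting) mem_Collect_eq)
  next
    fix y assume y: "y \<in> {y. Y (cadjoint Y y) = y \<and> Z (cadjoint Y y) = 0}"
    then have "cadjoint Y y \<in> cspan E" by (simp add: E(3))
    then have "fproj (Y ` E) y = y" using y fproj_eq_self[OF E(1,2)] by (simp add: f)
    then show "y \<in> cspan (Y ` E)" using fproj_in_cspan by metis
  qed
qed

context
  fixes U X :: "'a::chilbert_space \<Rightarrow> 'b::chilbert_space"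
  assumes U: "pisom U" and X: "pisom X" and hs: "hilbert_schmidt (\<lambda>x. X x - U x)"
begin

text \<open>The kernel and the cokernel of the pair are the intersections that occur in
  \<open>rel_index_intersections\<close>.\<close>

lemma fredholm_pair_initial:
  obtains E E' where "finite E" "orthonormal E" "cspan E = {x. cadjoint U (U x) = x \<and> X x = 0}"
    "finite E'" "orthonormal E'" "cspan E' = {x. cadjoint X (X x) = x \<and> U x = 0}"
    "fredholm_pair (cadjoint U \<circ> U) (cadjoint X \<circ> X)"
    "pair_index (cadjoint U \<circ> U) (cadjoint X \<circ> X) = int (card E) - int (card E')"
proof -
  define P Q where "P = cadjoint U \<circ> U" and "Q = cadjoint X \<circ> X"
  have pP: "is_proj P" and pQ: "is_proj Q"
    using pisom_initial[OF U] pisom_initial[OF X] by (simp_all add: P_def Q_def comp_def)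
  have rP: "range P = {x. cadjoint U (U x) = x}" and rQ: "range Q = {x. cadjoint X (X x) = x}"
    unfolding P_def Q_def by (rule range_initial[OF U], rule range_initial[OF X])
  have P0: "P x = 0 \<longleftrightarrow> U x = 0" and Q0: "Q x = 0 \<longleftrightarrow> X x = 0" for x
    by (simp_all add: P_def Q_def initial_eq_0_iff U X)
  have inP: "P x = x" if "x \<in> range P" for x using that is_projD(2)[OF pP] by auto
  have inQ: "Q x = x" if "x \<in> range Q" for x using that is_projD(2)[OF pQ] by auto
  have bQP: "bounded_clinear (Q \<circ> P)" by (intro bounded_clinear_o is_projD(1)[OF pP] is_projD(1)[OF pQ])
  have hs': "hilbert_schmidt (\<lambda>x. U x - X x)" using hs_minus[OF hs] by simp
  obtain E where E: "finite E" "orthonormal E" "cspan E = {x. cadjoint U (U x) = x \<and> X x = 0}"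
    using finite_intersection[OF X U hs] by blast
  obtain E' where E': "finite E'" "orthonormal E'" "cspan E' = {x. cadjoint X (X x) = x \<and> U x = 0}"
    using finite_intersection[OF U X hs'] by blast
  have ker: "range P \<inter> op_ker (Q \<circ> P) = cspan E"
  proof -
    have "x \<in> op_ker (Q \<circ> P) \<longleftrightarrow> X x = 0" if "x \<in> range P" for x
      using inP[OF that] by (simp add: op_ker_def Q0)
    then show ?thesis unfolding E(3) rP by blast
  qed
  have coker: "range Q \<inter> ortho_compl ((Q \<circ> P) ` range P) = cspan E'"
  proof -
    have "y \<in> ortho_compl ((Q \<circ> P) ` range P) \<longleftrightarrow> U y = 0" if y: "y \<in> range Q" for y
    proof -
      have "cinner y (Q (P (P z))) = cinner (P y) z" for z
        using inQ[OF y] by (simp add: is_projD(2)[OF pP] is_projD(3)[OF pP] flip: is_projD(3)[OF pQ])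
      then have "y \<in> ortho_compl ((Q \<circ> P) ` range P) \<longleftrightarrow> (\<forall>z. cinner (P y) z = 0)"
        by (simp add: ortho_compl_def)
      also have "\<dots> \<longleftrightarrow> P y = 0" using cinner_self_eq_0 by (metis cinner_zero_left)
      finally show ?thesis by (simp add: P0)
    qed
    then show ?thesis unfolding E'(3) rQ by blast
  qed
  have "closed_csubspace ((Q \<circ> P) ` range P)"
  proof (rule semi_fredholm_closed_image[OF bQP hs _ zero_less_one])
    show "closed_csubspace (range P)" unfolding rP by (rule closed_initial[OF U])
    fix x assume x: "x \<in> range P"
    have "norm (U x) = norm x" using x pisom_norm_of_initial[OF U] by (simp add: rP)
    moreover have "norm ((Q \<circ> P) x) = norm (X x)" using inP[OF x] pisom_norm[OF X, of x] by (simp add: Q_def)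
    ultimately show "1 * norm x - norm (X x - U x) \<le> norm ((Q \<circ> P) x)"
      using norm_diff_ineq[of "U x" "X x - U x"] by simp
  qed
  then have "closed ((Q \<circ> P) ` range P)" by (simp add: closed_csubspace_def)
  moreover have "closed_csubspace (range P)" "closed_csubspace (range Q)"
    unfolding rP rQ by (rule closed_initial[OF U], rule closed_initial[OF X])
  ultimately have "fredholm (range P) (range Q) (Q \<circ> P)"
    unfolding fredholm_def ker coker hdim_cspan[OF E(2,1)] hdim_cspan[OF E'(2,1)]
    using bQP by auto
  then have "fredholm_pair P Q"
    unfolding fredholm_pair_def P_def Q_def
    using orthogonal_projection_initial[OF U] orthogonal_projection_initial[OF X] by blast
  moreover have "pair_index P Q = int (card E) - int (card E')"
    unfolding pair_index_def fredholm_index_def ker coker cdim_cspan[OF E(2,1)] cdim_cspan[OF E'(2,1)] ..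
  ultimately show ?thesis using that E E' unfolding P_def Q_def by blast
qed

lemma fredholm_ranges:
  assumes E: "finite E" "orthonormal E" "cspan E = {x. cadjoint U (U x) = x \<and> X x = 0}"
    and E': "finite E'" "orthonormal E'" "cspan E' = {x. cadjoint X (X x) = x \<and> U x = 0}"
  shows "fredholm (range U) (range X) (X \<circ> cadjoint U)"
    "fredholm_index (range U) (range X) (X \<circ> cadjoint U) = int (card E) - int (card E')"
proof -
  note bU = pisom_bcl[OF U] and bX = pisom_bcl[OF X]
  note 1 = cspan_image_initial[OF U E] and 2 = cspan_image_initial[OF X E']
  have b: "bounded_clinear (X \<circ> cadjoint U)" by (intro bounded_clinear_o bX pisom_bcl_adj[OF U])
  have ker: "range U \<inter> op_ker (X \<circ> cadjoint U) = cspan (U ` E)"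
    by (auto simp: 1(1) pisom_range(1)[OF U] op_ker_def)
  have coker: "range X \<inter> ortho_compl ((X \<circ> cadjoint U) ` range U) = cspan (X ` E')"
  proof -
    have "y \<in> ortho_compl ((X \<circ> cadjoint U) ` range U) \<longleftrightarrow> U (cadjoint X y) = 0" for y
    proof -
      have "cinner y (X (cadjoint U (U z))) = cinner (cadjoint U (U (cadjoint X y))) z" for z
        by (simp add: cadjoint'[OF bU] cadjoint[OF bU] flip: cadjoint'[OF bX])
      then have "y \<in> ortho_compl ((X \<circ> cadjoint U) ` range U)
          \<longleftrightarrow> (\<forall>z. cinner (cadjoint U (U (cadjoint X y))) z = 0)"
        by (simp add: ortho_compl_def)
      also have "\<dots> \<longleftrightarrow> cadjoint U (U (cadjoint X y)) = 0"
        using cinner_self_eq_0 by (metis cinner_zero_left)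
      finally show ?thesis by (simp add: initial_eq_0_iff[OF U])
    qed
    then show ?thesis by (auto simp: 2(1) pisom_range(1)[OF X])
  qed
  have "closed_csubspace ((X \<circ> cadjoint U) ` range U)"
  proof (rule semi_fredholm_closed_image[OF b hs_comp_right[OF hs pisom_bcl_adj[OF U]] pisom_range(2)[OF U] zero_less_one])
    fix y assume "y \<in> range U"
    then have "U (cadjoint U y) = y" by (simp add: pisom_range(1)[OF U])
    then show "1 * norm y - norm (X (cadjoint U y) - U (cadjoint U y)) \<le> norm ((X \<circ> cadjoint U) y)"
      using norm_diff_ineq[of y "X (cadjoint U y) - y"] by simp
  qed
  then show "fredholm (range U) (range X) (X \<circ> cadjoint U)"
    unfolding fredholm_def ker coker hdim_cspan[OF 1(3,2)] hdim_cspan[OF 2(3,2)]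
    using pisom_range(2)[OF U] pisom_range(2)[OF X] b by (auto simp: closed_csubspace_def)
  show "fredholm_index (range U) (range X) (X \<circ> cadjoint U) = int (card E) - int (card E')"
    unfolding fredholm_index_def ker coker cdim_cspan[OF 1(3,2)] cdim_cspan[OF 2(3,2)] 1(4) 2(4) ..
qed

end

definition indices_eq ::
  "('a::chilbert_space \<Rightarrow> 'b::chilbert_space) \<Rightarrow> ('a \<Rightarrow> 'b) \<Rightarrow> int \<Rightarrow> bool" where
  "indices_eq U X k \<longleftrightarrow>
    (fredholm_pair (cadjoint U \<circ> U) (cadjoint X \<circ> X) \<and> pair_index (cadjoint U \<circ> U) (cadjoint X \<circ> X) = k) \<and>
    (fredholm_pair (U \<circ> cadjoint U) (X \<circ> cadjoint X) \<and> pair_index (U \<circ> cadjoint U) (X \<circ> cadjoint X) = k) \<and>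
    (fredholm (range U) (range X) (X \<circ> cadjoint U) \<and>
      fredholm_index (range U) (range X) (X \<circ> cadjoint U) = k)"

text \<open>The relative index is the common value of the three indices. For the range projections this is
  the result for the initial projections, applied to the adjoints; the bounds on the index are read off
  from the intersections that define it.\<close>

lemma three_indices:
  fixes U X :: "'a::chilbert_space \<Rightarrow> 'b::chilbert_space"
  assumes U: "pisom U" and X: "pisom X" and hs: "hilbert_schmidt (\<lambda>x. X x - U x)"
  obtains k where "rel_index U X k" "indices_eq U X k"
    "enat (nat k) \<le> hdim {x. cadjoint U (U x) = x}"
    "enat (nat (- k)) \<le> hdim {x. cadjoint U (U x) = 0}"
    "enat (nat (- k)) \<le> hdim {y. U (cadjoint U y) = 0}"
proof -
  obtain E E' where E: "finite E" "orthonormal E" "cspan E = {x. cadjoint U (U x) = x \<and> X x = 0}"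
    and E': "finite E'" "orthonormal E'" "cspan E' = {x. cadjoint X (X x) = x \<and> U x = 0}"
    and p: "fredholm_pair (cadjoint U \<circ> U) (cadjoint X \<circ> X)"
      "pair_index (cadjoint U \<circ> U) (cadjoint X \<circ> X) = int (card E) - int (card E')"
    by (rule fredholm_pair_initial[OF U X hs])
  define k where "k = int (card E) - int (card E')"
  have k: "rel_index U X k" unfolding k_def by (rule rel_index_intersections[OF U X hs E E'])
  note U' = pisom_cadjoint[OF U] and X' = pisom_cadjoint[OF X]
  note aa = cadjoint_cadjoint[OF pisom_bcl[OF U]] cadjoint_cadjoint[OF pisom_bcl[OF X]]
  have hs': "hilbert_schmidt (\<lambda>y. cadjoint X y - cadjoint U y)"
    using hs_cadjoint[OF hs] by (simp add: cadjoint_diff[OF pisom_bcl[OF X] pisom_bcl[OF U]])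
  obtain G G' where G: "finite G" "orthonormal G" "cspan G = {y. U (cadjoint U y) = y \<and> cadjoint X y = 0}"
    and G': "finite G'" "orthonormal G'" "cspan G' = {y. X (cadjoint X y) = y \<and> cadjoint U y = 0}"
    and q: "fredholm_pair (U \<circ> cadjoint U) (X \<circ> cadjoint X)"
      "pair_index (U \<circ> cadjoint U) (X \<circ> cadjoint X) = int (card G) - int (card G')"
    by (rule fredholm_pair_initial[OF U' X' hs', unfolded aa])
  have "rel_index (cadjoint U) (cadjoint X) (int (card G) - int (card G'))"
    by (rule rel_index_intersections[OF U' X' hs']) (use G G' in \<open>simp_all add: aa\<close>)
  from rel_index_cadjoint[OF U' X' this] have "rel_index U X (int (card G) - int (card G'))"
    by (simp add: aa)
  then have kG: "k = int (card G) - int (card G')" by (rule rel_index_unique[OF U X k])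
  have sub: "csubspace {x. cadjoint U (U x) = 0}" "csubspace {y. U (cadjoint U y) = 0}"
    "csubspace {x. cadjoint U (U x) = x}"
    using closed_csubspace_kernel[OF is_projD(1)[OF pisom_initial[OF U]]]
      closed_csubspace_kernel[OF is_projD(1)[OF pisom_final[OF U]]] closed_initial[OF U]
    by (simp_all add: closed_csubspace_def)
  have le: "enat (nat l) \<le> hdim S"
    if "csubspace S" "finite A" "orthonormal A" "cspan A \<subseteq> S" "l \<le> int (card A)"
    for l and S :: "'c::complex_inner set" and A
  proof -
    have "A \<subseteq> S" using that(4) complex_vector.span_superset by blast
    then have "enat (card A) \<le> hdim S" by (rule card_le_hdim[OF that(1-3)])
    moreover have "enat (nat l) \<le> enat (card A)" using that(5) by simp
    ultimately show ?thesis by (rule order_trans[rotated])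
  qed
  show ?thesis
  proof (rule that[of k])
    show "rel_index U X k" by (rule k)
    have "pair_index (U \<circ> cadjoint U) (X \<circ> cadjoint X) = k" by (simp only: q(2) kG)
    then show "indices_eq U X k"
      using fredholm_ranges[OF U X hs E E'] p q(1) by (simp add: indices_eq_def k_def)
    show "enat (nat k) \<le> hdim {x. cadjoint U (U x) = x}"
      by (rule le[OF sub(3) E(1,2)]) (auto simp: E(3) k_def)
    show "enat (nat (- k)) \<le> hdim {x. cadjoint U (U x) = 0}"
      by (rule le[OF sub(1) E'(1,2)]) (auto simp: E'(3) k_def bcl_zero[OF pisom_bcl_adj[OF U]])
    show "enat (nat (- k)) \<le> hdim {y. U (cadjoint U y) = 0}"
      by (rule le[OF sub(2) G'(1,2)]) (auto simp: G'(3) kG bcl_zero[OF pisom_bcl[OF U]])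
  qed
qed

text \<open>Every index that the dimensions permit occurs: a finite-rank piece of the initial space is
  removed, or an isometry of finite rank from the kernel to the orthogonal complement of the range
  is added.\<close>

lemma rel_index_realized:
  fixes U :: "'a::chilbert_space \<Rightarrow> 'b::chilbert_space"
  assumes U: "pisom U" and k2: "enat (nat k) \<le> hdim {x. cadjoint U (U x) = x}"
    and k1: "enat (nat (- k)) \<le> hdim {x. cadjoint U (U x) = 0}"
    and k3: "enat (nat (- k)) \<le> hdim {y. U (cadjoint U y) = 0}"
  shows "\<exists>X. pisom X \<and> hilbert_schmidt (\<lambda>x. X x - U x) \<and> rel_index U X k"
proof (cases "0 \<le> k")
  case True
  have "csubspace {x. cadjoint U (U x) = x}" using closed_initial[OF U] by (simp add: closed_csubspace_def)
  from orthonormal_of_card[OF this k2] obtain G where G: "finite G" "orthonormal G"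
    "G \<subseteq> {x. cadjoint U (U x) = x}" "card G = nat k" by blast
  have i: "initial_on U G" using G by (auto simp: initial_on_def)
  have "hilbert_schmidt (\<lambda>x. restr U G x - U x)" using hs_minus[OF hs_restr[OF U i]] by simp
  moreover have "rel_index U (restr U G) k"
    unfolding rel_index_def
    by (intro exI[of _ "restr U G"] exI[of _ G] exI[of _ "{}"])
       (use True in \<open>simp add: orbit_equiv_refl i initial_on_def[of _ "{}"] G(4) restr_def[of _ "{}"] fproj_def[of "{}"]\<close>)
  ultimately show ?thesis using pisom_restr[OF U i] by blast
next
  case False
  note bU = pisom_bcl[OF U] and bU' = pisom_bcl_adj[OF U]
  have "csubspace {x. cadjoint U (U x) = 0}" "csubspace {y. U (cadjoint U y) = 0}"
    using closed_csubspace_kernel[OF is_projD(1)[OF pisom_initial[OF U]]]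
      closed_csubspace_kernel[OF is_projD(1)[OF pisom_final[OF U]]]
    by (simp_all add: closed_csubspace_def)
  from orthonormal_of_card[OF this(1) k1] orthonormal_of_card[OF this(2) k3]
  obtain G H where G: "finite G" "orthonormal G" "G \<subseteq> {x. cadjoint U (U x) = 0}" "card G = nat (- k)"
    and H: "finite H" "orthonormal H" "H \<subseteq> {y. U (cadjoint U y) = 0}" "card H = nat (- k)" by blast
  have UG: "U g = 0" if "g \<in> G" for g using G(3) that initial_eq_0_iff[OF U] by blast
  have UH: "cadjoint U h = 0" if "h \<in> H" for h
    using H(3) that initial_eq_0_iff[OF pisom_cadjoint[OF U]] by (auto simp: cadjoint_cadjoint[OF bU])
  obtain \<pi> where \<pi>: "bij_betw \<pi> G H" using finite_same_card_bij[OF G(1) H(1)] G(4) H(4) by metis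
  have \<pi>H: "\<pi> g \<in> H" if "g \<in> G" for g using \<pi> that by (auto simp: bij_betw_def)
  define T where "T x = (\<Sum>g\<in>G. cinner x g *\<^sub>C \<pi> g)" for x
  define T' where "T' y = (\<Sum>g\<in>G. cinner y (\<pi> g) *\<^sub>C g)" for y
  have bT: "bounded_clinear T" unfolding T_def[abs_def] by (intro bounded_clinear_intros)
  have hT: "hilbert_schmidt T" unfolding T_def[abs_def] by (intro hs_sum hs_rank1)
  have Tadj: "cinner (T x) y = cinner x (T' y)" for x y
    unfolding T_def T'_def cinner_sum_left cinner_sum_right cinner_scaleC_left cinner_scaleC_right
    by (rule sum.cong) (simp_all add: mult.commute flip: cinner_commute)
  have T\<pi>: "cinner (T x) (\<pi> g) = cinner x g" if "g \<in> G" for x g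
    unfolding T_def using \<pi> H(2) by (intro cinner_sum_orthonormal G(1) that) (auto simp: bij_betw_def)
  have T'T: "T' (T x) = fproj G x" for x unfolding T'_def fproj_def by (rule sum.cong) (simp_all add: T\<pi>)
  have TG: "T (fproj G x) = T x" for x
    unfolding T_def by (rule sum.cong) (simp_all add: cinner_fproj[OF G(1,2)])
  have UT: "cadjoint U (T x) = 0" for x
    unfolding T_def bcl_sum[OF bU'] by (rule sum.neutral) (simp add: bcl_scaleC[OF bU'] UH \<pi>H)
  have TU': "T (cadjoint U y) = 0" for y
    unfolding T_def by (rule sum.neutral) (simp add: cadjoint'[OF bU] UG)
  have T'U: "T' (U x) = 0" for x
    unfolding T'_def by (rule sum.neutral) (simp add: cadjoint[OF bU] UH \<pi>H)
  have Up: "U (fproj G x) = 0" for x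
    unfolding fproj_def bcl_sum[OF bU] by (rule sum.neutral) (simp add: bcl_scaleC[OF bU] UG)
  define X where "X x = U x + T x" for x
  have bX: "bounded_clinear X" unfolding X_def[abs_def] by (intro bounded_clinear_intros bU bT)
  have aX: "cadjoint X = (\<lambda>y. cadjoint U y + T' y)"
    by (rule cadjoint_eqI) (simp add: X_def cinner_simps cadjoint[OF bU] Tadj)
  have "T' (u + v) = T' u + T' v" for u v
    unfolding T'_def by (simp add: cinner_add_left scaleC_add_left sum.distrib)
  then have XX: "cadjoint X (X x) = cadjoint U (U x) + fproj G x" for x
    by (simp add: aX) (simp add: X_def bcl_add[OF bU'] UT T'U T'T)
  have "pisom X"
    unfolding pisom_def
    by (simp add: bX XX) (simp add: X_def bcl_add[OF bU] bcl_add[OF bT] pisom_eq[OF U] Up TU' TG)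
  moreover have "hilbert_schmidt (\<lambda>x. X x - U x)" using hT by (simp add: X_def)
  moreover have "rel_index U X k"
    unfolding rel_index_def
  proof (intro exI conjI)
    show "orbit_equiv X X" by (rule orbit_equiv_refl)
    show "initial_on U {}" by (simp add: initial_on_def)
    show "initial_on X G"
      unfolding initial_on_def
    proof (intro conjI ballI G(1,2))
      fix g assume g: "g \<in> G"
      have "fproj G g = g" by (rule fproj_eq_self[OF G(1,2) complex_vector.span_base[OF g]])
      then show "cadjoint X (X g) = g" by (simp add: XX UG[OF g] bcl_zero[OF bU'])
    qed
    show "restr U {} = restr X G"
      by (simp add: restr_def X_def bcl_diff[OF bU] bcl_diff[OF bT] Up TG) (simp add: fproj_def bcl_zero[OF bU])
    show "k = int (card ({} :: 'a set)) - int (card G)" using False G(4) by simp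
  qed
  ultimately show ?thesis by blast
qed

section \<open>Orbits are the connected components\<close>

lemma hs_bound_norm:
  assumes T: "bounded_clinear T" and C: "hs_bound T C" shows "(norm (T x))\<^sup>2 \<le> C * (norm x)\<^sup>2"
proof (cases "x = 0")
  case True
  then show ?thesis by (simp add: bcl_zero[OF T])
next
  case False
  define u where "u = complex_of_real (1 / norm x) *\<^sub>C x"
  have "norm u = 1" using False by (simp add: u_def norm_scaleC norm_divide)
  then have "orthonormal {u}" by (simp add: orthonormal_def)
  then have "(norm (T u))\<^sup>2 \<le> C" using hs_boundD[OF C, of "{u}"] by simp
  moreover have "norm (T u) = norm (T x) / norm x"
    by (simp add: u_def bcl_scaleC[OF T] norm_scaleC norm_divide)
  ultimately show ?thesis using False by (simp add: power_divide pos_divide_le_eq)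
qed

text \<open>The synthesis operators of the Parseval frames near the columns of \<open>F\<close>.\<close>

definition near_pisom :: "(ell2 \<Rightarrow> 'h::chilbert_space) \<Rightarrow> (ell2 \<Rightarrow> 'h) \<Rightarrow> bool" where
  "near_pisom F X \<longleftrightarrow> pisom X \<and> hilbert_schmidt (\<lambda>y. X y - F y)"

definition frame_orbit :: "(ell2 \<Rightarrow> 'h::chilbert_space) \<Rightarrow> (nat \<Rightarrow> 'h) set" where
  "frame_orbit X = col ` {Y. orbit_equiv X Y}"

lemma near_pisomD:
  assumes "near_pisom F X"
  shows "pisom X" "hilbert_schmidt (\<lambda>y. X y - F y)" "bounded_clinear X"
  using assms pisom_bcl by (auto simp: near_pisom_def)

lemma near_pisom_orbit: "near_pisom F X \<Longrightarrow> orbit_equiv X Y \<Longrightarrow> near_pisom F Y"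
  using hs_add[of "\<lambda>x. X x - F x" "\<lambda>x. Y x - X x"] orbit_equiv_pisom[of X Y]
  by (simp add: near_pisom_def)

context
  fixes F :: "ell2 \<Rightarrow> 'h::chilbert_space"
  assumes F: "bounded_clinear F"
begin

lemma parseval_near_col: "x \<in> parseval_near (col F) \<longleftrightarrow> (\<exists>X. near_pisom F X \<and> x = col X)"
  using parseval_near_iff[OF F] by (simp add: near_pisom_def)

lemma frame_dist_le:
  assumes "hs_bound (\<lambda>x. X x - Y x) C" shows "frame_dist (col X) (col Y) \<le> sqrt C"
  using col_of_hs_bound[OF assms] by (subst frame_dist_eq) (simp_all add: col_def)

text \<open>The metric of the frames is the Hilbert-Schmidt distance, which dominates the operator norm.\<close>

lemma orbit_equiv_frame_dist:
  assumes X: "near_pisom F X" and Y: "near_pisom F Y" and d: "frame_dist (col X) (col Y) < 1"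
  shows "orbit_equiv Y X"
proof (rule orbit_equiv_near[OF near_pisomD(1)[OF X] near_pisomD(1)[OF Y]])
  have "hilbert_schmidt (\<lambda>x. (X x - F x) - (Y x - F x))"
    by (rule hs_diff[OF near_pisomD(2)[OF X] near_pisomD(2)[OF Y]])
  then show hs: "hilbert_schmidt (\<lambda>x. X x - Y x)" by simp
  note b = hs_bcl[OF hs]
  have s: "summable (\<lambda>i. (norm (X (ell2_basis i) - Y (ell2_basis i)))\<^sup>2)"
    using hs hs_iff_col[OF b] by simp
  define S where "S = (\<Sum>i. (norm (X (ell2_basis i) - Y (ell2_basis i)))\<^sup>2)"
  have "S < 1" using d frame_dist_eq[of "col X" "col Y"] s by (simp add: S_def col_def)
  fix x :: ell2 assume x: "x \<noteq> 0"
  have "(norm (X x - Y x))\<^sup>2 \<le> S * (norm x)\<^sup>2"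
    unfolding S_def by (rule hs_bound_norm[OF b hs_bound_col[OF b s]])
  also have "\<dots> < 1 * (norm x)\<^sup>2" using \<open>S < 1\<close> x by (intro mult_strict_right_mono) simp_all
  finally show "norm (X x - Y x) < norm x" by (simp add: power2_less_imp_less)
qed

interpretation M: Metric_space "parseval_near (col F)" frame_dist
  by (rule Metric_space_parseval_near)

lemma frame_orbit_subset: "near_pisom F X \<Longrightarrow> frame_orbit X \<subseteq> parseval_near (col F)"
  using near_pisom_orbit parseval_near_col by (force simp: frame_orbit_def)

text \<open>The unit ball around a frame lies in its orbit, so that every union of orbits is open. Applied to
  an orbit and to its complement this makes orbits both open and closed.\<close>

lemma openin_union_orbits:
  assumes A: "\<And>X Y. P X \<Longrightarrow> orbit_equiv X Y \<Longrightarrow> P Y"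
  shows "openin (parseval_near_topology (col F)) {col X |X. near_pisom F X \<and> P X}"
  unfolding parseval_near_topology_def M.openin_mtopology
proof (intro conjI allI impI)
  show "{col X |X. near_pisom F X \<and> P X} \<subseteq> parseval_near (col F)"
    using parseval_near_col by blast
  fix x assume "x \<in> {col X |X. near_pisom F X \<and> P X}"
  then obtain X where X: "x = col X" "near_pisom F X" "P X" by blast
  have "M.mball x 1 \<subseteq> {col X |X. near_pisom F X \<and> P X}"
  proof
    fix y assume y: "y \<in> M.mball x 1"
    then obtain Y where Y: "y = col Y" "near_pisom F Y" using parseval_near_col by auto
    have "frame_dist (col Y) (col X) < 1" using y X(1) Y(1) by (simp add: M.commute)
    then have "P Y" using A[OF X(3) orbit_equiv_frame_dist[OF Y(2) X(2)]] by blast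
    then show "y \<in> {col X |X. near_pisom F X \<and> P X}" using Y by blast
  qed
  then show "\<exists>r>0. M.mball x r \<subseteq> {col X |X. near_pisom F X \<and> P X}" by (intro exI[of _ 1]) simp
qed

lemma connected_by_path:
  assumes g: "\<And>t :: real. near_pisom F (g t)"
    and L: "\<And>s t. hs_bound (\<lambda>x. g t x - g s x) ((2 * \<bar>t - s\<bar>)\<^sup>2 * C)"
  shows "connected_component_of (parseval_near_topology (col F)) (col (g 0)) (col (g 1))"
proof -
  define L where "L = 2 * sqrt C"
  have C: "C \<ge> 0" using hs_bound_nonneg[OF L[of 1 0]] by (simp add: zero_le_mult_iff)
  have d: "frame_dist (col (g t)) (col (g s)) \<le> L * \<bar>t - s\<bar>" for s t
  proof -
    have "hs_bound (\<lambda>x. g t x - g s x) ((2 * \<bar>t - s\<bar>)\<^sup>2 * C)" by (rule L)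
    from frame_dist_le[OF this] show ?thesis by (simp add: L_def real_sqrt_mult mult_ac)
  qed
  have L0: "L \<ge> 0" using C by (simp add: L_def)
  have "pathin M.mtopology (\<lambda>t. col (g t))"
    unfolding pathin_def M.continuous_map_to_metric
  proof (intro ballI allI impI)
    fix t e :: real assume e: "e > 0"
    define r where "r = e / (L + 1)"
    have r: "r > 0" using e L0 by (simp add: r_def)
    show "\<exists>W. openin (top_of_set {0..1}) W \<and> t \<in> W \<and> (\<forall>s\<in>W. col (g s) \<in> M.mball (col (g t)) e)"
      if t: "t \<in> topspace (top_of_set {0..1})"
    proof (intro exI conjI ballI)
      show "openin (top_of_set {0..1}) ({0..1} \<inter> ball t r)" by (intro openin_open_Int open_ball)
      show "t \<in> {0..1} \<inter> ball t r" using t r by simp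
      fix s assume "s \<in> {0..1} \<inter> ball t r"
      then have "\<bar>t - s\<bar> < r" by (simp add: dist_real_def)
      then have "L * \<bar>t - s\<bar> \<le> L * r" using L0 by (intro mult_left_mono) auto
      also have "\<dots> < e" using e L0 by (simp add: r_def divide_less_eq algebra_simps)
      finally show "col (g s) \<in> M.mball (col (g t)) e"
        using d[of t s] g parseval_near_col by (auto simp: M.mball_def)
    qed
  qed
  then have "connectedin M.mtopology ((\<lambda>t. col (g t)) ` {0..1})"
    by (rule connectedin_path_image)
  then show ?thesis
    unfolding parseval_near_topology_def connected_component_of_def
    by (intro exI[of _ "(\<lambda>t. col (g t)) ` {0..1}"]) auto
qed

text \<open>For \<open>\<Phi> W = W X\<close> and for \<open>\<Phi> W = X W\<close> this connects \<open>X\<close> to the points of its orbit.\<close>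

lemma connected_unitary_family:
  fixes \<Phi> :: "('a::chilbert_space \<Rightarrow> 'a) \<Rightarrow> ell2 \<Rightarrow> 'h"
  assumes near: "\<And>V. u2_op V \<Longrightarrow> near_pisom F (\<Phi> V)"
    and lip: "\<And>V W C. u2_op V \<Longrightarrow> u2_op W \<Longrightarrow> hs_bound (\<lambda>x. V x - W x) C \<Longrightarrow> hs_bound (\<lambda>x. \<Phi> V x - \<Phi> W x) C"
    and W: "u2_op W"
  shows "connected_component_of (parseval_near_topology (col F)) (col (\<Phi> (\<lambda>x. x))) (col (\<Phi> W))"
proof -
  have cay: "connected_component_of (parseval_near_topology (col F)) (col (\<Phi> V)) (col (\<Phi> (\<lambda>x. W (V x))))"
    if V: "u2_op V" and W: "u2_op W" "\<And>x. x + W x = 0 \<Longrightarrow> x = 0" for V W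
  proof -
    obtain \<gamma> C where g: "\<gamma> (0::real) = (\<lambda>x. x)" "\<gamma> 1 = W" "\<And>t. u2_op (\<gamma> t)"
      "\<And>s t. hs_bound (\<lambda>x. \<gamma> t x - \<gamma> s x) ((2 * \<bar>t - s\<bar>)\<^sup>2 * C)"
      using cayley_path[OF W] by blast
    have u: "u2_op (\<lambda>x. \<gamma> t (V x))" for t by (rule u2_comp[OF g(3) V])
    have "hs_bound (\<lambda>x. \<Phi> (\<lambda>x. \<gamma> t (V x)) x - \<Phi> (\<lambda>x. \<gamma> s (V x)) x) ((2 * \<bar>t - s\<bar>)\<^sup>2 * C)" for s t
    proof (rule lip[OF u u])
      have b: "bounded_clinear (\<lambda>x. \<gamma> t x - \<gamma> s x)" by (intro bounded_clinear_diff u2_bcl g(3))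
      have "hs_bound (\<lambda>x. \<gamma> t x - \<gamma> s x) ((2 * \<bar>t - s\<bar>)\<^sup>2 * C)" by (rule g(4))
      from hs_bound_comp_right[OF b this u2_bcl[OF V], of 1]
      show "hs_bound (\<lambda>x. \<gamma> t (V x) - \<gamma> s (V x)) ((2 * \<bar>t - s\<bar>)\<^sup>2 * C)" by (simp add: u2_norm[OF V])
    qed
    then show ?thesis
      using connected_by_path[of "\<lambda>t. \<Phi> (\<lambda>x. \<gamma> t (V x))" C] near[OF u] by (simp add: g(1,2))
  qed
  obtain W1 W2 where W12: "u2_op W1" "u2_op W2" "\<And>x. x + W1 x = 0 \<Longrightarrow> x = 0"
    "\<And>x. x + W2 x = 0 \<Longrightarrow> x = 0" "W = (\<lambda>x. W1 (W2 (W2 x)))"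
    using u2_factorization[OF W] by blast
  show ?thesis
    unfolding W12(5)
    using cay[OF u2_id W12(2,4)] cay[OF W12(2) W12(2,4)] cay[OF u2_comp[OF W12(2,2)] W12(1,3)]
      connected_component_of_trans by metis
qed

lemma connected_left:
  assumes X: "near_pisom F X" and V: "u2_op V"
  shows "connected_component_of (parseval_near_topology (col F)) (col X) (col (\<lambda>x. V (X x)))"
proof (rule connected_unitary_family[of "\<lambda>V x. V (X x)", OF _ _ V])
  fix V W :: "'h \<Rightarrow> 'h" and C assume V: "u2_op V" and W: "u2_op W" and C: "hs_bound (\<lambda>x. V x - W x) C"
  have "bounded_clinear (\<lambda>x. V x - W x)" by (intro bounded_clinear_diff u2_bcl V W)
  from hs_bound_comp_right[OF this C near_pisomD(3)[OF X], of 1]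
  show "hs_bound (\<lambda>x. V (X x) - W (X x)) C" using pisom_norm_le[OF near_pisomD(1)[OF X]] by simp
qed (use near_pisom_orbit[OF X orbit_equivI[OF _ u2_id]] in simp)

lemma connected_right:
  assumes X: "near_pisom F X" and V: "u2_op V"
  shows "connected_component_of (parseval_near_topology (col F)) (col X) (col (\<lambda>x. X (V x)))"
proof (rule connected_unitary_family[of "\<lambda>V x. X (V x)", OF _ _ V])
  fix V W :: "ell2 \<Rightarrow> ell2" and C assume "hs_bound (\<lambda>x. V x - W x) C"
  from hs_bound_dominated[OF this, of "\<lambda>x. X (V x) - X (W x)" 1]
  show "hs_bound (\<lambda>x. X (V x) - X (W x)) C"
    using pisom_norm_le[OF near_pisomD(1)[OF X]] by (simp flip: bcl_diff[OF near_pisomD(3)[OF X]])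
qed (use near_pisom_orbit[OF X orbit_equivI[OF u2_id]] in simp)

lemma connected_component_frame_orbit:
  assumes X: "near_pisom F X"
  shows "connected_component_of_set (parseval_near_topology (col F)) (col X) = frame_orbit X"
proof
  let ?T = "parseval_near_topology (col F)"
  show "frame_orbit X \<subseteq> connected_component_of_set ?T (col X)"
  proof
    fix y assume "y \<in> frame_orbit X"
    then obtain Y where Y: "orbit_equiv X Y" "y = col Y" by (auto simp: frame_orbit_def)
    then obtain V W where VW: "u2_op V" "u2_op W" "Y = (\<lambda>x. V (X (W x)))" by (auto elim: orbit_equivE)
    have "near_pisom F (\<lambda>x. X (W x))" by (rule near_pisom_orbit[OF X orbit_equivI[OF u2_id VW(2)]])
    from connected_component_of_trans[OF connected_right[OF X VW(2)] connected_left[OF this VW(1)]]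
    show "y \<in> connected_component_of_set ?T (col X)" by (simp add: Y(2) VW(3))
  qed
  have topT: "topspace ?T = parseval_near (col F)" by (simp add: parseval_near_topology_def)
  have fo: "frame_orbit X = {col Y |Y. near_pisom F Y \<and> orbit_equiv X Y}"
    using near_pisom_orbit[OF X] by (auto simp: frame_orbit_def)
  have op: "openin ?T (frame_orbit X)"
    unfolding fo by (rule openin_union_orbits) (rule orbit_equiv_trans)
  have "openin ?T {col Y |Y. near_pisom F Y \<and> \<not> orbit_equiv X Y}"
  proof (rule openin_union_orbits)
    fix Y Z assume "\<not> orbit_equiv X Y" "orbit_equiv Y Z"
    then show "\<not> orbit_equiv X Z" using orbit_equiv_trans[OF _ orbit_equiv_sym] by blast
  qed
  moreover have "{col Y |Y. near_pisom F Y \<and> \<not> orbit_equiv X Y} = topspace ?T - frame_orbit X"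
  proof -
    have *: "col Y \<in> frame_orbit X \<longleftrightarrow> orbit_equiv X Y" if Y: "near_pisom F Y" for Y
    proof
      assume "col Y \<in> frame_orbit X"
      then obtain Z where Z: "near_pisom F Z" "orbit_equiv X Z" "col Y = col Z" unfolding fo by auto
      then show "orbit_equiv X Y" using col_inject[OF near_pisomD(3)[OF Y] near_pisomD(3)[OF Z(1)]] by simp
    qed (simp add: frame_orbit_def)
    show ?thesis
    proof (intro Set.set_eqI iffI)
      fix y assume "y \<in> {col Y |Y. near_pisom F Y \<and> \<not> orbit_equiv X Y}"
      then obtain Y where "y = col Y" "near_pisom F Y" "\<not> orbit_equiv X Y" by auto
      then show "y \<in> topspace ?T - frame_orbit X" using * parseval_near_col by (auto simp: topT)
    next
      fix y assume y: "y \<in> topspace ?T - frame_orbit X"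
      then obtain Y where Y: "near_pisom F Y" "y = col Y" using parseval_near_col by (auto simp: topT)
      then have "\<not> orbit_equiv X Y" using y * by simp
      then show "y \<in> {col Y |Y. near_pisom F Y \<and> \<not> orbit_equiv X Y}" using Y by auto
    qed
  qed
  ultimately have cl: "closedin ?T (frame_orbit X)"
    unfolding closedin_def using frame_orbit_subset[OF X] topT by simp
  have "col X \<in> frame_orbit X" using orbit_equiv_refl by (auto simp: frame_orbit_def)
  moreover have "col X \<in> connected_component_of_set ?T (col X)"
    using X topT parseval_near_col by (auto simp: connected_component_of_refl)
  ultimately show "connected_component_of_set ?T (col X) \<subseteq> frame_orbit X"
    using connectedin_clopen_cases[OF connectedin_connected_component_of cl op, of "col X"]
    by (auto simp: disjnt_def)
qed

section \<open>The group action\<close>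

lemma U2_action_col:
  assumes "u2_op V" "u2_op W" "near_pisom F X"
  shows "U2_action (col F) (V, W) (col X) = col (\<lambda>y. V (X (cadjoint W y)))"
proof -
  have "col X \<in> parseval_near (col F)" using assms(3) parseval_near_col by blast
  then show ?thesis
    by (simp add: U2_action_def synthesis_col[OF near_pisomD(3)[OF assms(3)]]) (simp add: col_def)
qed

end

lemma carrier_U2: "carrier U2 = {L. u2_op L}"
  by (simp add: U2_def u2_op_def)

lemma group_U2: "group U2"
proof (rule groupI)
  fix x y z :: "'a::chilbert_space \<Rightarrow> 'a"
  assume x: "x \<in> carrier U2"
  have ux: "u2_op x" using x by (simp add: carrier_U2)
  show "\<exists>y\<in>carrier U2. y \<otimes>\<^bsub>U2\<^esub> x = \<one>\<^bsub>U2\<^esub>"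
  proof (rule bexI[of _ "cadjoint x"])
    show "cadjoint x \<otimes>\<^bsub>U2\<^esub> x = \<one>\<^bsub>U2\<^esub>" by (simp add: U2_def fun_eq_iff u2_adj_left[OF ux])
    show "cadjoint x \<in> carrier U2" by (simp add: carrier_U2 u2_cadjoint[OF ux])
  qed
  assume "y \<in> carrier U2"
  with x show "x \<otimes>\<^bsub>U2\<^esub> y \<in> carrier U2"
    using u2_comp[of x y] by (simp add: carrier_U2) (simp add: U2_def comp_def)
qed (use u2_id in \<open>simp_all add: carrier_U2, simp_all add: U2_def id_def comp_def\<close>)

lemma orbit_U2_action:
  assumes F: "bounded_clinear F" and X: "near_pisom F X"
  shows "orbit (U2 \<times>\<times> U2) (U2_action (col F)) (col X) = frame_orbit X"
proof -
  have "y \<in> orbit (U2 \<times>\<times> U2) (U2_action (col F)) (col X) \<longleftrightarrow>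
      (\<exists>V W. u2_op V \<and> u2_op W \<and> y = col (\<lambda>x. V (X (cadjoint W x))))" for y
  proof
    assume "y \<in> orbit (U2 \<times>\<times> U2) (U2_action (col F)) (col X)"
    then obtain V W where "u2_op V" "u2_op W" "y = U2_action (col F) (V, W) (col X)"
      by (auto simp: orbit_def carrier_U2)
    then show "\<exists>V W. u2_op V \<and> u2_op W \<and> y = col (\<lambda>x. V (X (cadjoint W x)))"
      using U2_action_col[OF F _ _ X] by (intro exI[of _ V] exI[of _ W]) simp
  next
    assume "\<exists>V W. u2_op V \<and> u2_op W \<and> y = col (\<lambda>x. V (X (cadjoint W x)))"
    then obtain V W where VW: "u2_op V" "u2_op W" "y = col (\<lambda>x. V (X (cadjoint W x)))" by blast
    then have "y = U2_action (col F) (V, W) (col X)" by (simp add: U2_action_col[OF F _ _ X])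
    moreover have "(V, W) \<in> carrier (U2 \<times>\<times> U2)" using VW by (simp add: carrier_U2)
    ultimately show "y \<in> orbit (U2 \<times>\<times> U2) (U2_action (col F)) (col X)" unfolding orbit_def by blast
  qed
  moreover have "y \<in> frame_orbit X \<longleftrightarrow>
      (\<exists>V W. u2_op V \<and> u2_op W \<and> y = col (\<lambda>x. V (X (cadjoint W x))))" for y
  proof
    assume "y \<in> frame_orbit X"
    then obtain Y where Y: "orbit_equiv X Y" "y = col Y" by (auto simp: frame_orbit_def)
    then obtain V W where VW: "u2_op V" "u2_op W" "Y = (\<lambda>x. V (X (W x)))" by (auto elim: orbit_equivE)
    then show "\<exists>V W. u2_op V \<and> u2_op W \<and> y = col (\<lambda>x. V (X (cadjoint W x)))"
      using Y(2) u2_cadjoint[OF VW(2)] cadjoint_cadjoint[OF u2_bcl[OF VW(2)]]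
      by (intro exI[of _ V] exI[of _ "cadjoint W"]) simp
  next
    assume "\<exists>V W. u2_op V \<and> u2_op W \<and> y = col (\<lambda>x. V (X (cadjoint W x)))"
    then show "y \<in> frame_orbit X"
      using orbit_equivI[OF _ u2_cadjoint] unfolding frame_orbit_def by blast
  qed
  ultimately show ?thesis by blast
qed

lemma group_action_U2:
  fixes F :: "ell2 \<Rightarrow> 'h::chilbert_space"
  assumes F: "bounded_clinear F"
  shows "group_action (U2 \<times>\<times> U2) (parseval_near (col F)) (U2_action (col F))"
proof -
  let ?P = "parseval_near (col F)" and ?a = "U2_action (col F)"
  have act: "?a (V, W) (col X) = col (\<lambda>y. V (X (cadjoint W y)))" "col (\<lambda>y. V (X (cadjoint W y))) \<in> ?P"
    "near_pisom F (\<lambda>y. V (X (cadjoint W y)))"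
    if "u2_op V" "u2_op W" "near_pisom F X" for V W X
  proof -
    show "?a (V, W) (col X) = col (\<lambda>y. V (X (cadjoint W y)))" by (rule U2_action_col[OF F that])
    show "near_pisom F (\<lambda>y. V (X (cadjoint W y)))"
      by (rule near_pisom_orbit[OF that(3) orbit_equivI[OF that(1) u2_cadjoint[OF that(2)]]])
    then show "col (\<lambda>y. V (X (cadjoint W y))) \<in> ?P" using parseval_near_col[OF F] by blast
  qed
  have inv: "?a (V, W) (?a (cadjoint V, cadjoint W) x) = x" "?a (V, W) x \<in> ?P"
    if VW: "u2_op V" "u2_op W" and x: "x \<in> ?P" for V W x
  proof -
    obtain X where X: "near_pisom F X" "x = col X" using x parseval_near_col[OF F] by blast
    note a = u2_cadjoint[OF VW(1)] u2_cadjoint[OF VW(2)]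
    show "?a (V, W) (?a (cadjoint V, cadjoint W) x) = x"
      using act[OF a X(1)] act(1)[OF VW act(3)[OF a X(1)]]
      by (simp add: X(2) u2_adj_right[OF VW(1)] u2_adj_right[OF VW(2)] cadjoint_cadjoint[OF u2_bcl[OF VW(2)]])
    show "?a (V, W) x \<in> ?P" using act[OF VW X(1)] by (simp add: X(2))
  qed
  have bij: "?a (V, W) \<in> Bij ?P" if VW: "u2_op V" "u2_op W" for V W
    unfolding Bij_def
  proof
    show "?a (V, W) \<in> extensional ?P" by (simp add: U2_action_def)
    note a = u2_cadjoint[OF VW(1)] u2_cadjoint[OF VW(2)]
    have "bij_betw (?a (V, W)) ?P ?P"
    proof (rule bij_betwI[of _ _ _ "?a (cadjoint V, cadjoint W)"])
      show "?a (cadjoint V, cadjoint W) (?a (V, W) x) = x" if "x \<in> ?P" for x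
        using inv(1)[OF a that] by (simp add: cadjoint_cadjoint[OF u2_bcl[OF VW(1)]] cadjoint_cadjoint[OF u2_bcl[OF VW(2)]])
    qed (use inv[OF VW] inv(2)[OF a] in auto)
    then show "?a (V, W) \<in> {f. bij_betw f ?P ?P}" by simp
  qed
  have hom: "?a \<in> hom (U2 \<times>\<times> U2) (BijGroup ?P)"
  proof (rule homI)
    fix p :: "('h \<Rightarrow> 'h) \<times> (ell2 \<Rightarrow> ell2)" assume "p \<in> carrier (U2 \<times>\<times> U2)"
    then show "?a p \<in> carrier (BijGroup ?P)" using bij by (auto simp: carrier_U2 BijGroup_def)
  next
    fix p q :: "('h \<Rightarrow> 'h) \<times> (ell2 \<Rightarrow> ell2)"
    assume pq: "p \<in> carrier (U2 \<times>\<times> U2)" "q \<in> carrier (U2 \<times>\<times> U2)"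
    obtain V W where p: "p = (V, W)" by (cases p)
    obtain V' W' where q: "q = (V', W')" by (cases q)
    have VW: "u2_op V" "u2_op W" "u2_op V'" "u2_op W'" using pq by (simp_all add: p q carrier_U2)
    have "?a (\<lambda>x. V (V' x), \<lambda>x. W (W' x)) = compose ?P (?a (V, W)) (?a (V', W'))"
    proof
      fix x
      show "?a (\<lambda>x. V (V' x), \<lambda>x. W (W' x)) x = compose ?P (?a (V, W)) (?a (V', W')) x"
      proof (cases "x \<in> ?P")
        case True
        then obtain X where X: "near_pisom F X" "x = col X" using parseval_near_col[OF F] by blast
        have "compose ?P (?a (V, W)) (?a (V', W')) x = col (\<lambda>y. V (V' (X (cadjoint W' (cadjoint W y)))))"
          using True act(1)[OF VW(3,4) X(1)] act(1)[OF VW(1,2) act(3)[OF VW(3,4) X(1)]]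
          by (simp add: compose_def X(2))
        moreover have "?a (\<lambda>x. V (V' x), \<lambda>x. W (W' x)) x = col (\<lambda>y. V (V' (X (cadjoint W' (cadjoint W y)))))"
          using act(1)[OF u2_comp[OF VW(1,3)] u2_comp[OF VW(2,4)] X(1)]
          by (simp add: X(2) cadjoint_comp[OF u2_bcl[OF VW(2)] u2_bcl[OF VW(4)]])
        ultimately show ?thesis by simp
      qed (simp add: compose_def U2_action_def)
    qed
    then show "?a (p \<otimes>\<^bsub>U2 \<times>\<times> U2\<^esub> q) = ?a p \<otimes>\<^bsub>BijGroup ?P\<^esub> ?a q"
      using bij[OF VW(1,2)] bij[OF VW(3,4)] by (simp add: p q BijGroup_def) (simp add: U2_def comp_def)
  qed
  show ?thesis
    by (intro group_action.intro group_hom.intro group_hom_axioms.intro DirProd_group group_U2 group_BijGroup hom)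
qed

section \<open>The components of the set of nearby Parseval frames\<close>

lemma hdim_sum_infinite:
  fixes S T :: "'a::complex_inner set"
  assumes inf: "hdim (UNIV :: 'a set) = \<infinity>" and S: "csubspace S" and T: "csubspace T"
    and dec: "\<And>x. \<exists>s\<in>S. x - s \<in> T"
  shows "hdim S = \<infinity> \<or> hdim T = \<infinity>"
proof (rule ccontr)
  assume "\<not> ?thesis"
  then obtain G H where G: "finite G" "cspan G = S" and H: "finite H" "cspan H = T"
    using hdim_finiteE[OF S] hdim_finiteE[OF T] by metis
  have "x \<in> cspan (G \<union> H)" for x
  proof -
    obtain s where s: "s \<in> S" "x - s \<in> T" using dec by blast
    have "s \<in> cspan (G \<union> H)" "x - s \<in> cspan (G \<union> H)"
      using s G(2) H(2) complex_vector.span_mono[of G "G \<union> H"] complex_vector.span_mono[of H "G \<union> H"] by auto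
    from complex_vector.span_add[OF this] show ?thesis by simp
  qed
  then have "\<exists>B. finite B \<and> (UNIV :: 'a set) \<subseteq> cspan B" using G(1) H(1) by (intro exI[of _ "G \<union> H"]) auto
  then show False using inf unfolding hdim_def by simp
qed

lemma hdim_ell2: "hdim (UNIV :: ell2 set) = \<infinity>"
proof (cases "hdim (UNIV :: ell2 set)")
  case (enat m)
  have "enat (card (ell2_basis ` {..<Suc m})) \<le> hdim (UNIV :: ell2 set)"
    by (rule card_le_hdim) (simp_all add: orthonormal_ell2_basis)
  then show ?thesis using enat by (simp add: card_image inj_on_subset[OF inj_ell2_basis])
qed

lemma int_le_enat: "ereal (real_of_int k) \<le> ereal_of_enat n \<longleftrightarrow> enat (nat k) \<le> n"
  by (cases n) auto

lemma minus_enat_le_int: "- ereal_of_enat n \<le> ereal (real_of_int k) \<longleftrightarrow> enat (nat (- k)) \<le> n"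
  by (cases n) auto

theorem proposition3p3:
  fixes K :: "'h::chilbert_space set" and f :: "nat \<Rightarrow> 'h"
    and F U :: "ell2 \<Rightarrow> 'h" and absF :: "ell2 \<Rightarrow> ell2"
    and n1 n2 n3 :: enat and J :: "int set"
  assumes infinite_dimensional: "hdim (UNIV :: 'h set) = \<infinity>"
    and separable: "\<exists>D :: 'h set. countable D \<and> closure D = UNIV"
    and frame: "frame_in K f"
    and nonempty: "parseval_near f \<noteq> {}"
    and F: "F = synthesis f"
    and U: "polar_decomposition F U absF"
    and n1: "n1 = hdim (op_ker F)"
    and n2: "n2 = hdim (ortho_compl (op_ker F))"
    and n3: "n3 = hdim (ortho_compl (range F))"
    and J: "J = {k. - ereal_of_enat (min n1 n3) \<le> ereal (real_of_int k) \<and>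
                    ereal (real_of_int k) \<le> ereal_of_enat n2}"
  shows "\<exists>Q :: int \<Rightarrow> (nat \<Rightarrow> 'h) set.
      infinite J \<and>
      bij_betw Q J (connected_components_of (parseval_near_topology f)) \<and>
      parseval_near f = (\<Union>k\<in>J. Q k) \<and>
      group_action (U2 \<times>\<times> U2) (parseval_near f) (U2_action f) \<and>
      (\<forall>k\<in>J.
        Q k = {x \<in> parseval_near f.
                 fredholm_pair (cadjoint U \<circ> U) (cadjoint (synthesis x) \<circ> synthesis x) \<and>
                 pair_index (cadjoint U \<circ> U) (cadjoint (synthesis x) \<circ> synthesis x) = k} \<and>
        Q k = {x \<in> parseval_near f.
                 fredholm_pair (U \<circ> cadjoint U) (synthesis x \<circ> cadjoint (synthesis x)) \<and>
                 pair_index (U \<circ> cadjoint U) (synthesis x \<circ> cadjoint (synthesis x)) = k} \<and>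
        Q k = {x \<in> parseval_near f. \<exists>L. L = closure (cspan (range x)) \<and>
                 fredholm K L (synthesis x \<circ> cadjoint U) \<and>
                 fredholm_index K L (synthesis x \<circ> cadjoint U) = k} \<and>
        Q k \<in> orbits (U2 \<times>\<times> U2) (parseval_near f) (U2_action f))"
proof -
  note can = canonical_parseval[OF frame nonempty F U]
  note bF = can(1) and colF = can(2) and pU = can(3) and hsU = can(4) and rU = can(5)
  note n1' = n1[unfolded can(6)] and n2' = n2[unfolded can(7)] and n3' = n3[unfolded can(8)]
  have J': "k \<in> J \<longleftrightarrow> enat (nat k) \<le> n2 \<and> enat (nat (- k)) \<le> n1 \<and> enat (nat (- k)) \<le> n3" for k
    unfolding J by (auto simp: int_le_enat minus_enat_le_int)
  have sub: "csubspace {x. cadjoint U (U x) = 0}" "csubspace {y. U (cadjoint U y) = 0}"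
    "csubspace {x. cadjoint U (U x) = x}"
    using closed_csubspace_kernel[OF is_projD(1)[OF pisom_initial[OF pU]]]
      closed_csubspace_kernel[OF is_projD(1)[OF pisom_final[OF pU]]] closed_initial[OF pU]
    by (simp_all add: closed_csubspace_def)
  \<comment> \<open>The sequence space is the sum of the kernel and its orthogonal complement, the Hilbert space the
    sum of the range and its orthogonal complement, and the range has dimension \<open>n2\<close>.\<close>
  have inf12: "n2 = \<infinity> \<or> n1 = \<infinity>"
    unfolding n1' n2'
  proof (rule hdim_sum_infinite[OF hdim_ell2 sub(3,1)])
    fix x
    show "\<exists>s\<in>{x. cadjoint U (U x) = x}. x - s \<in> {x. cadjoint U (U x) = 0}"
      by (rule bexI[of _ "cadjoint U (U x)"])
         (simp_all add: bcl_diff[OF pisom_bcl[OF pU]] pisom_eq[OF pU] bcl_zero[OF pisom_bcl_adj[OF pU]])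
  qed
  have inf23: "n2 = \<infinity> \<or> n3 = \<infinity>"
  proof (rule ccontr)
    assume not: "\<not> (n2 = \<infinity> \<or> n3 = \<infinity>)"
    then obtain E where E: "finite E" "orthonormal E" "cspan E = {x. cadjoint U (U x) = x}"
      using hdim_finiteE[OF sub(3)] n2' by metis
    have "cspan (U ` E) = {y. U (cadjoint U y) = y}" "finite (U ` E)" "orthonormal (U ` E)"
      using cspan_image_initial[OF pU E(1,2), of "\<lambda>_. 0"] E(3) by simp_all
    then have "hdim {y. U (cadjoint U y) = y} \<noteq> \<infinity>" using hdim_cspan[of "U ` E"] by simp
    moreover have "hdim {y. U (cadjoint U y) = y} = \<infinity> \<or> hdim {y. U (cadjoint U y) = 0} = \<infinity>"
    proof (rule hdim_sum_infinite[OF infinite_dimensional _ sub(2)])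
      show "csubspace {y. U (cadjoint U y) = y}"
        using pisom_range[OF pU] by (simp add: closed_csubspace_def)
      fix y
      show "\<exists>s\<in>{y. U (cadjoint U y) = y}. y - s \<in> {y. U (cadjoint U y) = 0}"
        by (rule bexI[of _ "U (cadjoint U y)"])
           (simp_all add: bcl_diff[OF pisom_bcl_adj[OF pU]] pisom_adj_eq[OF pU] bcl_zero[OF pisom_bcl[OF pU]])
    qed
    ultimately have "hdim {y. U (cadjoint U y) = 0} = \<infinity>" by metis
    then show False using not unfolding n3' by metis
  qed
  have infJ: "infinite J"
  proof (cases "n2 = \<infinity>")
    case True
    then have "range int \<subseteq> J" by (auto simp: J' zero_enat_def[symmetric])
    then show ?thesis using infinite_super range_inj_infinite[of int] by (metis inj_of_nat)
  next
    case False
    then have "range (\<lambda>n. - int n) \<subseteq> J" using inf12 inf23 by (auto simp: J' zero_enat_def[symmetric])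
    moreover have "infinite (range (\<lambda>n. - int n))" by (rule range_inj_infinite) (simp add: inj_on_def)
    ultimately show ?thesis using infinite_super by blast
  qed
  have XU: "hilbert_schmidt (\<lambda>x. X x - U x)" if "near_pisom F X" for X
    using hs_diff[OF near_pisomD(2)[OF that] hsU] by simp
  have near: "near_pisom F X" if "pisom X" "hilbert_schmidt (\<lambda>x. X x - U x)" for X
    using hs_add[OF hsU that(2)] that(1) by (simp add: near_pisom_def)
  have P: "x \<in> parseval_near f \<longleftrightarrow> (\<exists>X. near_pisom F X \<and> x = col X)" for x
    using parseval_near_col[OF bF] by (simp add: colF)
  \<comment> \<open>The components are labelled by the relative index.\<close>
  define Q where "Q k = {col X |X. near_pisom F X \<and> rel_index U X k}" for k
  have QX: "col X \<in> Q k \<longleftrightarrow> rel_index U X k" if X: "near_pisom F X" for X k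
  proof
    assume "col X \<in> Q k"
    then obtain Y where Y: "near_pisom F Y" "rel_index U Y k" "col X = col Y" by (auto simp: Q_def)
    have "X = Y" by (rule col_inject[OF near_pisomD(3)[OF X] near_pisomD(3)[OF Y(1)] Y(3)])
    then show "rel_index U X k" using Y(2) by simp
  qed (use X in \<open>auto simp: Q_def\<close>)
  have Q_orbit: "Q k = frame_orbit X" if X: "near_pisom F X" and k: "rel_index U X k" for X k
  proof
    show "Q k \<subseteq> frame_orbit X"
    proof
      fix x assume "x \<in> Q k"
      then obtain Z where Z: "near_pisom F Z" "rel_index U Z k" "x = col Z" by (auto simp: Q_def)
      have "orbit_equiv X Z"
        by (rule rel_index_orbit_equiv[OF pU near_pisomD(1)[OF X] near_pisomD(1)[OF Z(1)] k Z(2)])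
      then show "x \<in> frame_orbit X" by (simp add: frame_orbit_def Z(3))
    qed
    show "frame_orbit X \<subseteq> Q k"
      using near_pisom_orbit[OF X] rel_index_invariant[OF k] unfolding Q_def frame_orbit_def by blast
  qed
  have ind: "\<exists>k\<in>J. rel_index U X k \<and> indices_eq U X k" if X: "near_pisom F X" for X
  proof (rule three_indices[OF pU near_pisomD(1)[OF X] XU[OF X]])
    fix k assume "rel_index U X k" "indices_eq U X k" "enat (nat k) \<le> hdim {x. cadjoint U (U x) = x}"
      "enat (nat (- k)) \<le> hdim {x. cadjoint U (U x) = 0}"
      "enat (nat (- k)) \<le> hdim {y. U (cadjoint U y) = 0}"
    then show ?thesis by (intro bexI[of _ k]) (simp_all add: J' n1' n2' n3')
  qed
  have real: "\<exists>X. near_pisom F X \<and> rel_index U X k" if "k \<in> J" for k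
  proof -
    have "enat (nat k) \<le> hdim {x. cadjoint U (U x) = x}" "enat (nat (- k)) \<le> hdim {x. cadjoint U (U x) = 0}"
      "enat (nat (- k)) \<le> hdim {y. U (cadjoint U y) = 0}"
      using that unfolding J' n1' n2' n3' by simp_all
    from rel_index_realized[OF pU this] show ?thesis using near by blast
  qed
  have comp: "connected_component_of_set (parseval_near_topology f) (col X) = frame_orbit X"
    if "near_pisom F X" for X
    using connected_component_frame_orbit[OF bF that] by (simp add: colF)
  have topP: "topspace (parseval_near_topology f) = parseval_near f"
    unfolding parseval_near_topology_def
    by (rule Metric_space.topspace_mtopology[OF Metric_space_parseval_near])
  have union: "parseval_near f = (\<Union>k\<in>J. Q k)"
  proof
    show "parseval_near f \<subseteq> (\<Union>k\<in>J. Q k)"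
    proof
      fix x assume "x \<in> parseval_near f"
      then obtain X where X: "near_pisom F X" "x = col X" using P by metis
      obtain k where "k \<in> J" "rel_index U X k" using ind[OF X(1)] by blast
      then show "x \<in> (\<Union>k\<in>J. Q k)" using QX[OF X(1), of k] X(2) by auto
    qed
    show "(\<Union>k\<in>J. Q k) \<subseteq> parseval_near f"
    proof
      fix x assume "x \<in> (\<Union>k\<in>J. Q k)"
      then obtain X where "near_pisom F X" "x = col X" by (auto simp: Q_def)
      then show "x \<in> parseval_near f" using P by metis
    qed
  qed
  have bij: "bij_betw Q J (connected_components_of (parseval_near_topology f))"
    unfolding bij_betw_def
  proof
    show "inj_on Q J"
    proof (rule inj_onI)
      fix k l assume k: "k \<in> J" and eq: "Q k = Q l"
      obtain X where X: "near_pisom F X" "rel_index U X k" using real[OF k] by blast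
      then have "rel_index U X l" using QX[OF X(1), of k] QX[OF X(1), of l] eq by simp
      then show "k = l" by (rule rel_index_unique[OF pU near_pisomD(1)[OF X(1)] X(2)])
    qed
    show "Q ` J = connected_components_of (parseval_near_topology f)"
      unfolding connected_components_of_def topP
    proof (intro Set.set_eqI iffI)
      fix C assume "C \<in> Q ` J"
      then obtain k where k: "k \<in> J" "C = Q k" by blast
      obtain X where X: "near_pisom F X" "rel_index U X k" using real[OF k(1)] by blast
      have "C = connected_component_of_set (parseval_near_topology f) (col X)"
        unfolding k(2) comp[OF X(1)] by (rule Q_orbit[OF X])
      moreover have "col X \<in> parseval_near f" using P X(1) by metis
      ultimately show "C \<in> connected_component_of_set (parseval_near_topology f) ` parseval_near f"
        by (rule image_eqI)
    next
      fix C assume "C \<in> connected_component_of_set (parseval_near_topology f) ` parseval_near f"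
      then obtain x where x: "x \<in> parseval_near f" "C = connected_component_of_set (parseval_near_topology f) x"
        by blast
      then obtain X where X: "near_pisom F X" "x = col X" using P by metis
      obtain k where k: "k \<in> J" "rel_index U X k" using ind[OF X(1)] by blast
      have "C = Q k" unfolding x(2) X(2) comp[OF X(1)] by (rule Q_orbit[OF X(1) k(2), symmetric])
      then show "C \<in> Q ` J" using k(1) by blast
    qed
  qed
  have act: "group_action (U2 \<times>\<times> U2) (parseval_near f) (U2_action f)"
    using group_action_U2[OF bF] by (simp add: colF)
  have char: "Q k = {x \<in> parseval_near f. R x}"
    if R: "\<And>X. near_pisom F X \<Longrightarrow> R (col X) \<longleftrightarrow> rel_index U X k" for R k
  proof (intro Set.set_eqI iffI)
    fix x assume "x \<in> Q k"
    then obtain X where "x = col X" "near_pisom F X" "rel_index U X k" by (auto simp: Q_def)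
    then show "x \<in> {x \<in> parseval_near f. R x}" using R P by (metis (mono_tags, lifting) mem_Collect_eq)
  next
    fix x assume x: "x \<in> {x \<in> parseval_near f. R x}"
    then obtain X where X: "near_pisom F X" "x = col X" using P by (metis (mono_tags, lifting) mem_Collect_eq)
    then have "rel_index U X k" using R[OF X(1)] x by simp
    then show "x \<in> Q k" using QX[OF X(1)] X(2) by simp
  qed
  have chars: "Q k = {x \<in> parseval_near f.
                 fredholm_pair (cadjoint U \<circ> U) (cadjoint (synthesis x) \<circ> synthesis x) \<and>
                 pair_index (cadjoint U \<circ> U) (cadjoint (synthesis x) \<circ> synthesis x) = k}"
    "Q k = {x \<in> parseval_near f.
                 fredholm_pair (U \<circ> cadjoint U) (synthesis x \<circ> cadjoint (synthesis x)) \<and>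
                 pair_index (U \<circ> cadjoint U) (synthesis x \<circ> cadjoint (synthesis x)) = k}"
    "Q k = {x \<in> parseval_near f. \<exists>L. L = closure (cspan (range x)) \<and>
                 fredholm K L (synthesis x \<circ> cadjoint U) \<and>
                 fredholm_index K L (synthesis x \<circ> cadjoint U) = k}" for k
  proof -
    have s: "synthesis (col X) = X" "closure (cspan (range (col X))) = range X" if X: "near_pisom F X" for X
      by (rule synthesis_col[OF near_pisomD(3)[OF X]], rule closure_cspan_col[OF near_pisomD(1)[OF X]])
    have i: "\<exists>l. (rel_index U X k \<longleftrightarrow> l = k) \<and> indices_eq U X l" if X: "near_pisom F X" for X
    proof -
      obtain l where l: "rel_index U X l" "indices_eq U X l" using ind[OF X] by blast
      have "l = k" if "rel_index U X k" by (rule rel_index_unique[OF pU near_pisomD(1)[OF X] l(1) that])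
      then have "rel_index U X k \<longleftrightarrow> l = k" using l(1) by auto
      then show ?thesis using l(2) by (intro exI[of _ l] conjI)
    qed
    show "Q k = {x \<in> parseval_near f.
                 fredholm_pair (cadjoint U \<circ> U) (cadjoint (synthesis x) \<circ> synthesis x) \<and>
                 pair_index (cadjoint U \<circ> U) (cadjoint (synthesis x) \<circ> synthesis x) = k}"
    proof (rule char)
      fix X assume X: "near_pisom F X"
      show "fredholm_pair (cadjoint U \<circ> U) (cadjoint (synthesis (col X)) \<circ> synthesis (col X)) \<and>
          pair_index (cadjoint U \<circ> U) (cadjoint (synthesis (col X)) \<circ> synthesis (col X)) = k
        \<longleftrightarrow> rel_index U X k"
        unfolding s(1)[OF X] using i[OF X] unfolding indices_eq_def by metis
    qed
    show "Q k = {x \<in> parseval_near f.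
                 fredholm_pair (U \<circ> cadjoint U) (synthesis x \<circ> cadjoint (synthesis x)) \<and>
                 pair_index (U \<circ> cadjoint U) (synthesis x \<circ> cadjoint (synthesis x)) = k}"
    proof (rule char)
      fix X assume X: "near_pisom F X"
      show "fredholm_pair (U \<circ> cadjoint U) (synthesis (col X) \<circ> cadjoint (synthesis (col X))) \<and>
          pair_index (U \<circ> cadjoint U) (synthesis (col X) \<circ> cadjoint (synthesis (col X))) = k
        \<longleftrightarrow> rel_index U X k"
        unfolding s(1)[OF X] using i[OF X] unfolding indices_eq_def by metis
    qed
    show "Q k = {x \<in> parseval_near f. \<exists>L. L = closure (cspan (range x)) \<and>
                 fredholm K L (synthesis x \<circ> cadjoint U) \<and>
                 fredholm_index K L (synthesis x \<circ> cadjoint U) = k}"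
    proof (rule char)
      fix X assume X: "near_pisom F X"
      obtain l where "rel_index U X k \<longleftrightarrow> l = k" "indices_eq U X l" using i[OF X] by (elim exE conjE)
      then have "rel_index U X k \<longleftrightarrow> l = k" "fredholm K (range X) (X \<circ> cadjoint U)"
        "fredholm_index K (range X) (X \<circ> cadjoint U) = l"
        unfolding indices_eq_def rU by simp_all
      then show "(\<exists>L. L = closure (cspan (range (col X))) \<and>
          fredholm K L (synthesis (col X) \<circ> cadjoint U) \<and>
          fredholm_index K L (synthesis (col X) \<circ> cadjoint U) = k) \<longleftrightarrow> rel_index U X k"
        by (simp add: s(1)[OF X] s(2)[OF X])
    qed
  qed
  have orb: "Q k \<in> orbits (U2 \<times>\<times> U2) (parseval_near f) (U2_action f)" if k: "k \<in> J" for k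
  proof -
    obtain X where X: "near_pisom F X" "rel_index U X k" using real[OF k] by blast
    have "Q k = orbit (U2 \<times>\<times> U2) (U2_action f) (col X)"
      using Q_orbit[OF X] orbit_U2_action[OF bF X(1)] by (simp add: colF)
    moreover have "col X \<in> parseval_near f" using P X(1) by metis
    ultimately show ?thesis unfolding orbits_def by auto
  qed
  show ?thesis
    by (rule exI[of _ Q], intro conjI ballI infJ bij union act)
       (rule chars(1), rule chars(2), rule chars(3), erule orb)
qed

end
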